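(* For every $\beta\ge0$ and $\mathbf n\in S^{d-1}$ there exists $\tau^q_\beta(\mathbf n)\ge 0$ (the quenched surface tension) such that, for every $\mathcal S\in\mathbb S_{\mathbf n}$ and every $\delta>0$, $$\lim_{N\to\infty}\tau^J_{\mathcal R_{0,N,\delta N}(\mathcal S,\mathbf n)}=\tau^q_\beta(\mathbf n)\quad\text{in }\mathbb P\text{-probability}.$$ (The limit does not depend on $\mathcal S$ nor on $\delta$.)
   Context: Fix $d\ge 2$, $q\ge 1$, $\beta\ge 0$. For $x,y\in\mathbb Z^d$ write $x\sim y$ if $\|x-y\|_2=1$; for $\Lambda\subset\mathbb Z^d$ let $E(\Lambda)=\{\{x,y\}:x,y\in\Lambda,\ x\sim y\}$. The couplings $J=(J_e)_{e\in E(\mathbb Z^d)}$ are i.i.d. with values in $[0,1]$ under the product measure $\mathbb P$. Random cluster model: for finite $E\subset E(\mathbb Z^d)$, boundary condition $\pi\in\{0,1\}^{E^c}$ and $\omega\in\{0,1\}^E$, $\Phi^{J,\pi,q}_{E,\beta}(\{\omega\})=\frac1Z\prod_{e\in E}p_e^{\omega_e}(1-p_e)^{1-\omega_e}\,q^{C^\pi_E(\omega)}$ with $p_e=1-e^{-\beta J_e}$, where $C^\pi_E(\omega)$ is the number of clusters of the set of vertices touched by $E$ when connections use the open edges of $\omega$ in $E$ and of $\pi$ outside $E$, and $Z$ is the normalizing constant. The boundary condition $w$ (wired) is $\pi\equiv1$. Geometry: $S^{d-1}$ is the Euclidean unit sphere. For $\mathbf n\in S^{d-1}$, $\mathbb S_{\mathbf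 n}$ is the set of the $(d-1)$-dimensional unit cubes $\{\sum_{k=1}^{d-1}t_k\mathbf u_k: t_k\in[-\frac12,\frac12]\}$ with $(\mathbf u_1,\dots,\mathbf u_{d-1},\mathbf n)$ an orthonormal basis of $\mathbb R^d$. $\mathcal R_{x,L,H}(\mathcal S,\mathbf n)=x+L\mathcal S+[-H,H]\mathbf n$. For such $\mathcal R$, $\hat{\mathcal R}$ is the set of points of $\mathbb Z^d$ in the interior of $\mathcal R$; $\partial\hat{\mathcal R}=\{y\in\hat{\mathcal R}:\exists z\in\mathbb Z^d\setminus\hat{\mathcal R},\ z\sim y\}$; $\partial^+\hat{\mathcal R}=\{y\in\partial\hat{\mathcal R}:(y-x)\cdot\mathbf n\ge0\}$, $\partial^-\hat{\mathcal R}=\{y\in\partial\hat{\mathcal R}:(y-x)\cdot\mathbf n<0\}$. $\Phi^{J,w}_{\mathcal R}$ is $\Phi^{J,w,q}_{E(\hat{\mathcal R}),\beta}$. Surface tension: $\mathcal D_{\mathcal R}$ is the event that no $\omega$-open path in $E(\hat{\mathcal R})$ joins $\partial^+\hat{\mathcal R}$ to $\partial^-\hat{\mathcal R}$, and $\tau^J_{\mathcal R}=-\frac1{L^{d-1}}\log\Phi^{J,w}_{\mathcal R}(\mathcal D_{\mathcal R})$. *)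

theory Defs
  imports "HOL-Probability.Probability"
begin

section \<open>The lattice and its edges\<close>

text \<open>\<open>\<int>\<^sup>d\<close> is realised as the set of integer points of \<open>real ^ 'd\<close>, with \<open>d = CARD('d)\<close>.
  Edges are unordered pairs, i.e. two-element sets of vertices.\<close>

definition int_lattice :: "(real ^ 'd) set" where
  "int_lattice = {x. \<forall>i. x $ i \<in> \<int>}"

definition adj :: "real ^ 'd \<Rightarrow> real ^ 'd \<Rightarrow> bool" where
  "adj x y \<longleftrightarrow> norm (x - y) = 1"

definition edges_in :: "(real ^ 'd) set \<Rightarrow> (real ^ 'd) set set" where
  "edges_in \<Lambda> = {{x, y} | x y. x \<in> \<Lambda> \<and> y \<in> \<Lambda> \<and> adj x y}"

abbreviation all_edges :: "(real ^ 'd) set set" where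
  "all_edges \<equiv> edges_in int_lattice"

section \<open>The random cluster model\<close>

text \<open>A configuration on \<open>E\<close> is an extensional function from \<open>E\<close> to \<open>{0, 1}\<close> (1 means open).\<close>

definition configs :: "(real ^ 'd) set set \<Rightarrow> ((real ^ 'd) set \<Rightarrow> nat) set" where
  "configs E = (E \<rightarrow>\<^sub>E {0, 1})"

definition connected_via :: "(real ^ 'd) set set \<Rightarrow> ((real ^ 'd) \<times> (real ^ 'd)) set" where
  "connected_via F = {(x, y). {x, y} \<in> F}\<^sup>*"

definition open_edges ::
  "(real ^ 'd) set set \<Rightarrow> ((real ^ 'd) set \<Rightarrow> nat) \<Rightarrow> (real ^ 'd) set set" where
  "open_edges E \<omega> = {e \<in> E. \<omega> e = 1}"

text \<open>The vertices touched by \<open>E\<close> are \<open>\<Union>E\<close>; the quotient below is the set of those clusters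
  of the lattice (for the open edges of \<open>\<omega>\<close> in \<open>E\<close> and of \<open>\<pi>\<close> outside \<open>E\<close>) that meet \<open>\<Union>E\<close>.\<close>

definition num_clusters ::
  "(real ^ 'd) set set \<Rightarrow> ((real ^ 'd) set \<Rightarrow> nat) \<Rightarrow> ((real ^ 'd) set \<Rightarrow> nat) \<Rightarrow> nat" where
  "num_clusters E \<pi> \<omega> =
     card (\<Union>E // connected_via (open_edges E \<omega> \<union> open_edges (all_edges - E) \<pi>))"

definition edge_prob :: "real \<Rightarrow> ((real ^ 'd) set \<Rightarrow> real) \<Rightarrow> (real ^ 'd) set \<Rightarrow> real" where
  "edge_prob \<beta> J e = 1 - exp (- \<beta> * J e)"

definition rc_weight ::
  "(real ^ 'd) set set \<Rightarrow> real \<Rightarrow> real \<Rightarrow> ((real ^ 'd) set \<Rightarrow> real) \<Rightarrow> ((real ^ 'd) set \<Rightarrow> nat)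
    \<Rightarrow> ((real ^ 'd) set \<Rightarrow> nat) \<Rightarrow> real" where
  "rc_weight E \<beta> q J \<pi> \<omega> =
     (\<Prod>e\<in>E. edge_prob \<beta> J e ^ \<omega> e * (1 - edge_prob \<beta> J e) ^ (1 - \<omega> e))
       * q ^ num_clusters E \<pi> \<omega>"

definition rc_partition ::
  "(real ^ 'd) set set \<Rightarrow> real \<Rightarrow> real \<Rightarrow> ((real ^ 'd) set \<Rightarrow> real) \<Rightarrow> ((real ^ 'd) set \<Rightarrow> nat)
    \<Rightarrow> real" where
  "rc_partition E \<beta> q J \<pi> = (\<Sum>\<omega>\<in>configs E. rc_weight E \<beta> q J \<pi> \<omega>)"

definition rc_measure ::
  "(real ^ 'd) set set \<Rightarrow> real \<Rightarrow> real \<Rightarrow> ((real ^ 'd) set \<Rightarrow> real) \<Rightarrow> ((real ^ 'd) set \<Rightarrow> nat)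
    \<Rightarrow> ((real ^ 'd) set \<Rightarrow> nat) measure" where
  "rc_measure E \<beta> q J \<pi> =
     point_measure (configs E)
       (\<lambda>\<omega>. ennreal (rc_weight E \<beta> q J \<pi> \<omega> / rc_partition E \<beta> q J \<pi>))"

text \<open>Only the values of a boundary condition on \<open>all_edges - E\<close> matter, so one function serves as
  the wired boundary condition for every \<open>E\<close>.\<close>

definition wired :: "(real ^ 'd) set \<Rightarrow> nat" where
  "wired = (\<lambda>_. 1)"

section \<open>Geometry\<close>

text \<open>The indices \<open>1, \<dots>, d - 1\<close> range over \<open>{1..<CARD('d)}\<close>.\<close>

definition orthonormal_basis_with :: "(nat \<Rightarrow> real ^ 'd) \<Rightarrow> real ^ 'd \<Rightarrow> bool" where
  "orthonormal_basis_with u n \<longleftrightarrow>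
     (\<forall>i\<in>{1..<CARD('d)}. \<forall>j\<in>{1..<CARD('d)}. u i \<bullet> u j = (if i = j then 1 else 0)) \<and>
     (\<forall>i\<in>{1..<CARD('d)}. u i \<bullet> n = 0) \<and> n \<bullet> n = 1 \<and>
     span (insert n (u ` {1..<CARD('d)})) = UNIV"

definition unit_cubes :: "real ^ 'd \<Rightarrow> (real ^ 'd) set set" where
  "unit_cubes n =
     {{\<Sum>k\<in>{1..<CARD('d)}. t k *\<^sub>R u k | t. \<forall>k\<in>{1..<CARD('d)}. t k \<in> {-1/2..1/2}} | u.
        orthonormal_basis_with u n}"

definition box_set ::
  "real ^ 'd \<Rightarrow> real \<Rightarrow> real \<Rightarrow> (real ^ 'd) set \<Rightarrow> real ^ 'd \<Rightarrow> (real ^ 'd) set" where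
  "box_set x L H S n = {x + L *\<^sub>R s + h *\<^sub>R n | s h. s \<in> S \<and> h \<in> {-H..H}}"

definition lattice_interior :: "(real ^ 'd) set \<Rightarrow> (real ^ 'd) set" where
  "lattice_interior R = int_lattice \<inter> interior R"

definition inner_boundary :: "(real ^ 'd) set \<Rightarrow> (real ^ 'd) set" where
  "inner_boundary V = {y \<in> V. \<exists>z \<in> int_lattice - V. adj z y}"

definition upper_boundary :: "real ^ 'd \<Rightarrow> real ^ 'd \<Rightarrow> (real ^ 'd) set \<Rightarrow> (real ^ 'd) set" where
  "upper_boundary x n V = {y \<in> inner_boundary V. (y - x) \<bullet> n \<ge> 0}"

definition lower_boundary :: "real ^ 'd \<Rightarrow> real ^ 'd \<Rightarrow> (real ^ 'd) set \<Rightarrow> (real ^ 'd) set" where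
  "lower_boundary x n V = {y \<in> inner_boundary V. (y - x) \<bullet> n < 0}"

section \<open>Surface tension\<close>

text \<open>In the following two definitions \<open>V\<close> stands for the lattice points of the interior of the
  box, whose centre \<open>x\<close> and normal \<open>n\<close> determine the upper and lower boundary.\<close>

definition disconnection_event ::
  "real ^ 'd \<Rightarrow> real ^ 'd \<Rightarrow> (real ^ 'd) set \<Rightarrow> ((real ^ 'd) set \<Rightarrow> nat) set" where
  "disconnection_event x n V =
     {\<omega> \<in> configs (edges_in V).
        \<not> (\<exists>y\<in>upper_boundary x n V. \<exists>z\<in>lower_boundary x n V.
             (y, z) \<in> connected_via (open_edges (edges_in V) \<omega>))}"

definition surface_tension ::
  "real \<Rightarrow> real \<Rightarrow> ((real ^ 'd) set \<Rightarrow> real) \<Rightarrow> real ^ 'd \<Rightarrow> real \<Rightarrow> real \<Rightarrow> (real ^ 'd) set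
    \<Rightarrow> real ^ 'd \<Rightarrow> real" where
  "surface_tension \<beta> q J x L H S n =
     (let V = lattice_interior (box_set x L H S n)
      in - (1 / L ^ (CARD('d) - 1)) *
           ln (measure (rc_measure (edges_in V) \<beta> q J wired) (disconnection_event x n V)))"

section \<open>Random couplings and convergence in probability\<close>

definition coupling_law :: "real measure \<Rightarrow> bool" where
  "coupling_law \<mu> \<longleftrightarrow> prob_space \<mu> \<and> sets \<mu> = sets (restrict_space borel {0..1})"

definition couplings :: "real measure \<Rightarrow> ((real ^ 'd) set \<Rightarrow> real) measure" where
  "couplings \<mu> = Pi\<^sub>M all_edges (\<lambda>_. \<mu>)"

text \<open>Measurability is part of the notion: \<^const>\<open>measure\<close> is 0 on non-measurable sets, so the
  limit alone would say nothing about non-measurable functions.\<close>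

definition converges_in_probability ::
  "'w measure \<Rightarrow> (nat \<Rightarrow> 'w \<Rightarrow> real) \<Rightarrow> real \<Rightarrow> bool" where
  "converges_in_probability M X c \<longleftrightarrow>
     (\<forall>N. X N \<in> borel_measurable M) \<and>
     (\<forall>\<epsilon>>0. (\<lambda>N. measure M {\<omega> \<in> space M. \<bar>X N \<omega> - c\<bar> > \<epsilon>}) \<longlonglongrightarrow> 0)"

end

theory Submission
  imports Defs
begin

text \<open>Write \<open>c(R)\<close> for minus the logarithm of the wired probability of disconnection in a box
\<open>R\<close>, so that the surface tension is \<open>c(R) / L\<^sup>d\<^sup>-\<^sup>1\<close>.  The limit exists because \<open>c\<close> is subadditive up to a
surface error, and it is deterministic because the blocks of a tiling are independent.

\<^emph>\<open>Subadditivity.\<close>  Place disjoint small boxes \<open>R\<^sub>i\<close> of side \<open>l\<close> along the mid-hyperplane of a box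
\<open>R\<close> of side \<open>N\<close>.  If disconnection holds in every \<open>R\<^sub>i\<close> and all edges of \<open>R\<close> that lie near the
hyperplane but in no \<open>R\<^sub>i\<close> (the \<^emph>\<open>seam\<close>) are closed, then the disconnecting surfaces glue to one of
\<open>R\<close> (\<open>separating_glue\<close>).  Disconnection is a decreasing event, and for \<open>q \<ge> 1\<close> the wired measure on
\<open>R\<^sub>i\<close> dominates the conditional law on \<open>R\<^sub>i\<close> given everything else.  Hence the events cost at most the
sum of their separate costs, plus \<open>\<beta>\<close> for each edge of the seam
(\<open>minus_ln_wired_prob_subadditive\<close>).  The domination is positive association: opening an edge merges
fewer clusters when more edges are open, so the number of clusters is a supermodular function of the
set of open edges, and the four functions theorem applies.

\<^emph>\<open>Geometry.\<close>  The small boxes may have another tangential orientation and another ratio of height to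
side than \<open>R\<close>.  They are centred at lattice points near the points of a tilted grid, so that by
translation invariance their costs have the law of \<open>c\<close> for the box centred at \<open>0\<close>; the grid spacing
\<open>l + 2 d\<close> absorbs the displacement.  Comparing volumes shows that the number of boxes is at most
\<open>(N / l)\<^sup>d\<^sup>-\<^sup>1\<close> and that the seam has at most \<open>\<eta>(l) N\<^sup>d\<^sup>-\<^sup>1\<close> edges for large \<open>N\<close>, with
\<open>\<eta>(l) \<rightarrow> 0\<close> (\<open>tiling\<close>).  Volumes are indifferent to rotations, which is why
orientations may be mixed.

\<^emph>\<open>Probability.\<close>  The costs of disjoint boxes are independent, equidistributed and bounded, so by
Hoeffding's inequality their normalised sum rarely exceeds the mean.  Thus, for every
\<open>\<epsilon> > 0\<close> and every large \<open>l\<close>, the tension at scale \<open>N\<close> exceeds the mean tension at scale \<open>l\<close> by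
\<open>\<epsilon>\<close> with probability tending to \<open>0\<close> as \<open>N\<close> grows (\<open>tension_upper_tail\<close>).  Taking
expectations, the limit superior of the means for one choice of cube and height is at most the limit
inferior for any other choice; so all means converge to one \<open>\<tau>\<close>.  A uniformly bounded sequence whose
upper tails above \<open>\<tau>\<close> vanish and whose means tend to \<open>\<tau>\<close> converges to \<open>\<tau>\<close> in probability, because
a lower tail could not be compensated in the mean.\<close>

section \<open>Positive association on a finite power set\<close>

text \<open>The two-point case of the four functions theorem.  Of the four products on the left only the mixed
ones \<open>a0 * b1\<close> and \<open>a1 * b0\<close> compete for the same bound \<open>c1 * d0\<close>; their product is bounded by
\<open>(c1 * d0) * (c0 * d1)\<close>, and two numbers below \<open>r\<close> with product at most \<open>r * s\<close> have sum at most
\<open>r + s\<close>.\<close>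

lemma four_numbers:
  fixes a0 :: real
  assumes nn: "0 \<le> a0" "0 \<le> a1" "0 \<le> b0" "0 \<le> b1" "0 \<le> c0" "0 \<le> c1" "0 \<le> d0" "0 \<le> d1"
    and h: "a0 * b0 \<le> c0 * d0" "a0 * b1 \<le> c1 * d0" "a1 * b0 \<le> c1 * d0" "a1 * b1 \<le> c1 * d1"
  shows "(a0 + a1) * (b0 + b1) \<le> (c0 + c1) * (d0 + d1)"
proof (cases "c1 * d0 = 0")
  case True
  have z: "a0 * b1 = 0" "a1 * b0 = 0"
    using True h(2,3) mult_nonneg_nonneg[OF nn(1,4)] mult_nonneg_nonneg[OF nn(2,3)] by linarith+
  have "0 \<le> c0 * d1" "0 \<le> c1 * d0" using nn by simp_all
  moreover have "(a0 + a1) * (b0 + b1) = a0*b0 + a1*b1" using z by (simp only: distrib_left distrib_right)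
  moreover have "(c0 + c1) * (d0 + d1) = c0*d0 + c1*d1 + c0*d1 + c1*d0" by (simp add: algebra_simps)
  ultimately show ?thesis using h by linarith
next
  case False
  define r where "r = c1 * d0"
  have r: "r > 0" unfolding r_def using False nn by (simp add: less_le)
  have p: "(a0 * b1) * (a1 * b0) \<le> r * (c0 * d1)"
  proof -
    have "(a0 * b1) * (a1 * b0) = (a0 * b0) * (a1 * b1)" by (simp add: algebra_simps)
    also have "\<dots> \<le> (c0 * d0) * (c1 * d1)"
      using mult_mono[OF h(1) h(4)] nn by simp
    finally show ?thesis by (simp add: r_def algebra_simps)
  qed
  \<comment> \<open>both mixed products are at most \<open>r\<close>\<close>
  have "(r - a0 * b1) * (r - a1 * b0) \<ge> 0"
    using h by (intro mult_nonneg_nonneg) (simp_all add: r_def)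
  then have "r * (a0 * b1 + a1 * b0) \<le> r * r + (a0 * b1) * (a1 * b0)"
    by (simp add: algebra_simps)
  also have "\<dots> \<le> r * (r + c0 * d1)" using p by (simp add: algebra_simps)
  finally have "a0 * b1 + a1 * b0 \<le> r + c0 * d1" using r by simp
  then show ?thesis using h by (simp add: r_def algebra_simps)
qed

lemma sum_Pow_insert:
  assumes "finite E" "e \<notin> E"
  shows "(\<Sum>F\<in>Pow (insert e E). f F) = (\<Sum>F\<in>Pow E. f F + f (insert e F))"
proof -
  have "inj_on (insert e) (Pow E)" using assms(2) by (auto simp: inj_on_def)
  moreover have "Pow E \<inter> insert e ` Pow E = {}" using assms(2) by auto
  ultimately show ?thesis
    using assms(1) by (simp add: Pow_insert sum.union_disjoint sum.reindex sum.distrib)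
qed

text \<open>The Ahlswede--Daykin theorem for the lattice of subsets.  Summing each function over the presence of
one element \<open>e\<close> preserves the hypothesis, by the two-point case, and removes \<open>e\<close> from the ground
set.\<close>

theorem four_functions:
  fixes \<alpha> \<beta> \<gamma> \<delta> :: "'e set \<Rightarrow> real"
  assumes "finite E"
    and "\<And>A. A \<subseteq> E \<Longrightarrow> 0 \<le> \<alpha> A \<and> 0 \<le> \<beta> A \<and> 0 \<le> \<gamma> A \<and> 0 \<le> \<delta> A"
    and "\<And>A B. A \<subseteq> E \<Longrightarrow> B \<subseteq> E \<Longrightarrow> \<alpha> A * \<beta> B \<le> \<gamma> (A \<union> B) * \<delta> (A \<inter> B)"
  shows "sum \<alpha> (Pow E) * sum \<beta> (Pow E) \<le> sum \<gamma> (Pow E) * sum \<delta> (Pow E)"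
  using assms
proof (induction E arbitrary: \<alpha> \<beta> \<gamma> \<delta> rule: finite_induct)
  case empty
  from empty(2)[of "{}" "{}"] show ?case by simp
next
  case (insert e E)
  let ?p = "\<lambda>f F. f F + f (Set.insert e F) :: real"
  have nn: "A \<subseteq> E \<Longrightarrow> 0 \<le> \<alpha> A \<and> 0 \<le> \<beta> A \<and> 0 \<le> \<gamma> A \<and> 0 \<le> \<delta> A"
           "A \<subseteq> E \<Longrightarrow> 0 \<le> \<alpha> (Set.insert e A) \<and> 0 \<le> \<beta> (Set.insert e A)
             \<and> 0 \<le> \<gamma> (Set.insert e A) \<and> 0 \<le> \<delta> (Set.insert e A)" for A
    by (intro insert.prems(1); blast)+
  have "sum (?p \<alpha>) (Pow E) * sum (?p \<beta>) (Pow E) \<le> sum (?p \<gamma>) (Pow E) * sum (?p \<delta>) (Pow E)"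
  proof (rule insert.IH)
    fix A assume "A \<subseteq> E"
    then show "0 \<le> ?p \<alpha> A \<and> 0 \<le> ?p \<beta> A \<and> 0 \<le> ?p \<gamma> A \<and> 0 \<le> ?p \<delta> A"
      using nn[of A] by auto
  next
    fix A B assume AB: "A \<subseteq> E" "B \<subseteq> E"
    then have e: "e \<notin> A" "e \<notin> B" using insert.hyps by auto
    have sub: "A \<subseteq> Set.insert e E" "B \<subseteq> Set.insert e E" "Set.insert e A \<subseteq> Set.insert e E" "Set.insert e B \<subseteq> Set.insert e E"
      using AB by auto
    have "A \<union> B \<subseteq> E" "A \<inter> B \<subseteq> E" using AB by auto
    note nns = nn[OF AB(1)] nn[OF AB(2)] nn[OF \<open>A \<union> B \<subseteq> E\<close>] nn[OF \<open>A \<inter> B \<subseteq> E\<close>]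
    have eqs: "A \<inter> Set.insert e B = A \<inter> B" "Set.insert e A \<inter> B = A \<inter> B" "A \<union> Set.insert e B = Set.insert e (A \<union> B)"
      "Set.insert e A \<union> B = Set.insert e (A \<union> B)" "Set.insert e A \<union> Set.insert e B = Set.insert e (A \<union> B)"
      "Set.insert e A \<inter> Set.insert e B = Set.insert e (A \<inter> B)"
      using e by auto
    show "?p \<alpha> A * ?p \<beta> B \<le> ?p \<gamma> (A \<union> B) * ?p \<delta> (A \<inter> B)"
      using nns insert.prems(2)[OF sub(1,2)] insert.prems(2)[OF sub(1,4)]
        insert.prems(2)[OF sub(3,2)] insert.prems(2)[OF sub(3,4)]
      unfolding eqs by (intro four_numbers) auto
  qed
  then show ?case
    unfolding sum_Pow_insert[OF insert.hyps] .
qed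

text \<open>The four functions are \<open>m f\<close>, \<open>m g\<close>, \<open>m\<close> and \<open>m f g\<close>: both \<open>f\<close> and \<open>g\<close> increase when their
arguments are replaced by the intersection.\<close>

lemma FKG_decreasing:
  fixes m f g :: "'e set \<Rightarrow> real"
  assumes "finite E"
    and m0: "\<And>A. A \<subseteq> E \<Longrightarrow> 0 \<le> m A"
    and lat: "\<And>A B. A \<subseteq> E \<Longrightarrow> B \<subseteq> E \<Longrightarrow> m A * m B \<le> m (A \<union> B) * m (A \<inter> B)"
    and f0: "\<And>A. A \<subseteq> E \<Longrightarrow> 0 \<le> f A" and g0: "\<And>A. A \<subseteq> E \<Longrightarrow> 0 \<le> g A"
    and f: "\<And>A B. A \<subseteq> B \<Longrightarrow> B \<subseteq> E \<Longrightarrow> f B \<le> f A"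
    and g: "\<And>A B. A \<subseteq> B \<Longrightarrow> B \<subseteq> E \<Longrightarrow> g B \<le> g A"
  shows "(\<Sum>F\<in>Pow E. m F * f F) * (\<Sum>F\<in>Pow E. m F * g F)
      \<le> (\<Sum>F\<in>Pow E. m F) * (\<Sum>F\<in>Pow E. m F * (f F * g F))"
proof (rule four_functions[OF \<open>finite E\<close>])
  fix A B assume AB: "A \<subseteq> E" "B \<subseteq> E"
  then have i: "A \<inter> B \<subseteq> E" "A \<union> B \<subseteq> E" by auto
  have "(m A * f A) * (m B * g B) = (m A * m B) * (f A * g B)" by (simp add: algebra_simps)
  also have "\<dots> \<le> (m (A \<union> B) * m (A \<inter> B)) * (f (A \<inter> B) * g (A \<inter> B))"
    using AB i by (intro mult_mono lat f g mult_nonneg_nonneg m0 f0 g0) auto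
  finally show "(m A * f A) * (m B * g B) \<le> m (A \<union> B) * (m (A \<inter> B) * (f (A \<inter> B) * g (A \<inter> B)))"
    by (simp add: algebra_simps)
qed (use m0 f0 g0 in auto)

section \<open>Counting clusters\<close>

lemma connected_via_refl: "(x, x) \<in> connected_via F"
  by (simp add: connected_via_def)

lemma connected_via_sym: "(x, y) \<in> connected_via F \<longleftrightarrow> (y, x) \<in> connected_via F"
proof -
  have "sym (connected_via F)"
    unfolding connected_via_def by (intro sym_rtrancl) (simp add: sym_def insert_commute)
  then show ?thesis by (auto simp: sym_def)
qed

lemma connected_via_trans:
  "(x, y) \<in> connected_via F \<Longrightarrow> (y, z) \<in> connected_via F \<Longrightarrow> (x, z) \<in> connected_via F"
  by (auto simp: connected_via_def)

lemma connected_via_cong: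
  "(x, y) \<in> connected_via F \<Longrightarrow> (x, z) \<in> connected_via F \<longleftrightarrow> (y, z) \<in> connected_via F"
  using connected_via_trans[of x y F z] connected_via_trans[of y x F z] connected_via_sym[of x y F] by auto

lemma connected_via_mono: "F \<subseteq> G \<Longrightarrow> connected_via F \<subseteq> connected_via G"
  unfolding connected_via_def by (intro rtrancl_mono) auto

text \<open>A path may be shortened until it crosses the new edge at most once, in one of the two directions.\<close>

lemma connected_via_insert:
  "(u, v) \<in> connected_via (insert {x, y} F) \<longleftrightarrow>
     (u, v) \<in> connected_via F \<or>
     (u, x) \<in> connected_via F \<and> (y, v) \<in> connected_via F \<or>
     (u, y) \<in> connected_via F \<and> (x, v) \<in> connected_via F"
proof -
  have "{(a, b). {a, b} \<in> insert {x, y} F} = insert (x, y) (insert (y, x) {(a, b). {a, b} \<in> F})"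
    by (auto simp: doubleton_eq_iff)
  then have "(u, v) \<in> connected_via (insert {x, y} F) \<longleftrightarrow>
      (u, v) \<in> (insert (x, y) (insert (y, x) {(a, b). {a, b} \<in> F}))\<^sup>*"
    by (simp add: connected_via_def)
  also have "\<dots> \<longleftrightarrow> (u, v) \<in> connected_via F \<or>
     (u, x) \<in> connected_via F \<and> (y, v) \<in> connected_via F \<or>
     (u, y) \<in> connected_via F \<and> (x, v) \<in> connected_via F"
    unfolding rtrancl_insert connected_via_def[symmetric]
    using connected_via_trans[of u x F v] connected_via_trans[of u y F v] by auto
  finally show ?thesis .
qed

definition cluster_count :: "(real ^ 'd) set \<Rightarrow> (real ^ 'd) set set \<Rightarrow> nat" where
  "cluster_count X F = card (X // connected_via F)"

text \<open>The only clusters that change are those of \<open>x\<close> and \<open>y\<close>, and both are counted since \<open>x\<close> and \<open>y\<close> lie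
in \<open>X\<close>.\<close>

lemma cluster_count_insert:
  assumes X: "finite X" "x \<in> X" "y \<in> X"
  shows "cluster_count X F
       = cluster_count X (insert {x, y} F) + (if (x, y) \<in> connected_via F then 0 else 1)"
proof (cases "(x, y) \<in> connected_via F")
  case True
  have "(u, v) \<in> connected_via (insert {x, y} F) \<longleftrightarrow> (u, v) \<in> connected_via F" for u v
    using connected_via_cong[OF True, of v] connected_via_trans[of u x F v] connected_via_trans[of u y F v]
    by (auto simp: connected_via_insert)
  then have "connected_via (insert {x, y} F) = connected_via F" by (auto simp: set_eq_iff)
  with True show ?thesis by (simp add: cluster_count_def)
next
  case False
  let ?c = "\<lambda>u. connected_via F `` {u}"
  let ?c' = "\<lambda>u. connected_via (insert {x, y} F) `` {u}"
  define R where "R = {u \<in> X. (u, x) \<notin> connected_via F \<and> (u, y) \<notin> connected_via F}"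
  have eq_iff: "?c u = ?c v \<longleftrightarrow> (u, v) \<in> connected_via F" for u v
  proof
    assume "?c u = ?c v"
    then have "v \<in> ?c u" using connected_via_refl[of v F] by auto
    then show "(u, v) \<in> connected_via F" by simp
  next
    assume "(u, v) \<in> connected_via F"
    from connected_via_cong[OF this] show "?c u = ?c v" by auto
  qed
  have q: "X // connected_via F = insert (?c x) (insert (?c y) (?c ` R))"
  proof -
    have "X // connected_via F = ?c ` X" by (auto simp: quotient_def)
    also have "\<dots> = insert (?c x) (insert (?c y) (?c ` R))"
    proof (intro equalityI subsetI)
      fix C assume "C \<in> ?c ` X"
      then obtain u where u: "u \<in> X" "C = ?c u" by auto
      show "C \<in> insert (?c x) (insert (?c y) (?c ` R))"
        using u by (cases "u \<in> R") (auto simp: R_def eq_iff simp del: Image_singleton_iff)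
    qed (use X in \<open>auto simp: R_def\<close>)
    finally show ?thesis .
  qed
  have R_out: "?c' u = ?c u" if "u \<in> R" for u
    using that by (auto simp: R_def connected_via_insert)
  have merged: "?c' u = ?c x \<union> ?c y" if "(u, x) \<in> connected_via F \<or> (u, y) \<in> connected_via F" for u
  proof -
    have "v \<in> ?c' u \<longleftrightarrow> v \<in> ?c x \<union> ?c y" for v
      using that connected_via_cong[of u x F v] connected_via_cong[of u y F v]
      by (auto simp: connected_via_insert)
    then show ?thesis by blast
  qed
  have q': "X // connected_via (insert {x, y} F) = insert (?c x \<union> ?c y) (?c ` R)"
  proof -
    have "X // connected_via (insert {x, y} F) = ?c' ` X" by (auto simp: quotient_def)
    also have "\<dots> = insert (?c x \<union> ?c y) (?c ` R)"
    proof (intro equalityI subsetI)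
      fix C assume "C \<in> ?c' ` X"
      then obtain u where u: "u \<in> X" "C = ?c' u" by auto
      show "C \<in> insert (?c x \<union> ?c y) (?c ` R)"
      proof (cases "u \<in> R")
        case True then show ?thesis using u R_out by auto
      next
        case False
        then have "(u, x) \<in> connected_via F \<or> (u, y) \<in> connected_via F" using u by (auto simp: R_def)
        from merged[OF this] u show ?thesis by simp
      qed
    next
      fix C assume "C \<in> insert (?c x \<union> ?c y) (?c ` R)"
      then show "C \<in> ?c' ` X"
      proof
        assume "C = ?c x \<union> ?c y"
        then have "C = ?c' x" using merged[of x] connected_via_refl by metis
        then show ?thesis using X by blast
      next
        assume "C \<in> ?c ` R"
        then obtain u where "u \<in> R" "C = ?c u" by blast
        then have "C = ?c' u" "u \<in> X" using R_out by (auto simp: R_def)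
        then show ?thesis by blast
      qed
    qed
    finally show ?thesis .
  qed
  have fin: "finite (?c ` R)" using X by (simp add: R_def)
  have n1: "?c y \<notin> ?c ` R" "?c x \<notin> insert (?c y) (?c ` R)"
  proof -
    have ne: "?c y \<noteq> ?c u \<and> ?c x \<noteq> ?c u" if "u \<in> R" for u
      using that eq_iff[of u y] eq_iff[of u x] unfolding R_def by (metis (no_types, lifting) mem_Collect_eq)
    show "?c y \<notin> ?c ` R" using ne by blast
    show "?c x \<notin> insert (?c y) (?c ` R)" using ne False eq_iff[of x y] by blast
  qed
  have n2: "?c x \<union> ?c y \<notin> ?c ` R"
  proof
    assume "?c x \<union> ?c y \<in> ?c ` R"
    then obtain u where "u \<in> R" "?c x \<union> ?c y = ?c u" by blast
    then have "x \<in> ?c u" using connected_via_refl[of x F] by blast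
    with \<open>u \<in> R\<close> show False by (auto simp: R_def)
  qed
  show ?thesis using False fin n1 n2 by (simp add: cluster_count_def q q')
qed

text \<open>Opening edges between points of \<open>X\<close> merges fewer clusters when more edges are
  open already; the vertex sets \<open>X\<close> and \<open>Y\<close> in which clusters are counted may differ,
  because a merge is seen by both counts.\<close>

lemma cluster_count_drop_antimono:
  assumes "finite X" "finite Y" "finite D" "P \<subseteq> Q"
    and D: "\<And>e. e \<in> D \<Longrightarrow> \<exists>x y. e = {x, y} \<and> x \<in> X \<inter> Y \<and> y \<in> X \<inter> Y"
  shows "cluster_count X (P \<union> D) + cluster_count Y Q \<le> cluster_count X P + cluster_count Y (Q \<union> D)"
  using assms(3) D
proof (induction D rule: finite_induct)
  case empty
  show ?case by simp
next
  case (insert e D)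
  obtain x y where e: "e = {x, y}" "x \<in> X \<inter> Y" "y \<in> X \<inter> Y"
    using insert.prems by blast
  have mono: "connected_via (P \<union> D) \<subseteq> connected_via (Q \<union> D)"
    using \<open>P \<subseteq> Q\<close> by (intro connected_via_mono) auto
  have IH: "cluster_count X (P \<union> D) + cluster_count Y Q \<le> cluster_count X P + cluster_count Y (Q \<union> D)"
    using insert by auto
  have "cluster_count X (P \<union> D) = cluster_count X (insert e (P \<union> D)) + (if (x, y) \<in> connected_via (P \<union> D) then 0 else 1)"
    "cluster_count Y (Q \<union> D) = cluster_count Y (insert e (Q \<union> D)) + (if (x, y) \<in> connected_via (Q \<union> D) then 0 else 1)"
    using e cluster_count_insert[of X x y "P \<union> D"] cluster_count_insert[of Y x y "Q \<union> D"] \<open>finite X\<close> \<open>finite Y\<close>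
    by auto
  with IH mono show ?case by (auto split: if_splits)
qed

text \<open>Passing from \<open>F \<inter> G\<close> to \<open>F\<close> and from \<open>G\<close> to \<open>F \<union> G\<close> opens the same edges \<open>F - G\<close>, the second
time on top of a larger set.\<close>

lemma cluster_count_supermodular:
  assumes "finite X" "finite F"
    and F: "\<And>e. e \<in> F \<Longrightarrow> \<exists>x y. e = {x, y} \<and> x \<in> X \<and> y \<in> X"
  shows "cluster_count X (F \<union> P) + cluster_count X (G \<union> P)
       \<le> cluster_count X (F \<union> G \<union> P) + cluster_count X (F \<inter> G \<union> P)"
proof -
  have "cluster_count X ((F \<inter> G \<union> P) \<union> (F - G)) + cluster_count X (G \<union> P)
      \<le> cluster_count X (F \<inter> G \<union> P) + cluster_count X ((G \<union> P) \<union> (F - G))"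
    using assms by (intro cluster_count_drop_antimono) auto
  moreover have "(F \<inter> G \<union> P) \<union> (F - G) = F \<union> P" "(G \<union> P) \<union> (F - G) = F \<union> G \<union> P" by auto
  ultimately show ?thesis by simp
qed

section \<open>The wired random cluster measure on sets of open edges\<close>

definition edge_weight ::
  "real \<Rightarrow> ((real ^ 'd) set \<Rightarrow> real) \<Rightarrow> (real ^ 'd) set set \<Rightarrow> (real ^ 'd) set set \<Rightarrow> real" where
  "edge_weight \<beta> J E F = (\<Prod>e\<in>E. if e \<in> F then edge_prob \<beta> J e else 1 - edge_prob \<beta> J e)"

text \<open>A configuration is represented by its set \<open>F\<close> of open edges, so that events become families of sets
and the lattice operations are union and intersection.  The wired boundary condition adds every edge
outside \<open>E\<close>.\<close>

definition wired_weight ::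
  "real \<Rightarrow> real \<Rightarrow> ((real ^ 'd) set \<Rightarrow> real) \<Rightarrow> (real ^ 'd) set set \<Rightarrow> (real ^ 'd) set set \<Rightarrow> real" where
  "wired_weight \<beta> q J E F =
     edge_weight \<beta> J E F * q ^ cluster_count (\<Union>E) (F \<union> (all_edges - E))"

definition wired_prob ::
  "real \<Rightarrow> real \<Rightarrow> ((real ^ 'd) set \<Rightarrow> real) \<Rightarrow> (real ^ 'd) set set \<Rightarrow> (real ^ 'd) set set set \<Rightarrow> real" where
  "wired_prob \<beta> q J E \<A> =
     (\<Sum>F\<in>Pow E. wired_weight \<beta> q J E F * of_bool (F \<in> \<A>)) / (\<Sum>F\<in>Pow E. wired_weight \<beta> q J E F)"

lemma edge_endpoints:
  assumes "E \<subseteq> all_edges" "e \<in> E"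
  obtains x y where "e = {x, y}" "x \<in> \<Union>E" "y \<in> \<Union>E" "x \<in> int_lattice" "y \<in> int_lattice" "adj x y"
proof -
  from assms obtain x y where "e = {x, y}" "x \<in> int_lattice" "y \<in> int_lattice" "adj x y"
    unfolding edges_in_def by blast
  with assms show ?thesis by (intro that) auto
qed

lemma finite_Union_edges:
  assumes "finite E" "E \<subseteq> all_edges"
  shows "finite (\<Union>E)"
proof -
  have "finite e" if "e \<in> E" for e
    using edge_endpoints[OF assms(2) that] by (metis finite.emptyI finite.insertI)
  with assms(1) show ?thesis by blast
qed

lemma sum_Pow_split:
  assumes "finite E" "E1 \<subseteq> E"
  shows "(\<Sum>F\<in>Pow E. f F) = (\<Sum>B\<in>Pow (E - E1). \<Sum>F\<in>Pow E1. f (F \<union> B))"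
proof -
  have "(\<Sum>B\<in>Pow (E - E1). \<Sum>F\<in>Pow E1. f (F \<union> B)) = (\<Sum>(B, F)\<in>Pow (E - E1) \<times> Pow E1. f (F \<union> B))"
    using assms by (subst sum.cartesian_product) simp
  also have "\<dots> = (\<Sum>F\<in>Pow E. f F)"
    by (rule sum.reindex_bij_witness[where j = "\<lambda>(B, F). F \<union> B" and i = "\<lambda>F. (F - E1, F \<inter> E1)"])
      (use assms in auto)
  finally show ?thesis by simp
qed

context
  fixes \<beta> q :: real and J :: "(real ^ 'd) set \<Rightarrow> real"
  assumes q: "q \<ge> 1" and \<beta>: "\<beta> \<ge> 0" and J: "\<And>e. e \<in> all_edges \<Longrightarrow> 0 \<le> J e \<and> J e \<le> 1"
begin

lemma edge_prob_bounds:
  assumes "e \<in> all_edges"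
  shows "0 \<le> edge_prob \<beta> J e" "exp (- \<beta>) \<le> 1 - edge_prob \<beta> J e"
  using J[OF assms] \<beta> by (auto simp: edge_prob_def mult_left_le)

lemma edge_prob_less_1: "e \<in> all_edges \<Longrightarrow> 0 < 1 - edge_prob \<beta> J e"
  by (simp add: edge_prob_def)

lemma edge_weight_nonneg:
  assumes "E \<subseteq> all_edges"
  shows "0 \<le> edge_weight \<beta> J E F"
  unfolding edge_weight_def
proof (rule prod_nonneg)
  fix e assume "e \<in> E"
  then have "e \<in> all_edges" using assms by blast
  from edge_prob_bounds(1)[OF this] edge_prob_less_1[OF this]
  show "0 \<le> (if e \<in> F then edge_prob \<beta> J e else 1 - edge_prob \<beta> J e)" by simp
qed

lemma wired_weight_nonneg: "E \<subseteq> all_edges \<Longrightarrow> 0 \<le> wired_weight \<beta> q J E F"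
  using q by (simp add: wired_weight_def edge_weight_nonneg)

lemma wired_weight_empty_pos:
  assumes "E \<subseteq> all_edges"
  shows "0 < wired_weight \<beta> q J E {}"
proof -
  have "0 < edge_weight \<beta> J E {}"
    unfolding edge_weight_def using assms edge_prob_less_1 by (intro prod_pos) auto
  then show ?thesis using q by (simp add: wired_weight_def)
qed

lemma wired_partition_pos:
  assumes "finite E" "E \<subseteq> all_edges"
  shows "0 < (\<Sum>F\<in>Pow E. wired_weight \<beta> q J E F)"
  by (rule sum_pos2[of _ "{}"]) (use assms wired_weight_nonneg wired_weight_empty_pos in auto)

lemma wired_prob_nonneg: "E \<subseteq> all_edges \<Longrightarrow> 0 \<le> wired_prob \<beta> q J E \<A>"
  unfolding wired_prob_def by (intro divide_nonneg_nonneg sum_nonneg mult_nonneg_nonneg wired_weight_nonneg) auto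

lemma wired_prob_mono:
  assumes "finite E" "E \<subseteq> all_edges" "\<And>F. F \<subseteq> E \<Longrightarrow> F \<in> \<A> \<Longrightarrow> F \<in> \<B>"
  shows "wired_prob \<beta> q J E \<A> \<le> wired_prob \<beta> q J E \<B>"
  unfolding wired_prob_def
  using assms wired_weight_nonneg[of E] wired_partition_pos[of E]
  by (intro divide_right_mono sum_mono mult_left_mono) auto

lemma wired_prob_UNIV: "finite E \<Longrightarrow> E \<subseteq> all_edges \<Longrightarrow> wired_prob \<beta> q J E UNIV = 1"
  using wired_partition_pos[of E] by (simp add: wired_prob_def)

lemma wired_prob_le_1: "finite E \<Longrightarrow> E \<subseteq> all_edges \<Longrightarrow> wired_prob \<beta> q J E \<A> \<le> 1"
  using wired_prob_mono[of E \<A> UNIV] wired_prob_UNIV[of E] by simp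

lemma wired_prob_pos:
  assumes "finite E" "E \<subseteq> all_edges" "{} \<in> \<A>"
  shows "0 < wired_prob \<beta> q J E \<A>"
proof -
  have "0 < (\<Sum>F\<in>Pow E. wired_weight \<beta> q J E F * of_bool (F \<in> \<A>))"
    by (rule sum_pos2[of _ "{}"]) (use assms wired_weight_nonneg wired_weight_empty_pos in auto)
  then show ?thesis using wired_partition_pos[OF assms(1,2)] by (simp add: wired_prob_def)
qed

lemma edge_weight_lattice:
  assumes "finite E"
  shows "edge_weight \<beta> J E F * edge_weight \<beta> J E G
       = edge_weight \<beta> J E (F \<union> G) * edge_weight \<beta> J E (F \<inter> G)"
  unfolding edge_weight_def prod.distrib[symmetric] by (intro prod.cong) auto

lemma wired_weight_lattice:
  assumes E: "finite E" "E \<subseteq> all_edges" and F: "F \<subseteq> E" "G \<subseteq> E"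
  shows "wired_weight \<beta> q J E F * wired_weight \<beta> q J E G
       \<le> wired_weight \<beta> q J E (F \<union> G) * wired_weight \<beta> q J E (F \<inter> G)"
proof -
  let ?k = "\<lambda>F. cluster_count (\<Union>E) (F \<union> (all_edges - E))"
  have "?k F + ?k G \<le> ?k (F \<union> G) + ?k (F \<inter> G)"
  proof (rule cluster_count_supermodular)
    show "finite F" using E F finite_subset by blast
    show "\<exists>x y. e = {x, y} \<and> x \<in> \<Union>E \<and> y \<in> \<Union>E" if "e \<in> F" for e
      using edge_endpoints[OF E(2), of e] that F by (metis subsetD)
  qed (use finite_Union_edges[OF E] in auto)
  then have "q ^ (?k F + ?k G) \<le> q ^ (?k (F \<union> G) + ?k (F \<inter> G))"
    using q by (intro power_increasing) auto
  then have "(edge_weight \<beta> J E F * edge_weight \<beta> J E G) * (q ^ ?k F * q ^ ?k G)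
      \<le> (edge_weight \<beta> J E F * edge_weight \<beta> J E G) * (q ^ ?k (F \<union> G) * q ^ ?k (F \<inter> G))"
    using edge_weight_nonneg[OF E(2)] by (intro mult_left_mono) (auto simp: power_add)
  also have "\<dots> = (edge_weight \<beta> J E (F \<union> G) * edge_weight \<beta> J E (F \<inter> G)) * (q ^ ?k (F \<union> G) * q ^ ?k (F \<inter> G))"
    by (simp only: edge_weight_lattice[OF E(1), of F G])
  finally show ?thesis by (simp add: wired_weight_def algebra_simps)
qed

text \<open>Stochastic domination by the wired measure on \<open>E1\<close>.  Fix the open edges \<open>B\<close> outside \<open>E1\<close>.  The
conditional weight of \<open>F\<close> in \<open>E1\<close> is the wired weight of \<open>F\<close> on \<open>E1\<close> times \<open>q\<close> to the power of a
difference of two cluster counts.  The count for \<open>B\<close> sees fewer open edges than the wired count, so it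
loses more clusters when \<open>F\<close> grows: the factor is decreasing in \<open>F\<close>, and by positive association it
favours the decreasing event.  Summing over \<open>B\<close> gives the claim.\<close>

lemma wired_prob_decouple:
  assumes E: "finite E" "E \<subseteq> all_edges" and E1: "E1 \<subseteq> E"
    and dec: "\<And>F G. F \<subseteq> G \<Longrightarrow> G \<subseteq> E1 \<Longrightarrow> G \<in> \<A> \<Longrightarrow> F \<in> \<A>"
    and \<B>: "\<And>F. F \<in> \<B> \<longleftrightarrow> F - E1 \<in> \<B>"
  shows "wired_prob \<beta> q J E1 \<A> * wired_prob \<beta> q J E \<B>
       \<le> wired_prob \<beta> q J E {F. F \<inter> E1 \<in> \<A> \<and> F \<in> \<B>}"
proof -
  let ?E2 = "E - E1"
  have E1': "finite E1" "E1 \<subseteq> all_edges" using E E1 finite_subset by auto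
  define \<rho> where "\<rho> B F = cluster_count (\<Union>E) (F \<union> B \<union> (all_edges - E))" for B F
  define \<kappa> where "\<kappa> F = cluster_count (\<Union>E1) (F \<union> (all_edges - E1))" for F
  let ?w1 = "edge_weight \<beta> J E1" and ?w2 = "edge_weight \<beta> J ?E2"
  let ?m = "wired_weight \<beta> q J E1"
  have m: "?m F = ?w1 F * q ^ \<kappa> F" for F by (simp add: wired_weight_def \<kappa>_def)
  have split: "wired_weight \<beta> q J E (F \<union> B) = ?w2 B * (?w1 F * q ^ \<rho> B F)"
    if "F \<subseteq> E1" "B \<subseteq> ?E2" for F B
  proof -
    have "edge_weight \<beta> J E (F \<union> B) = edge_weight \<beta> J ?E2 (F \<union> B) * edge_weight \<beta> J E1 (F \<union> B)"
      unfolding edge_weight_def using prod.subset_diff[OF E1 E(1)] by simp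
    moreover have "edge_weight \<beta> J ?E2 (F \<union> B) = ?w2 B" "edge_weight \<beta> J E1 (F \<union> B) = ?w1 F"
      unfolding edge_weight_def using that by (intro prod.cong; auto)+
    ultimately show ?thesis by (simp add: wired_weight_def \<rho>_def)
  qed
  \<comment> \<open>density, up to normalisation, of the conditional law given \<open>B\<close> with respect to the wired law\<close>
  define g where "g B F = q ^ \<rho> B F / q ^ \<kappa> F" for B F
  have mg: "?m F * g B F = ?w1 F * q ^ \<rho> B F" for B F
    using q by (simp add: m g_def)
  have fkg: "(\<Sum>F\<in>Pow E1. ?m F * of_bool (F \<in> \<A>)) * (\<Sum>F\<in>Pow E1. ?w1 F * q ^ \<rho> B F)
      \<le> (\<Sum>F\<in>Pow E1. ?m F) * (\<Sum>F\<in>Pow E1. ?w1 F * q ^ \<rho> B F * of_bool (F \<in> \<A>))"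
    if B: "B \<subseteq> ?E2" for B
  proof -
    have gdec: "g B G \<le> g B F" if FG: "F \<subseteq> G" "G \<subseteq> E1" for F G
    proof -
      have "cluster_count (\<Union>E) ((F \<union> B \<union> (all_edges - E)) \<union> (G - F)) + cluster_count (\<Union>E1) (F \<union> (all_edges - E1))
          \<le> cluster_count (\<Union>E) (F \<union> B \<union> (all_edges - E)) + cluster_count (\<Union>E1) ((F \<union> (all_edges - E1)) \<union> (G - F))"
      proof (rule cluster_count_drop_antimono)
        show "finite (G - F)" using E1' FG finite_subset by blast
        show "F \<union> B \<union> (all_edges - E) \<subseteq> F \<union> (all_edges - E1)" using B E E1 by auto
        fix e assume "e \<in> G - F"
        then have "e \<in> E1" using FG by auto
        then obtain x y where "e = {x, y}" "x \<in> \<Union>E1" "y \<in> \<Union>E1"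
          using edge_endpoints[OF E1'(2)] by metis
        then show "\<exists>x y. e = {x, y} \<and> x \<in> \<Union>E \<inter> \<Union>E1 \<and> y \<in> \<Union>E \<inter> \<Union>E1"
          using E1 by blast
      qed (use finite_Union_edges E E1' in auto)
      moreover have "(F \<union> B \<union> (all_edges - E)) \<union> (G - F) = G \<union> B \<union> (all_edges - E)"
        "(F \<union> (all_edges - E1)) \<union> (G - F) = G \<union> (all_edges - E1)" using FG by auto
      ultimately have "\<rho> B G + \<kappa> F \<le> \<rho> B F + \<kappa> G" by (simp add: \<rho>_def \<kappa>_def)
      then have "q ^ (\<rho> B G + \<kappa> F) \<le> q ^ (\<rho> B F + \<kappa> G)" using q by (intro power_increasing) auto
      then show ?thesis using q by (simp add: g_def power_add field_simps)
    qed
    have "(\<Sum>F\<in>Pow E1. ?m F * of_bool (F \<in> \<A>)) * (\<Sum>F\<in>Pow E1. ?m F * g B F)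
      \<le> (\<Sum>F\<in>Pow E1. ?m F) * (\<Sum>F\<in>Pow E1. ?m F * (of_bool (F \<in> \<A>) * g B F))"
    proof (rule FKG_decreasing)
      show "of_bool (G \<in> \<A>) \<le> (of_bool (F \<in> \<A>) :: real)" if "F \<subseteq> G" "G \<subseteq> E1" for F G
        using dec[OF that] by auto
    qed (use gdec E1' wired_weight_nonneg wired_weight_lattice q in \<open>auto simp: g_def\<close>)
    then show ?thesis
      by (simp only: mg mult.assoc[symmetric] mult.commute[of "of_bool _"]) 
  qed
  let ?Z = "\<Sum>F\<in>Pow E. wired_weight \<beta> q J E F" and ?Z1 = "\<Sum>F\<in>Pow E1. ?m F"
  let ?SA = "\<Sum>F\<in>Pow E1. ?m F * of_bool (F \<in> \<A>)"
  let ?N = "\<Sum>F\<in>Pow E. wired_weight \<beta> q J E F * of_bool (F \<in> \<B>)"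
  let ?NA = "\<Sum>F\<in>Pow E. wired_weight \<beta> q J E F * of_bool (F \<in> {F. F \<inter> E1 \<in> \<A> \<and> F \<in> \<B>})"
  have inB: "F \<union> B \<in> \<B> \<longleftrightarrow> B \<in> \<B>" if "F \<subseteq> E1" "B \<subseteq> ?E2" for F B
  proof -
    have "F \<union> B - E1 = B" using that by auto
    then show ?thesis using \<B>[of "F \<union> B"] by simp
  qed
  have N: "?N = (\<Sum>B\<in>Pow ?E2. ?w2 B * of_bool (B \<in> \<B>) * (\<Sum>F\<in>Pow E1. ?w1 F * q ^ \<rho> B F))"
    unfolding sum_Pow_split[OF E(1) E1] sum_distrib_left
    by (intro sum.cong refl) (simp add: split inB)
  have NA: "?NA = (\<Sum>B\<in>Pow ?E2. ?w2 B * of_bool (B \<in> \<B>) * (\<Sum>F\<in>Pow E1. ?w1 F * q ^ \<rho> B F * of_bool (F \<in> \<A>)))"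
    unfolding sum_Pow_split[OF E(1) E1] sum_distrib_left
  proof (intro sum.cong refl)
    fix B F assume "B \<in> Pow ?E2" "F \<in> Pow E1"
    then have BF: "F \<subseteq> E1" "B \<subseteq> ?E2" by auto
    then have "(F \<union> B) \<inter> E1 = F" by auto
    then show "wired_weight \<beta> q J E (F \<union> B) * of_bool (F \<union> B \<in> {F. F \<inter> E1 \<in> \<A> \<and> F \<in> \<B>}) =
      ?w2 B * of_bool (B \<in> \<B>) * (?w1 F * q ^ \<rho> B F * of_bool (F \<in> \<A>))"
      using BF by (auto simp: split inB)
  qed
  define X where "X B = ?w2 B * of_bool (B \<in> \<B>) * (\<Sum>F\<in>Pow E1. ?w1 F * q ^ \<rho> B F)" for B
  define Y where "Y B = ?w2 B * of_bool (B \<in> \<B>) * (\<Sum>F\<in>Pow E1. ?w1 F * q ^ \<rho> B F * of_bool (F \<in> \<A>))" for B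
  have "?SA * X B \<le> ?Z1 * Y B" if B: "B \<subseteq> ?E2" for B
  proof -
    have "0 \<le> ?w2 B * of_bool (B \<in> \<B>)" using E by (intro mult_nonneg_nonneg edge_weight_nonneg) auto
    from mult_left_mono[OF fkg[OF B] this] show ?thesis
      unfolding X_def Y_def by (simp only: mult_ac)
  qed
  then have "?SA * sum X (Pow ?E2) \<le> ?Z1 * sum Y (Pow ?E2)"
    unfolding sum_distrib_left by (intro sum_mono) auto
  then have "?SA * ?N \<le> ?Z1 * ?NA"
    unfolding N NA X_def Y_def .
  moreover have "0 < ?Z" "0 < ?Z1" using wired_partition_pos E E1' by auto
  ultimately show ?thesis
    unfolding wired_prob_def by (simp add: field_simps)
qed

text \<open>Each block is split off in turn; the event imposed by the other blocks does not look at its edges.\<close>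

lemma wired_prob_blocks:
  assumes E: "finite E" "E \<subseteq> all_edges" and "finite I" and "\<And>i. i \<in> I \<Longrightarrow> Ef i \<subseteq> E"
    and "disjoint_family_on Ef I"
    and "\<And>i F G. i \<in> I \<Longrightarrow> F \<subseteq> G \<Longrightarrow> G \<subseteq> Ef i \<Longrightarrow> G \<in> \<A> i \<Longrightarrow> F \<in> \<A> i"
    and "\<And>i F. i \<in> I \<Longrightarrow> F \<in> \<B> \<longleftrightarrow> F - Ef i \<in> \<B>"
  shows "(\<Prod>i\<in>I. wired_prob \<beta> q J (Ef i) (\<A> i)) * wired_prob \<beta> q J E \<B>
       \<le> wired_prob \<beta> q J E {F. (\<forall>i\<in>I. F \<inter> Ef i \<in> \<A> i) \<and> F \<in> \<B>}"
  using assms(3-)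
proof (induction I rule: finite_induct)
  case empty
  then show ?case by simp
next
  case (insert i I)
  define \<C> where "\<C> = {F. (\<forall>i\<in>I. F \<inter> Ef i \<in> \<A> i) \<and> F \<in> \<B>}"
  have disj: "Ef i \<inter> Ef j = {}" if "j \<in> I" for j
    using insert.prems(2) insert.hyps that by (auto simp: disjoint_family_on_def)
  have IH: "(\<Prod>i\<in>I. wired_prob \<beta> q J (Ef i) (\<A> i)) * wired_prob \<beta> q J E \<B> \<le> wired_prob \<beta> q J E \<C>"
    unfolding \<C>_def
  proof (rule insert.IH)
    show "disjoint_family_on Ef I"
      by (rule disjoint_family_on_mono[OF _ insert.prems(2)]) auto
  qed (use insert.prems in auto)
  have "F \<in> \<C> \<longleftrightarrow> F - Ef i \<in> \<C>" for F
  proof -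
    have "(F - Ef i) \<inter> Ef j = F \<inter> Ef j" if "j \<in> I" for j using disj[OF that] by auto
    then show ?thesis using insert.prems(4)[of i F] by (auto simp: \<C>_def)
  qed
  then have "wired_prob \<beta> q J (Ef i) (\<A> i) * wired_prob \<beta> q J E \<C> \<le>
      wired_prob \<beta> q J E {F. F \<inter> Ef i \<in> \<A> i \<and> F \<in> \<C>}"
    using insert.prems E by (intro wired_prob_decouple) auto
  moreover have "{F. F \<inter> Ef i \<in> \<A> i \<and> F \<in> \<C>} = {F. (\<forall>i\<in>Set.insert i I. F \<inter> Ef i \<in> \<A> i) \<and> F \<in> \<B>}"
    by (auto simp: \<C>_def)
  moreover have "wired_prob \<beta> q J (Ef i) (\<A> i) * ((\<Prod>i\<in>I. wired_prob \<beta> q J (Ef i) (\<A> i)) * wired_prob \<beta> q J E \<B>)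
    \<le> wired_prob \<beta> q J (Ef i) (\<A> i) * wired_prob \<beta> q J E \<C>"
    using IH insert.prems(1)[of i] E by (intro mult_left_mono wired_prob_nonneg) auto
  ultimately show ?case using insert.hyps by (simp add: mult.assoc)
qed

text \<open>Opening the edge cannot create clusters, so the factor \<open>q\<close> only favours the closed state.\<close>

lemma wired_prob_edge_closed:
  assumes e: "e \<in> all_edges"
  shows "exp (- \<beta>) \<le> wired_prob \<beta> q J {e} {{}}"
proof -
  obtain x y where xy: "e = {x, y}" using edge_endpoints[of all_edges e] e by blast
  let ?p = "edge_prob \<beta> J e"
  let ?k = "\<lambda>F. cluster_count e (F \<union> (all_edges - {e}))"
  have k: "?k {e} \<le> ?k {}"
    using cluster_count_insert[of e x y "all_edges - {e}"] xy by simp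
  have p: "0 \<le> ?p" "0 < 1 - ?p" "exp (- \<beta>) \<le> 1 - ?p"
    using edge_prob_bounds[OF e] edge_prob_less_1[OF e] by auto
  have w: "wired_weight \<beta> q J {e} {} = (1 - ?p) * q ^ ?k {}"
    "wired_weight \<beta> q J {e} {e} = ?p * q ^ ?k {e}"
    by (simp_all add: wired_weight_def edge_weight_def)
  have Z: "wired_weight \<beta> q J {e} {} + wired_weight \<beta> q J {e} {e} \<le> q ^ ?k {}"
  proof -
    have "?p * q ^ ?k {e} \<le> ?p * q ^ ?k {}"
      using k q p by (intro mult_left_mono power_increasing) auto
    then show ?thesis by (simp add: w algebra_simps)
  qed
  have w0: "0 < wired_weight \<beta> q J {e} {}" "0 \<le> wired_weight \<beta> q J {e} {e}"
    using e wired_weight_empty_pos[of "{e}"] wired_weight_nonneg[of "{e}"] by auto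
  have P: "wired_prob \<beta> q J {e} {{}} = wired_weight \<beta> q J {e} {} / (wired_weight \<beta> q J {e} {} + wired_weight \<beta> q J {e} {e})"
    by (simp add: wired_prob_def Pow_insert)
  have "1 - ?p = wired_weight \<beta> q J {e} {} / q ^ ?k {}" using q by (simp add: w)
  also have "\<dots> \<le> wired_prob \<beta> q J {e} {{}}"
    unfolding P using w0 Z by (intro divide_left_mono) (auto intro!: mult_pos_pos)
  finally show ?thesis using p by simp
qed

lemma wired_prob_closed:
  assumes E: "finite E" "E \<subseteq> all_edges" and G: "G \<subseteq> E"
  shows "exp (- \<beta> * card G) \<le> wired_prob \<beta> q J E {F. F \<inter> G = {}}"
proof -
  have fin: "finite G" using E G finite_subset by blast
  have "exp (- \<beta> * card G) = (\<Prod>e\<in>G. exp (- \<beta>))"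
    by (simp add: exp_of_nat_mult[symmetric] mult.commute)
  also have "\<dots> \<le> (\<Prod>e\<in>G. wired_prob \<beta> q J {e} {{}})"
    using wired_prob_edge_closed E G by (intro prod_mono) auto
  also have "\<dots> \<le> wired_prob \<beta> q J E {F. (\<forall>e\<in>G. F \<inter> {e} \<in> {{}}) \<and> F \<in> UNIV}"
    using wired_prob_blocks[OF E fin, of "\<lambda>e. {e}" "\<lambda>_. {{}}" UNIV] G wired_prob_UNIV[OF E]
    by (auto simp: disjoint_family_on_def)
  also have "{F. (\<forall>e\<in>G. F \<inter> {e} \<in> {{}}) \<and> F \<in> UNIV} = {F. F \<inter> G = {}}" by auto
  finally show ?thesis .
qed

text \<open>The form in which positive association is used.  Decreasing events on disjoint blocks, together with
the closing of the edges of \<open>G\<close>, force \<open>\<D>\<close>; their costs add up.\<close>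

theorem minus_ln_wired_prob_subadditive:
  assumes E: "finite E" "E \<subseteq> all_edges" and I: "finite I" "\<And>i. i \<in> I \<Longrightarrow> Ef i \<subseteq> E"
    and disj: "disjoint_family_on Ef I"
    and dec: "\<And>i F G. i \<in> I \<Longrightarrow> F \<subseteq> G \<Longrightarrow> G \<subseteq> Ef i \<Longrightarrow> G \<in> \<A> i \<Longrightarrow> F \<in> \<A> i"
    and ne: "\<And>i. i \<in> I \<Longrightarrow> {} \<in> \<A> i"
    and G: "G \<subseteq> E" "\<And>i. i \<in> I \<Longrightarrow> G \<inter> Ef i = {}"
    and imp: "\<And>F. F \<subseteq> E \<Longrightarrow> F \<inter> G = {} \<Longrightarrow> (\<And>i. i \<in> I \<Longrightarrow> F \<inter> Ef i \<in> \<A> i) \<Longrightarrow> F \<in> \<D>"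
  shows "- ln (wired_prob \<beta> q J E \<D>) \<le> (\<Sum>i\<in>I. - ln (wired_prob \<beta> q J (Ef i) (\<A> i))) + \<beta> * card G"
proof -
  have pos: "0 < wired_prob \<beta> q J (Ef i) (\<A> i)" if "i \<in> I" for i
    using that I E ne by (intro wired_prob_pos) (auto intro: finite_subset)
  let ?P = "\<Prod>i\<in>I. wired_prob \<beta> q J (Ef i) (\<A> i)"
  have "?P * exp (- \<beta> * card G) \<le> ?P * wired_prob \<beta> q J E {F. F \<inter> G = {}}"
    using pos wired_prob_closed[OF E G(1)] by (intro mult_left_mono prod_nonneg) (auto simp: less_imp_le)
  also have "\<dots> \<le> wired_prob \<beta> q J E {F. (\<forall>i\<in>I. F \<inter> Ef i \<in> \<A> i) \<and> F \<in> {F. F \<inter> G = {}}}"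
  proof (rule wired_prob_blocks[OF E I disj])
    show "F \<in> {F. F \<inter> G = {}} \<longleftrightarrow> F - Ef i \<in> {F. F \<inter> G = {}}" if "i \<in> I" for i F
      using G(2)[OF that] by auto
  qed (use dec in blast)+
  also have "\<dots> \<le> wired_prob \<beta> q J E \<D>"
    using imp by (intro wired_prob_mono E) auto
  finally have le: "?P * exp (- \<beta> * card G) \<le> wired_prob \<beta> q J E \<D>" .
  have P: "0 < ?P" using pos by (intro prod_pos) auto
  then have "ln (?P * exp (- \<beta> * card G)) \<le> ln (wired_prob \<beta> q J E \<D>)"
    using le by (intro ln_mono) auto
  moreover have "ln (?P * exp (- \<beta> * card G)) = (\<Sum>i\<in>I. ln (wired_prob \<beta> q J (Ef i) (\<A> i))) - \<beta> * card G"
  proof -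
    have "ln ?P = (\<Sum>i\<in>I. ln (wired_prob \<beta> q J (Ef i) (\<A> i)))"
      by (intro ln_prod I(1)) (metis pos less_irrefl)
    moreover have "ln (?P * exp (- \<beta> * card G)) = ln ?P + ln (exp (- \<beta> * card G))"
      using P by (intro ln_mult_pos) auto
    ultimately show ?thesis by simp
  qed
  ultimately show ?thesis by (simp add: sum_negf)
qed

end

text \<open>Passage from configurations with values in \<open>{0, 1}\<close> to sets of open edges.\<close>

lemma measure_rc_wired:
  assumes E: "finite E" "E \<subseteq> all_edges"
    and pos: "\<And>F. 0 \<le> wired_weight \<beta> q J E F"
  shows "measure (rc_measure E \<beta> q J wired) {\<omega> \<in> configs E. open_edges E \<omega> \<in> \<D>} = wired_prob \<beta> q J E \<D>"
proof -
  have bij: "bij_betw (open_edges E) (configs E) (Pow E)"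
    by (rule bij_betw_byWitness[where f' = "\<lambda>F. restrict (\<lambda>e. of_bool (e \<in> F)) E"])
      (auto simp: configs_def open_edges_def PiE_iff extensional_def fun_eq_iff)
  have fin: "finite (configs E)" unfolding configs_def using E by (intro finite_PiE) auto
  have w: "rc_weight E \<beta> q J wired \<omega> = wired_weight \<beta> q J E (open_edges E \<omega>)" if "\<omega> \<in> configs E" for \<omega>
  proof -
    have "edge_prob \<beta> J e ^ \<omega> e * (1 - edge_prob \<beta> J e) ^ (1 - \<omega> e)
        = (if e \<in> open_edges E \<omega> then edge_prob \<beta> J e else 1 - edge_prob \<beta> J e)" if "e \<in> E" for e
    proof -
      have "\<omega> e = 0 \<or> \<omega> e = 1" using \<open>\<omega> \<in> configs E\<close> that by (auto simp: configs_def PiE_iff)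
      then show ?thesis using that by (auto simp: open_edges_def)
    qed
    moreover have "open_edges (all_edges - E) wired = all_edges - E"
      by (auto simp: open_edges_def wired_def)
    ultimately show ?thesis
      by (simp add: rc_weight_def wired_weight_def edge_weight_def num_clusters_def cluster_count_def)
  qed
  have Z: "rc_partition E \<beta> q J wired = (\<Sum>F\<in>Pow E. wired_weight \<beta> q J E F)"
    unfolding rc_partition_def sum.reindex_bij_betw[OF bij, symmetric] by (intro sum.cong w) auto
  let ?Z = "rc_partition E \<beta> q J wired"
  have Z0: "0 \<le> ?Z" unfolding Z using pos by (intro sum_nonneg) auto
  let ?D = "{\<omega> \<in> configs E. open_edges E \<omega> \<in> \<D>}"
  have "emeasure (rc_measure E \<beta> q J wired) ?D = (\<Sum>\<omega>\<in>?D. ennreal (rc_weight E \<beta> q J wired \<omega> / ?Z))"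
    unfolding rc_measure_def using fin by (subst emeasure_point_measure_finite) auto
  also have "\<dots> = ennreal (\<Sum>\<omega>\<in>?D. rc_weight E \<beta> q J wired \<omega> / ?Z)"
    using pos Z0 by (subst sum_ennreal) (auto simp: w)
  finally have "measure (rc_measure E \<beta> q J wired) ?D = (\<Sum>\<omega>\<in>?D. rc_weight E \<beta> q J wired \<omega> / ?Z)"
    unfolding measure_def using pos Z0 by (subst \<open>emeasure _ ?D = _\<close>) (auto simp: w intro!: enn2real_ennreal sum_nonneg)
  also have "\<dots> = (\<Sum>\<omega>\<in>configs E. wired_weight \<beta> q J E (open_edges E \<omega>) * of_bool (open_edges E \<omega> \<in> \<D>) / ?Z)"
    using fin by (intro sum.mono_neutral_cong_left) (auto simp: w)
  also have "\<dots> = (\<Sum>F\<in>Pow E. wired_weight \<beta> q J E F * of_bool (F \<in> \<D>) / ?Z)"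
    by (rule sum.reindex_bij_betw[OF bij])
  finally show ?thesis by (simp add: wired_prob_def Z sum_divide_distrib)
qed

\<comment> \<open>keeps the index set of a tangential basis in the form \<open>{1..<d}\<close>\<close>
declare One_nat_def [simp del]

section \<open>Volumes of tilted boxes\<close>

lemma isometry_image_ball:
  fixes f :: "'a::metric_space \<Rightarrow> 'a"
  assumes iso: "\<And>x y. dist (f x) (f y) = dist x y" and "surj f"
  shows "f ` ball c r = ball (f c) r"
proof (intro equalityI subsetI)
  fix y assume "y \<in> ball (f c) r"
  moreover obtain x where "y = f x" using \<open>surj f\<close> by (meson surjE)
  ultimately show "y \<in> f ` ball c r" by (auto simp: iso)
qed (auto simp: iso)

lemma open_isometry_image:
  fixes f :: "'a::metric_space \<Rightarrow> 'a"
  assumes iso: "\<And>x y. dist (f x) (f y) = dist x y" and "surj f" and "open U"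
  shows "open (f ` U)"
proof (unfold open_contains_ball, intro ballI)
  fix y assume "y \<in> f ` U"
  then obtain x where x: "x \<in> U" "y = f x" by auto
  then obtain e where "e > 0" "ball x e \<subseteq> U" using \<open>open U\<close> open_contains_ball by blast
  then show "\<exists>e>0. ball y e \<subseteq> f ` U"
    using isometry_image_ball[OF iso \<open>surj f\<close>, of x e] x by blast
qed

text \<open>Volume is invariant under rotations because it is so for balls: by Vitali's theorem an open set is a
countable disjoint union of balls up to a negligible set, and an isometry maps balls to balls of the
same radius and negligible sets to negligible sets.\<close>

lemma emeasure_isometry_image:
  fixes f :: "'a::euclidean_space \<Rightarrow> 'a"
  assumes iso: "\<And>x y. dist (f x) (f y) = dist x y" and "surj f" and "open U"
  shows "emeasure lborel (f ` U) = emeasure lborel U"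
proof -
  have inj: "inj f" by (rule injI) (metis iso dist_eq_0_iff)
  define K where "K = {(x, r). ball x r \<subseteq> U}"
  obtain C where C: "countable C" "C \<subseteq> K"
    and disj: "pairwise (\<lambda>i j. disjnt (ball (fst i) (snd i)) (ball (fst j) (snd j))) C"
    and neg: "negligible (U - (\<Union>i\<in>C. ball (fst i) (snd i)))"
  proof (rule Vitali_covering_theorem_balls[of U K fst snd])
    fix x and d :: real assume "x \<in> U" "0 < d"
    then obtain e where "e > 0" "ball x e \<subseteq> U" using \<open>open U\<close> open_contains_ball by blast
    then show "\<exists>i. i \<in> K \<and> x \<in> ball (fst i) (snd i) \<and> snd i < d"
      using \<open>0 < d\<close> by (intro exI[of _ "(x, min e (d/2))"]) (auto simp: K_def)
  qed
  define B where "B i = ball (fst i) (snd i)" for i :: "'a \<times> real"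
  define B' where "B' i = ball (f (fst i)) (snd i)" for i :: "'a \<times> real"
  have fB: "f ` B i = B' i" for i
    by (simp add: B_def B'_def isometry_image_ball[OF iso \<open>surj f\<close>])
  have same: "emeasure lborel (B i) = emeasure lborel (B' i)" for i
    by (cases "0 \<le> snd i") (auto simp: B_def B'_def emeasure_ball ball_empty)
  have dB: "disjoint_family_on B C"
    using disj by (auto simp: disjoint_family_on_def pairwise_def disjnt_def B_def)
  have dB': "disjoint_family_on B' C"
    unfolding disjoint_family_on_def
  proof (intro ballI impI)
    fix i j assume ij: "i \<in> C" "j \<in> C" "i \<noteq> j"
    have "B' i \<inter> B' j = f ` (B i \<inter> B j)" using inj by (simp add: fB[symmetric] image_Int)
    also have "B i \<inter> B j = {}" using dB ij by (auto simp: disjoint_family_on_def)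
    finally show "B' i \<inter> B' j = {}" by simp
  qed
  have BU: "B i \<subseteq> U" if "i \<in> C" for i
  proof -
    have "i \<in> K" using that C by blast
    then show ?thesis by (cases i) (simp add: K_def B_def)
  qed
  have split: "emeasure lborel V = emeasure lborel (\<Union>i\<in>C. X i)"
    if V: "open V" "(\<Union>i\<in>C. X i) \<subseteq> V" "\<And>i. open (X i)" "negligible (V - (\<Union>i\<in>C. X i))"
    for V :: "'a set" and X
  proof -
    have b: "(\<Union>i\<in>C. X i) \<in> sets lborel" "V - (\<Union>i\<in>C. X i) \<in> sets lborel"
    proof -
      have "open (\<Union>i\<in>C. X i)" using V(3) by blast
      then show "(\<Union>i\<in>C. X i) \<in> sets lborel" by simp
      with V(1) show "V - (\<Union>i\<in>C. X i) \<in> sets lborel" by (intro sets.Diff) auto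
    qed
    have "V - (\<Union>i\<in>C. X i) \<in> null_sets lborel"
      using V(4) b by (auto simp: negligible_iff_null_sets null_sets_completion_iff)
    from emeasure_Un_null_set[OF b(1) this] V(2) show ?thesis by (simp add: Un_absorb1)
  qed
  have "emeasure lborel U = emeasure lborel (\<Union>i\<in>C. B i)"
    by (intro split \<open>open U\<close>) (use BU neg in \<open>auto simp: B_def\<close>)
  also have "\<dots> = (\<integral>\<^sup>+i. emeasure lborel (B i) \<partial>count_space C)"
    by (rule emeasure_UN_countable[OF _ C(1) dB]) (simp add: B_def)
  also have "\<dots> = (\<integral>\<^sup>+i. emeasure lborel (B' i) \<partial>count_space C)"
    by (simp add: same)
  also have "\<dots> = emeasure lborel (\<Union>i\<in>C. B' i)"
    by (rule emeasure_UN_countable[symmetric, OF _ C(1) dB']) (simp add: B'_def)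
  also have "\<dots> = emeasure lborel (f ` U)"
  proof (rule split[symmetric])
    have "(\<Union>i\<in>C. B' i) = f ` (\<Union>i\<in>C. B i)" by (simp add: image_UN fB)
    moreover have "(\<Union>i\<in>C. B i) \<subseteq> U" using BU by blast
    ultimately show "(\<Union>i\<in>C. B' i) \<subseteq> f ` U" by blast
    have "f ` U - (\<Union>i\<in>C. B' i) = f ` (U - (\<Union>i\<in>C. B i))"
      using inj by (simp add: image_UN fB[symmetric] image_set_diff)
    moreover have "negligible (f ` (U - (\<Union>i\<in>C. B i)))"
    proof (rule negligible_locally_Lipschitz_image)
      show "negligible (U - (\<Union>i\<in>C. B i))" using neg by (simp add: B_def)
      show "\<exists>T B. open T \<and> x \<in> T \<and> (\<forall>y\<in>(U - (\<Union>i\<in>C. B' i)) \<inter> T. norm (f y - f x) \<le> B * norm (y - x))" for x B'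
        by (rule exI[of _ UNIV], rule exI[of _ 1]) (auto simp: iso[unfolded dist_norm])
    qed simp
    ultimately show "negligible (f ` U - (\<Union>i\<in>C. B' i))" by simp
  qed (use open_isometry_image[OF iso \<open>surj f\<close> \<open>open U\<close>] in \<open>auto simp: B'_def\<close>)
  finally show ?thesis by simp
qed

text \<open>The open box in the coordinates of the orthonormal basis: \<open>L\<close> is the side in the tangential
directions \<open>u 1, \<dots>, u (d - 1)\<close>, and \<open>H\<close> is half the height in the direction \<open>n\<close>.\<close>

definition tilted_box ::
  "(nat \<Rightarrow> real ^ 'd) \<Rightarrow> real ^ 'd \<Rightarrow> real ^ 'd \<Rightarrow> real \<Rightarrow> real \<Rightarrow> (real ^ 'd) set" where
  "tilted_box u n x L H =
     {y. (\<forall>k\<in>{1..<CARD('d)}. \<bar>(y - x) \<bullet> u k\<bar> < L / 2) \<and> \<bar>(y - x) \<bullet> n\<bar> < H}"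

lemma open_tilted_box:
  fixes n :: "real ^ 'd"
  shows "open (tilted_box u n x L H)"
proof -
  have "tilted_box u n x L H =
     (\<Inter>k\<in>{1..<CARD('d)}. {y. \<bar>(y - x) \<bullet> u k\<bar> < L / 2}) \<inter> {y :: real ^ 'd. \<bar>(y - x) \<bullet> n\<bar> < H}"
    by (auto simp: tilted_box_def)
  also have "open \<dots>"
    by (intro open_Int open_INT ballI open_Collect_less continuous_intros) auto
  finally show ?thesis .
qed

context
  fixes u :: "nat \<Rightarrow> real ^ 'd" and n :: "real ^ 'd"
  assumes onb: "orthonormal_basis_with u n"
begin

lemma basis_orthonormal:
  "n \<bullet> n = 1" "k \<in> {1..<CARD('d)} \<Longrightarrow> u k \<bullet> n = 0" "k \<in> {1..<CARD('d)} \<Longrightarrow> n \<bullet> u k = 0"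
  "j \<in> {1..<CARD('d)} \<Longrightarrow> k \<in> {1..<CARD('d)} \<Longrightarrow> u j \<bullet> u k = (if j = k then 1 else 0)"
  using onb unfolding orthonormal_basis_with_def by (auto simp: inner_commute)

lemma basis_norm: "norm n = 1" "k \<in> {1..<CARD('d)} \<Longrightarrow> norm (u k) = 1"
  using basis_orthonormal by (auto simp: norm_eq_1)

lemma basis_inner_sum:
  assumes "k \<in> {1..<CARD('d)}"
  shows "(\<Sum>j\<in>{1..<CARD('d)}. c j *\<^sub>R u j) \<bullet> u k = c k"
  using assms by (simp add: inner_sum_left basis_orthonormal if_distrib cong: if_cong)

lemma basis_inner_sum_normal: "(\<Sum>j\<in>{1..<CARD('d)}. c j *\<^sub>R u j) \<bullet> n = 0"
  by (simp add: inner_sum_left basis_orthonormal)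

text \<open>The difference of the two sides is orthogonal to a spanning set, hence to itself.\<close>

lemma basis_expansion: "v = (\<Sum>k\<in>{1..<CARD('d)}. (v \<bullet> u k) *\<^sub>R u k) + (v \<bullet> n) *\<^sub>R n"
proof -
  define w where "w = v - ((\<Sum>k\<in>{1..<CARD('d)}. (v \<bullet> u k) *\<^sub>R u k) + (v \<bullet> n) *\<^sub>R n)"
  have "orthogonal w y" if "y \<in> insert n (u ` {1..<CARD('d)})" for y
    using that by (auto simp: w_def orthogonal_def inner_diff_left inner_add_left
      basis_inner_sum basis_inner_sum_normal basis_orthonormal)
  moreover have "w \<in> span (insert n (u ` {1..<CARD('d)}))"
    using onb by (simp add: orthonormal_basis_with_def)
  ultimately have "orthogonal w w" by (rule orthogonal_to_span[rotated])
  then show ?thesis by (simp add: w_def orthogonal_def)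
qed

text \<open>The basis is indexed by \<open>{1..<d}\<close> and the normal, whereas coordinates of \<open>real ^ 'd\<close> are indexed by
\<open>'d\<close>.  The bijection \<open>b\<close> matches them, with \<open>0\<close> standing for the normal.\<close>

lemma basis_parametrization:
  obtains b :: "'d \<Rightarrow> nat" and f :: "real ^ 'd \<Rightarrow> real ^ 'd"
  where "bij_betw b UNIV {0..<CARD('d)}" "linear f" "surj f" "\<And>x. norm (f x) = norm x"
    "\<And>x i. f x \<bullet> (if b i = 0 then n else u (b i)) = x $ i"
proof -
  obtain b :: "'d \<Rightarrow> nat" where b: "bij_betw b UNIV {0..<CARD('d)}"
    using ex_bij_betw_finite_nat[of "UNIV :: 'd set"] by auto
  define w where "w i = (if b i = 0 then n else u (b i))" for i
  have b_range: "b i < CARD('d)" for i using b by (auto simp: bij_betw_def)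
  have b_inj: "b i = b j \<longleftrightarrow> i = j" for i j using b by (auto simp: bij_betw_def inj_on_def)
  have ww: "w i \<bullet> w j = (if i = j then 1 else 0)" for i j
    using b_range[of i] b_range[of j] b_inj[of i j]
    by (auto simp: w_def basis_orthonormal)
  define f :: "real ^ 'd \<Rightarrow> real ^ 'd" where "f x = (\<Sum>i\<in>UNIV. (x $ i) *\<^sub>R w i)" for x
  have fw: "f x \<bullet> w i = x $ i" for x i
    by (simp add: f_def inner_sum_left ww if_distrib cong: if_cong)
  have lin: "linear f"
    by (rule linearI) (auto simp: f_def sum.distrib scaleR_add_left scaleR_sum_right)
  have "f x \<bullet> f x = x \<bullet> x" for x
  proof -
    have "f x \<bullet> f x = (\<Sum>i\<in>UNIV. (x $ i) * (f x \<bullet> w i))"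
      by (subst (2) f_def) (simp add: inner_sum_right)
    also have "\<dots> = x \<bullet> x" unfolding fw by (simp add: inner_vec_def)
    finally show ?thesis .
  qed
  then have norm: "norm (f x) = norm x" for x by (simp add: norm_eq_sqrt_inner)
  have "inj f" using norm lin by (metis linear_injective_0 norm_eq_zero)
  then have "surj f" using lin linear_injective_imp_surjective by blast
  show ?thesis
    using b lin \<open>surj f\<close> norm fw[unfolded w_def] that by blast
qed

lemma tilted_box_as_image:
  obtains f :: "real ^ 'd \<Rightarrow> real ^ 'd" and a b
  where "\<And>x y. dist (f x) (f y) = dist x y" "surj f" "tilted_box u n x L H = f ` box a b"
    "L \<ge> 0 \<Longrightarrow> H \<ge> 0 \<Longrightarrow> measure lborel (box a b) = L ^ (CARD('d) - 1) * (2 * H)"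
proof -
  obtain b :: "'d \<Rightarrow> nat" and f :: "real ^ 'd \<Rightarrow> real ^ 'd"
    where b: "bij_betw b UNIV {0..<CARD('d)}" and lin: "linear f" and surj: "surj f"
      and nrm: "\<And>x. norm (f x) = norm x"
      and fw: "\<And>x i. f x \<bullet> (if b i = 0 then n else u (b i)) = x $ i"
    by (rule basis_parametrization) (rule that; assumption)
  define c :: "real ^ 'd" where "c = (\<chi> i. if b i = 0 then H else L / 2)"
  define g where "g y = x + f y" for y
  have "dist (g y) (g z) = dist y z" for y z
    using nrm[of "y - z"] lin by (simp add: g_def dist_norm linear_diff)
  moreover have "surj g"
  proof (rule surjI)
    fix y
    show "g (inv f (y - x)) = y" using surj by (simp add: g_def surj_f_inv_f)
  qed
  moreover have box: "tilted_box u n x L H = g ` box (- c) c"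
  proof -
    have *: "g y \<in> tilted_box u n x L H \<longleftrightarrow> y \<in> box (- c) c" for y
    proof -
      have "y \<in> box (- c) c \<longleftrightarrow> (\<forall>i. \<bar>f y \<bullet> (if b i = 0 then n else u (b i))\<bar> < (if b i = 0 then H else L / 2))"
      proof -
        have "(- c) $ i < y $ i \<and> y $ i < c $ i \<longleftrightarrow> \<bar>f y \<bullet> (if b i = 0 then n else u (b i))\<bar> < (if b i = 0 then H else L / 2)" for i
        proof -
          have ci: "(if b i = 0 then H else L / 2) = c $ i" by (simp add: c_def)
          show ?thesis unfolding fw ci vector_uminus_component by arith
        qed
        then show ?thesis by (simp add: mem_box_cart)
      qed
      also have "\<dots> \<longleftrightarrow> (\<forall>k\<in>{0..<CARD('d)}. \<bar>f y \<bullet> (if k = 0 then n else u k)\<bar> < (if k = 0 then H else L / 2))"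
        using bij_betw_imp_surj_on[OF b] by (metis (no_types, lifting) UNIV_I imageE image_eqI)
      also have "{0..<CARD('d)} = insert 0 {1..<CARD('d)}" by auto
      finally show ?thesis by (auto simp: g_def tilted_box_def)
    qed
    show ?thesis
    proof (intro equalityI subsetI)
      fix z assume z: "z \<in> tilted_box u n x L H"
      obtain y where "z = g y" using \<open>surj g\<close> by (meson surjE)
      with z * show "z \<in> g ` box (- c) c" by auto
    qed (use * in auto)
  qed
  moreover have "measure lborel (box (- c) c) = L ^ (CARD('d) - 1) * (2 * H)" if "L \<ge> 0" "H \<ge> 0"
  proof -
    have "measure lborel (box (- c) c) = (\<Prod>b\<in>Basis. (c - (- c)) \<bullet> b)"
      using that by (intro measure_lborel_box) (auto simp: Basis_vec_def inner_axis c_def)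
    also have "\<dots> = (\<Prod>i\<in>UNIV. 2 * c $ i)"
    proof -
      have B1: "Basis = (\<lambda>i. axis i 1 :: real ^ 'd) ` UNIV" by (auto simp: Basis_vec_def)
      have B2: "inj (\<lambda>i. axis i 1 :: real ^ 'd)" by (auto simp: inj_on_def axis_eq_axis)
      have "(\<Prod>b\<in>Basis. (c - (- c)) \<bullet> b) = (\<Prod>i\<in>UNIV. (c - (- c)) \<bullet> axis i 1)"
        unfolding B1 by (subst prod.reindex[OF B2]) (simp add: o_def)
      then show ?thesis by (simp add: inner_axis)
    qed
    also have "\<dots> = (\<Prod>i\<in>UNIV. if b i = 0 then 2 * H else L)" by (intro prod.cong) (auto simp: c_def)
    also have "\<dots> = (\<Prod>k\<in>{0..<CARD('d)}. if k = 0 then 2 * H else L)"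
      by (rule prod.reindex_bij_betw[OF b])
    also have "{0..<CARD('d)} = insert 0 {1..<CARD('d)}" by auto
    also have "(\<Prod>k\<in>insert 0 {1..<CARD('d)}. if k = 0 then 2 * H else L) = L ^ (CARD('d) - 1) * (2 * H)"
      by simp
    finally show ?thesis .
  qed
  ultimately show ?thesis using that by blast
qed

lemma bounded_tilted_box: "bounded (tilted_box u n x L H)"
proof -
  obtain f :: "real ^ 'd \<Rightarrow> real ^ 'd" and a b
    where f: "\<And>x y. dist (f x) (f y) = dist x y" and im: "tilted_box u n x L H = f ` box a b"
    by (rule tilted_box_as_image) blast
  obtain e where "\<And>y. y \<in> box a b \<Longrightarrow> dist a y \<le> e"
    using bounded_box[of a b] unfolding bounded_any_center[of _ a] by blast
  then show ?thesis
    unfolding im bounded_def by (intro exI[of _ "f a"] exI[of _ e]) (auto simp: f)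
qed

lemma tilted_box_lmeasurable: "tilted_box u n x L H \<in> fmeasurable lborel"
  using emeasure_bounded_finite[OF bounded_tilted_box]
  by (intro fmeasurableI) (auto simp: open_tilted_box borel_open)

lemma measure_tilted_box:
  assumes "L \<ge> 0" "H \<ge> 0"
  shows "measure lborel (tilted_box u n x L H) = L ^ (CARD('d) - 1) * (2 * H)"
proof -
  obtain f :: "real ^ 'd \<Rightarrow> real ^ 'd" and a b
    where f: "\<And>x y. dist (f x) (f y) = dist x y" "surj f" and im: "tilted_box u n x L H = f ` box a b"
      and m: "measure lborel (box a b) = L ^ (CARD('d) - 1) * (2 * H)"
    using assms by (rule_tac tilted_box_as_image) blast
  from emeasure_isometry_image[OF f open_box] m show ?thesis
    by (simp add: im measure_def)
qed

text \<open>The box is described by closed conditions on the coordinates; a point that satisfies one of them with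
equality leaves the box under an arbitrarily small move along that basis vector.\<close>

lemma interior_box_set:
  assumes "L > 0" "H > 0"
    and S: "S = {\<Sum>k\<in>{1..<CARD('d)}. t k *\<^sub>R u k | t. \<forall>k\<in>{1..<CARD('d)}. t k \<in> {-1/2..1/2}}"
  shows "interior (box_set x L H S n) = tilted_box u n x L H"
proof -
  have box: "box_set x L H S n =
    {y. (\<forall>k\<in>{1..<CARD('d)}. \<bar>(y - x) \<bullet> u k\<bar> \<le> L / 2) \<and> \<bar>(y - x) \<bullet> n\<bar> \<le> H}" (is "_ = ?R")
  proof (intro equalityI subsetI)
    fix y assume "y \<in> box_set x L H S n"
    then obtain t h where y: "y = x + L *\<^sub>R (\<Sum>k\<in>{1..<CARD('d)}. t k *\<^sub>R u k) + h *\<^sub>R n"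
      and t: "\<forall>k\<in>{1..<CARD('d)}. t k \<in> {-1/2..1/2}" and h: "h \<in> {-H..H}"
      unfolding box_set_def S by blast
    have "\<bar>(y - x) \<bullet> u k\<bar> \<le> L / 2" if k: "k \<in> {1..<CARD('d)}" for k
    proof -
      have "(y - x) \<bullet> u k = L * t k"
        using k by (simp add: y inner_add_left basis_inner_sum basis_orthonormal)
      moreover have "\<bar>t k\<bar> \<le> 1/2" using t[rule_format, OF k] by auto
      ultimately show ?thesis using \<open>L > 0\<close> by (simp add: abs_mult mult_left_le)
    qed
    moreover have "\<bar>(y - x) \<bullet> n\<bar> \<le> H"
      using h by (auto simp: y inner_add_left basis_inner_sum_normal basis_orthonormal)
    ultimately show "y \<in> ?R" by blast
  next
    fix y assume y: "y \<in> ?R"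
    define t where "t k = ((y - x) \<bullet> u k) / L" for k
    have "y = x + L *\<^sub>R (\<Sum>k\<in>{1..<CARD('d)}. t k *\<^sub>R u k) + ((y - x) \<bullet> n) *\<^sub>R n"
    proof -
      have eq: "L *\<^sub>R (\<Sum>k\<in>{1..<CARD('d)}. t k *\<^sub>R u k) = (\<Sum>k\<in>{1..<CARD('d)}. ((y - x) \<bullet> u k) *\<^sub>R u k)"
        using \<open>L > 0\<close> by (simp add: t_def scaleR_sum_right)
      show ?thesis
        unfolding eq add.assoc by (simp only: basis_expansion[of "y - x", symmetric]) simp
    qed
    moreover have "\<forall>k\<in>{1..<CARD('d)}. t k \<in> {-1/2..1/2}"
      using y \<open>L > 0\<close> by (auto simp: t_def field_simps abs_le_iff)
    moreover have "(y - x) \<bullet> n \<in> {-H..H}" using y by (auto simp: abs_le_iff)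
    ultimately show "y \<in> box_set x L H S n"
      unfolding box_set_def S by blast
  qed
  show ?thesis
  proof (rule interior_unique)
    show "tilted_box u n x L H \<subseteq> box_set x L H S n" by (auto simp: box tilted_box_def intro: less_imp_le)
    show "open (tilted_box u n x L H)" by (rule open_tilted_box)
    fix T assume T: "T \<subseteq> box_set x L H S n" "open T"
    show "T \<subseteq> tilted_box u n x L H"
    proof
      fix y assume "y \<in> T"
      then obtain e where e: "e > 0" "ball y e \<subseteq> T" using T open_contains_ball by blast
      have strict: "\<bar>(y - x) \<bullet> w\<bar> < c" if w: "w \<bullet> w = 1" and c: "\<And>z. z \<in> box_set x L H S n \<Longrightarrow> \<bar>(z - x) \<bullet> w\<bar> \<le> c" for w c
      proof -
        have nw: "norm w = 1" using w by (simp add: norm_eq_1)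
        have "y + (e/2) *\<^sub>R w \<in> ball y e" "y - (e/2) *\<^sub>R w \<in> ball y e" using e nw by (auto simp: dist_norm)
        then have "\<bar>(y + (e/2) *\<^sub>R w - x) \<bullet> w\<bar> \<le> c" "\<bar>(y - (e/2) *\<^sub>R w - x) \<bullet> w\<bar> \<le> c"
          using c e T by blast+
        moreover have "(y + (e/2) *\<^sub>R w - x) \<bullet> w = (y - x) \<bullet> w + e/2" "(y - (e/2) *\<^sub>R w - x) \<bullet> w = (y - x) \<bullet> w - e/2"
          using w by (simp_all add: inner_diff_left inner_add_left)
        ultimately show ?thesis using e by linarith
      qed
      have "\<bar>(y - x) \<bullet> u k\<bar> < L / 2" if "k \<in> {1..<CARD('d)}" for k
        using that by (intro strict) (auto simp: box basis_orthonormal)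
      moreover have "\<bar>(y - x) \<bullet> n\<bar> < H" by (intro strict) (auto simp: box basis_orthonormal)
      ultimately show "y \<in> tilted_box u n x L H" by (simp add: tilted_box_def)
    qed
  qed
qed

end

section \<open>Counting lattice points\<close>

lemma finite_lattice_bounded:
  fixes W :: "(real ^ 'd) set"
  assumes "W \<subseteq> int_lattice" "bounded W"
  shows "finite W"
proof -
  obtain B where B: "\<And>x. x \<in> W \<Longrightarrow> norm x \<le> B" using assms(2) by (auto simp: bounded_iff)
  have "vec_nth ` W \<subseteq> UNIV \<rightarrow>\<^sub>E (real_of_int ` {- \<lceil>B\<rceil>..\<lceil>B\<rceil>})"
  proof
    fix g assume "g \<in> vec_nth ` W"
    then obtain x where x: "x \<in> W" "g = vec_nth x" by auto
    have "x $ i \<in> real_of_int ` {- \<lceil>B\<rceil>..\<lceil>B\<rceil>}" for i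
    proof -
      have "x $ i \<in> \<int>" using x assms(1) by (auto simp: int_lattice_def)
      then obtain m where m: "x $ i = of_int m" by (elim Ints_cases)
      have "\<bar>x $ i\<bar> \<le> B" using component_le_norm_cart[of x i] B[OF x(1)] by linarith
      then have "\<bar>m\<bar> \<le> \<lceil>B\<rceil>" by (simp add: m) linarith
      then show ?thesis by (intro image_eqI[of _ _ m]) (auto simp: m abs_le_iff)
    qed
    then show "g \<in> UNIV \<rightarrow>\<^sub>E (real_of_int ` {- \<lceil>B\<rceil>..\<lceil>B\<rceil>})" by (auto simp: x)
  qed
  then have "finite (vec_nth ` W)" by (rule finite_subset) (intro finite_PiE; simp)
  then show ?thesis by (rule finite_imageD) (simp add: inj_on_def vec_nth_inject)
qed

lemma norm_le_card:
  fixes v :: "real ^ 'd"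
  assumes "\<And>i. \<bar>v $ i\<bar> \<le> 1"
  shows "norm v \<le> real CARD('d)"
proof -
  have "norm v \<le> (\<Sum>i\<in>UNIV. \<bar>v $ i\<bar>)" by (rule norm_le_l1_cart)
  also have "\<dots> \<le> (\<Sum>i\<in>(UNIV :: 'd set). 1)" by (intro sum_mono assms)
  finally show ?thesis by simp
qed

lemma nearby_lattice_point:
  fixes y :: "real ^ 'd"
  obtains z where "z \<in> int_lattice" "norm (z - y) \<le> real CARD('d)"
proof
  let ?z = "(\<chi> i. of_int \<lfloor>y $ i\<rfloor>) :: real ^ 'd"
  show "?z \<in> int_lattice" by (auto simp: int_lattice_def)
  show "norm (?z - y) \<le> real CARD('d)" by (intro norm_le_card) (simp, linarith)
qed

text \<open>The open unit cubes centred at the points of \<open>W\<close> are disjoint, have volume \<open>1\<close> and stay within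
distance \<open>d\<close> of \<open>W\<close>.\<close>

lemma card_lattice_le_measure:
  fixes W U :: "(real ^ 'd) set"
  assumes W: "W \<subseteq> int_lattice" "finite W" and U: "U \<in> fmeasurable lborel"
    and near: "\<And>x v. x \<in> W \<Longrightarrow> norm (v - x) \<le> real CARD('d) \<Longrightarrow> v \<in> U"
  shows "real (card W) \<le> measure lborel U"
proof -
  define h :: "real ^ 'd" where "h = (\<chi> i. 1/2)"
  define Q where "Q x = box (x - h) (x + h)" for x
  have Q: "v \<in> Q x \<longleftrightarrow> (\<forall>i. \<bar>v $ i - x $ i\<bar> < 1/2)" for v x
  proof -
    have "(x - h) $ i < v $ i \<and> v $ i < (x + h) $ i \<longleftrightarrow> \<bar>v $ i - x $ i\<bar> < 1/2" for i
    proof -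
      have "h $ i = 1/2" by (simp add: h_def)
      then show ?thesis by (smt (verit) vector_minus_component vector_add_component)
    qed
    then show ?thesis unfolding Q_def mem_box_cart by blast
  qed
  have mQ: "measure lborel (Q x) = 1" for x
  proof -
    have "measure lborel (Q x) = (\<Prod>b\<in>Basis. ((x + h) - (x - h)) \<bullet> b)"
      unfolding Q_def
      by (intro measure_lborel_box) (auto simp: Basis_vec_def inner_axis h_def)
    also have "\<dots> = (\<Prod>b\<in>(Basis :: (real ^ 'd) set). 1)"
      by (intro prod.cong) (auto simp: Basis_vec_def inner_axis h_def)
    finally show ?thesis by simp
  qed
  have fm: "Q x \<in> fmeasurable lborel" for x 
    unfolding Q_def using emeasure_lborel_box_finite[of "x - h" "x + h"] by (intro fmeasurableI) auto
  have "pairwise (\<lambda>x y. disjnt (Q x) (Q y)) W"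
    unfolding pairwise_def disjnt_iff
  proof (intro ballI impI allI notI, elim conjE)
    fix x y v assume xy: "x \<in> W" "y \<in> W" "x \<noteq> y" and v: "v \<in> Q x" "v \<in> Q y"
    have "x $ i = y $ i" for i
    proof -
      obtain a b where ab: "x $ i = of_int a" "y $ i = of_int b"
        using xy W by (auto simp: int_lattice_def subset_iff elim!: Ints_cases) (metis Ints_cases)
      have "\<bar>x $ i - y $ i\<bar> < 1" using v[unfolded Q, rule_format, of i] by linarith
      then show ?thesis by (simp add: ab)
    qed
    then show False using xy by (simp add: vec_eq_iff)
  qed
  then have "measure lborel (\<Union>x\<in>W. Q x) = (\<Sum>x\<in>W. measure lborel (Q x))"
    by (intro measure_UNION' W fm)
  also have "\<dots> = card W" by (simp add: mQ)
  finally have "real (card W) = measure lborel (\<Union>x\<in>W. Q x)" by simp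
  also have "\<dots> \<le> measure lborel U"
  proof (rule measure_mono_fmeasurable[OF _ _ U])
    show "(\<Union>x\<in>W. Q x) \<subseteq> U"
    proof
      fix v assume "v \<in> (\<Union>x\<in>W. Q x)"
      then obtain x where x: "x \<in> W" "v \<in> Q x" by auto
      have "\<bar>(v - x) $ i\<bar> \<le> 1" for i using x(2)[unfolded Q, rule_format, of i] by simp
      then have "norm (v - x) \<le> real CARD('d)" by (rule norm_le_card)
      then show "v \<in> U" using near x by blast
    qed
    show "(\<Union>x\<in>W. Q x) \<in> sets lborel" using W by (intro sets.finite_UN) (auto simp: Q_def)
  qed
  finally show ?thesis .
qed

section \<open>Gluing disconnecting surfaces\<close>

definition separating :: "real ^ 'd \<Rightarrow> real ^ 'd \<Rightarrow> (real ^ 'd) set \<Rightarrow> (real ^ 'd) set set set" where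
  "separating x n V = {F. \<not> (\<exists>y\<in>upper_boundary x n V. \<exists>z\<in>lower_boundary x n V. (y, z) \<in> connected_via F)}"

definition separation_cost ::
  "real \<Rightarrow> real \<Rightarrow> ((real ^ 'd) set \<Rightarrow> real) \<Rightarrow> real ^ 'd \<Rightarrow> real ^ 'd \<Rightarrow> (real ^ 'd) set \<Rightarrow> real" where
  "separation_cost \<beta> q J x n V = - ln (wired_prob \<beta> q J (edges_in V) (separating x n V))"

lemma separating_decreasing: "F \<subseteq> G \<Longrightarrow> G \<in> separating x n V \<Longrightarrow> F \<in> separating x n V"
  using connected_via_mono unfolding separating_def by blast

lemma empty_separating: "{} \<in> separating x n V"
  by (auto simp: separating_def connected_via_def upper_boundary_def lower_boundary_def)

lemma edges_in_mono: "V \<subseteq> W \<Longrightarrow> edges_in V \<subseteq> edges_in W"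
  unfolding edges_in_def by blast

lemma adj_sym: "adj x y \<longleftrightarrow> adj y x"
  by (simp add: adj_def norm_minus_commute)

lemma edges_in_pairD: "{a, b} \<in> edges_in V \<Longrightarrow> a \<in> V \<and> b \<in> V \<and> adj a b"
  by (auto simp: edges_in_def doubleton_eq_iff adj_sym)

lemma edges_in_pairI: "a \<in> V \<Longrightarrow> b \<in> V \<Longrightarrow> adj a b \<Longrightarrow> {a, b} \<in> edges_in V"
  by (auto simp: edges_in_def)

lemma finite_edges_in:
  assumes "finite V"
  shows "finite (edges_in V)"
proof (rule finite_subset)
  show "edges_in V \<subseteq> Pow V" by (auto simp: edges_in_def)
qed (use assms in simp)

lemma edges_in_disjoint:
  assumes "V \<inter> W = {}"
  shows "edges_in V \<inter> edges_in W = {}"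
  using assms by (auto simp: edges_in_def doubleton_eq_iff)

lemma abs_inner_unit_le:
  fixes v n :: "'a::real_inner"
  assumes "norm n = 1"
  shows "\<bar>v \<bullet> n\<bar> \<le> norm v"
  using Cauchy_Schwarz_ineq2[of v n] assms by simp

text \<open>The edges of \<open>V\<close> that have to be closed in addition to disconnecting each block \<open>Vf z\<close>.  The width
\<open>d + 1\<close> allows for centres \<open>z\<close> at height up to \<open>d\<close> and for one lattice step.\<close>

definition seam :: "real ^ 'd \<Rightarrow> (real ^ 'd) set \<Rightarrow> (real ^ 'd \<Rightarrow> (real ^ 'd) set) \<Rightarrow> (real ^ 'd) set \<Rightarrow> (real ^ 'd) set set" where
  "seam n V Vf Z = {e \<in> edges_in V. (\<forall>z\<in>Z. e \<notin> edges_in (Vf z)) \<and> (\<forall>y\<in>e. \<bar>y \<bullet> n\<bar> \<le> real CARD('d) + 1)}"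

text \<open>Call a point of a block \<open>up\<close> if it is connected, inside the block, to the upper boundary of the
block, and call a point outside all blocks \<open>up\<close> if it lies above the hyperplane.  On the boundary of a
block, disconnection makes \<open>up\<close> equivalent to lying above the centre of the block.  So \<open>up\<close> can change
along an open edge only where the edge passes between points of different levels close to the
hyperplane and belongs to no block; all these edges are in the seam and closed.  Hence \<open>up\<close> is constant
along open paths, while it separates the two boundaries of \<open>V\<close>, which no block touches.\<close>

lemma separating_glue:
  fixes n :: "real ^ 'd"
  assumes n: "norm n = 1" and V: "V \<subseteq> int_lattice"
    and disj: "disjoint_family_on Vf Z"
    and inside: "\<And>z y w. z \<in> Z \<Longrightarrow> y \<in> Vf z \<Longrightarrow> w \<in> int_lattice \<Longrightarrow> norm (w - y) \<le> 1 \<Longrightarrow> w \<in> V"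
    and flat: "\<And>z. z \<in> Z \<Longrightarrow> \<bar>z \<bullet> n\<bar> \<le> real CARD('d)"
    and F: "F \<subseteq> edges_in V" "F \<inter> seam n V Vf Z = {}"
      "\<And>z. z \<in> Z \<Longrightarrow> F \<inter> edges_in (Vf z) \<in> separating z n (Vf z)"
  shows "F \<in> separating 0 n V"
proof -
  define D where "D = real CARD('d)"
  define up where "up y \<longleftrightarrow>
    (\<exists>z\<in>Z. y \<in> Vf z \<and> (\<exists>b\<in>upper_boundary z n (Vf z). (b, y) \<in> connected_via (F \<inter> edges_in (Vf z))))
    \<or> (\<forall>z\<in>Z. y \<notin> Vf z) \<and> y \<bullet> n \<ge> 0" for y
  have uniq: "z = z'" if "z \<in> Z" "z' \<in> Z" "y \<in> Vf z" "y \<in> Vf z'" for z z' y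
    using disj that by (auto simp: disjoint_family_on_def)
  have up_in: "up y \<longleftrightarrow> (\<exists>b\<in>upper_boundary z n (Vf z). (b, y) \<in> connected_via (F \<inter> edges_in (Vf z)))"
    if "z \<in> Z" "y \<in> Vf z" for z y
    using that uniq unfolding up_def by blast
  have up_out: "up y \<longleftrightarrow> y \<bullet> n \<ge> 0" if "\<forall>z\<in>Z. y \<notin> Vf z" for y
    using that unfolding up_def by blast
  have up_boundary: "up y \<longleftrightarrow> (y - z) \<bullet> n \<ge> 0" if z: "z \<in> Z" and y: "y \<in> inner_boundary (Vf z)" for z y
  proof -
    have yV: "y \<in> Vf z" using y by (simp add: inner_boundary_def)
    show ?thesis
    proof
      assume "(y - z) \<bullet> n \<ge> 0"
      then have "y \<in> upper_boundary z n (Vf z)" using y by (simp add: upper_boundary_def)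
      then show "up y" unfolding up_in[OF z yV] using connected_via_refl by blast
    next
      assume "up y"
      then obtain b where b: "b \<in> upper_boundary z n (Vf z)" "(b, y) \<in> connected_via (F \<inter> edges_in (Vf z))"
        unfolding up_in[OF z yV] by blast
      then have "y \<notin> lower_boundary z n (Vf z)" using F(3)[OF z] by (auto simp: separating_def)
      then show "(y - z) \<bullet> n \<ge> 0" using y by (auto simp: lower_boundary_def)
    qed
  qed
  \<comment> \<open>at an edge inside no block, \<open>up\<close> is decided by a threshold of height at most \<open>D\<close>\<close>
  have level: "\<exists>t. \<bar>t\<bar> \<le> D \<and> (up a \<longleftrightarrow> a \<bullet> n \<ge> t)"
    if ab: "a \<in> V" "b \<in> V" "adj a b" and ns: "\<And>z. z \<in> Z \<Longrightarrow> \<not> (a \<in> Vf z \<and> b \<in> Vf z)" for a b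
  proof (cases "\<exists>z\<in>Z. a \<in> Vf z")
    case True
    then obtain z where z: "z \<in> Z" "a \<in> Vf z" by blast
    then have "b \<in> int_lattice - Vf z" using ns ab V by blast
    then have "a \<in> inner_boundary (Vf z)" using z ab adj_sym[of a b] by (auto simp: inner_boundary_def)
    from up_boundary[OF z(1) this] flat[OF z(1)] show ?thesis
      by (intro exI[of _ "z \<bullet> n"]) (auto simp: D_def inner_diff_left)
  next
    case False
    then show ?thesis using up_out[of a] by (intro exI[of _ 0]) (auto simp: D_def)
  qed
  have step: "up a \<longleftrightarrow> up b" if e: "{a, b} \<in> F" for a b
  proof -
    have ab: "a \<in> V" "b \<in> V" "adj a b" using e F(1) edges_in_pairD by blast+
    show ?thesis
    proof (cases "\<exists>z\<in>Z. a \<in> Vf z \<and> b \<in> Vf z")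
      case True
      then obtain z where z: "z \<in> Z" "a \<in> Vf z" "b \<in> Vf z" by blast
      have "{a, b} \<in> F \<inter> edges_in (Vf z)" using e z ab edges_in_pairI by blast
      then have "(a, b) \<in> connected_via (F \<inter> edges_in (Vf z))"
        unfolding connected_via_def by (intro r_into_rtrancl) auto
      then have "(c, a) \<in> connected_via (F \<inter> edges_in (Vf z)) \<longleftrightarrow> (c, b) \<in> connected_via (F \<inter> edges_in (Vf z))" for c
        using connected_via_cong connected_via_sym by metis
      then show ?thesis using up_in z by simp
    next
      case False
      have "{a, b} \<notin> edges_in (Vf z)" if "z \<in> Z" for z using False that edges_in_pairD by blast
      then have "\<not> (\<bar>a \<bullet> n\<bar> \<le> D + 1 \<and> \<bar>b \<bullet> n\<bar> \<le> D + 1)"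
        using e F(1,2) by (auto simp: seam_def D_def)
      moreover have "\<bar>a \<bullet> n - b \<bullet> n\<bar> \<le> 1"
        using abs_inner_unit_le[OF n, of "a - b"] ab by (simp add: adj_def inner_diff_left)
      moreover obtain s where "\<bar>s\<bar> \<le> D" "up a \<longleftrightarrow> a \<bullet> n \<ge> s" using level[OF ab] False by blast
      moreover obtain t where "\<bar>t\<bar> \<le> D" "up b \<longleftrightarrow> b \<bullet> n \<ge> t"
        using level[of b a] ab adj_sym[of a b] False by blast
      ultimately show ?thesis by (smt (verit))
    qed
  qed
  have out: "\<forall>z\<in>Z. y \<notin> Vf z" if "y \<in> inner_boundary V" for y
  proof (intro ballI notI)
    fix z assume z: "z \<in> Z" "y \<in> Vf z"
    from that obtain w where "w \<in> int_lattice - V" "adj w y" by (auto simp: inner_boundary_def)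
    then show False using inside[OF z, of w] by (simp add: adj_def)
  qed
  have "up z" if "(y, z) \<in> connected_via F" "up y" for y z
    using that unfolding connected_via_def by (induction rule: rtrancl_induct) (use step in auto)
  moreover have "up y" if "y \<in> upper_boundary 0 n V" for y
    using that up_out[OF out, of y] by (auto simp: upper_boundary_def)
  moreover have "\<not> up y" if "y \<in> lower_boundary 0 n V" for y
    using that up_out[OF out, of y] by (auto simp: lower_boundary_def)
  ultimately show ?thesis unfolding separating_def by blast
qed

lemma separation_cost_subadditive:
  fixes n :: "real ^ 'd"
  assumes q: "q \<ge> 1" and \<beta>: "\<beta> \<ge> 0" and J: "\<And>e. e \<in> all_edges \<Longrightarrow> 0 \<le> J e \<and> J e \<le> 1"
    and n: "norm n = 1" and V: "V \<subseteq> int_lattice" "finite V" and Z: "finite Z"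
    and sub: "\<And>z. z \<in> Z \<Longrightarrow> Vf z \<subseteq> int_lattice"
    and disj: "disjoint_family_on Vf Z"
    and inside: "\<And>z y w. z \<in> Z \<Longrightarrow> y \<in> Vf z \<Longrightarrow> w \<in> int_lattice \<Longrightarrow> norm (w - y) \<le> 1 \<Longrightarrow> w \<in> V"
    and flat: "\<And>z. z \<in> Z \<Longrightarrow> \<bar>z \<bullet> n\<bar> \<le> real CARD('d)"
  shows "separation_cost \<beta> q J 0 n V
       \<le> (\<Sum>z\<in>Z. separation_cost \<beta> q J z n (Vf z)) + \<beta> * card (seam n V Vf Z)"
  unfolding separation_cost_def
proof (rule minus_ln_wired_prob_subadditive[OF q \<beta> J])
  show "edges_in (Vf z) \<subseteq> edges_in V" if "z \<in> Z" for z
    using inside[OF that] sub[OF that] by (intro edges_in_mono) auto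
  show "disjoint_family_on (\<lambda>z. edges_in (Vf z)) Z"
    using disj edges_in_disjoint unfolding disjoint_family_on_def by blast
  show "F \<in> separating 0 n V" if "F \<subseteq> edges_in V" "F \<inter> seam n V Vf Z = {}"
    "\<And>z. z \<in> Z \<Longrightarrow> F \<inter> edges_in (Vf z) \<in> separating z n (Vf z)" for F
    by (rule separating_glue[OF n V(1) disj inside flat that])
qed (use V Z in \<open>auto simp: empty_separating seam_def intro: finite_edges_in separating_decreasing dest: edges_in_mono\<close>)

lemma separation_cost_nonneg:
  assumes q: "q \<ge> 1" and \<beta>: "\<beta> \<ge> 0" and J: "\<And>e. e \<in> all_edges \<Longrightarrow> 0 \<le> J e \<and> J e \<le> 1"
    and V: "V \<subseteq> int_lattice" "finite V"
  shows "0 \<le> separation_cost \<beta> q J x n V"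
proof -
  have E: "finite (edges_in V)" "edges_in V \<subseteq> all_edges"
    using finite_edges_in[OF V(2)] edges_in_mono[OF V(1)] by auto
  have "0 < wired_prob \<beta> q J (edges_in V) (separating x n V)"
    by (rule wired_prob_pos[OF q \<beta> J E empty_separating])
  moreover have "wired_prob \<beta> q J (edges_in V) (separating x n V) \<le> 1"
    by (rule wired_prob_le_1[OF q \<beta> J E])
  ultimately show ?thesis by (simp add: separation_cost_def)
qed

lemma int_lattice_diff: "x \<in> int_lattice \<Longrightarrow> y \<in> int_lattice \<Longrightarrow> x - y \<in> int_lattice"
  by (simp add: int_lattice_def)

text \<open>\<open>P z y\<close> is meant to say that \<open>y\<close> is deep inside the block of \<open>z\<close>: all edges at such a \<open>y\<close> belong to
the block.  Every edge of the seam therefore arises from an endpoint that is deep in no block by one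
of the unit steps of the lattice.\<close>

lemma card_seam_le:
  fixes n :: "real ^ 'd"
  assumes V: "V \<subseteq> int_lattice" "finite V"
    and deep: "\<And>z y w. z \<in> Z \<Longrightarrow> y \<in> V \<Longrightarrow> \<bar>y \<bullet> n\<bar> \<le> real CARD('d) + 1 \<Longrightarrow> P z y \<Longrightarrow>
      w \<in> int_lattice \<Longrightarrow> norm (w - y) \<le> 1 \<Longrightarrow> w \<in> Vf z"
  shows "card (seam n V Vf Z) \<le> card {y \<in> V. \<bar>y \<bullet> n\<bar> \<le> real CARD('d) + 1 \<and> (\<forall>z\<in>Z. \<not> P z y)}
     * card (int_lattice \<inter> sphere 0 1 :: (real ^ 'd) set)"
proof -
  let ?W = "{y \<in> V. \<bar>y \<bullet> n\<bar> \<le> real CARD('d) + 1 \<and> (\<forall>z\<in>Z. \<not> P z y)}"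
  let ?T = "int_lattice \<inter> sphere 0 1 :: (real ^ 'd) set"
  have fin: "finite (?W \<times> ?T)"
  proof (rule finite_cartesian_product)
    show "finite ?W" using V(2) by simp
    show "finite ?T" by (rule finite_lattice_bounded) (auto intro: bounded_subset[OF bounded_sphere])
  qed
  have "seam n V Vf Z \<subseteq> (\<lambda>(y, t). {y, y + t}) ` (?W \<times> ?T)"
  proof
    fix e assume e: "e \<in> seam n V Vf Z"
    then obtain a b where ab: "e = {a, b}" "a \<in> V" "b \<in> V" "adj a b"
      by (auto simp: seam_def edges_in_def)
    have lat: "a \<in> int_lattice" "b \<in> int_lattice" using ab V by auto
    have an: "\<bar>a \<bullet> n\<bar> \<le> real CARD('d) + 1" using e ab(1) by (auto simp: seam_def)
    have nP: "\<not> P z a" if z: "z \<in> Z" for z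
    proof
      assume P: "P z a"
      have "a \<in> Vf z" using deep[OF z ab(2) an P lat(1)] by simp
      moreover have "b \<in> Vf z" using deep[OF z ab(2) an P lat(2)] ab(4)
        by (simp add: adj_def norm_minus_commute)
      ultimately have "e \<in> edges_in (Vf z)" using ab edges_in_pairI by blast
      then show False using e z by (auto simp: seam_def)
    qed
    have "b - a \<in> ?T" using lat ab(4) by (simp add: int_lattice_diff adj_def norm_minus_commute)
    then show "e \<in> (\<lambda>(y, t). {y, y + t}) ` (?W \<times> ?T)"
      using ab an nP by (intro image_eqI[of _ _ "(a, b - a)"]) auto
  qed
  then have "card (seam n V Vf Z) \<le> card (?W \<times> ?T)" using fin by (rule surj_card_le[rotated])
  then show ?thesis by (simp add: card_cartesian_product)
qed

section \<open>Tiling by boxes centred at lattice points\<close>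

definition lattice_box ::
  "(nat \<Rightarrow> real ^ 'd) \<Rightarrow> real ^ 'd \<Rightarrow> real ^ 'd \<Rightarrow> real \<Rightarrow> real \<Rightarrow> (real ^ 'd) set" where
  "lattice_box u n x L H = int_lattice \<inter> tilted_box u n x L H"

lemma finite_lattice_box: "orthonormal_basis_with u n \<Longrightarrow> finite (lattice_box u n x L H)"
  unfolding lattice_box_def
  by (intro finite_lattice_bounded) (auto intro: bounded_subset[OF bounded_tilted_box])

text \<open>Both families span the hyperplane orthogonal to \<open>n\<close>, so the normal component of \<open>v\<close> drops out.\<close>

lemma tangential_change_of_basis:
  fixes u u' :: "nat \<Rightarrow> real ^ 'd"
  assumes onb: "orthonormal_basis_with u n" "orthonormal_basis_with u' n"
    and c: "0 \<le> c" "\<And>j. j \<in> {1..<CARD('d)} \<Longrightarrow> \<bar>v \<bullet> u j\<bar> \<le> c" and k: "k \<in> {1..<CARD('d)}"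
  shows "\<bar>v \<bullet> u' k\<bar> \<le> real CARD('d) * c"
proof -
  have "v \<bullet> u' k = ((\<Sum>j\<in>{1..<CARD('d)}. (v \<bullet> u j) *\<^sub>R u j) + (v \<bullet> n) *\<^sub>R n) \<bullet> u' k"
    using basis_expansion[OF onb(1), of v] by simp
  also have "\<dots> = (\<Sum>j\<in>{1..<CARD('d)}. (v \<bullet> u j) * (u j \<bullet> u' k))"
    using basis_orthonormal(3)[OF onb(2) k] by (simp add: inner_add_left inner_sum_left)
  also have "\<bar>\<dots>\<bar> \<le> (\<Sum>j\<in>{1..<CARD('d)}. c)"
  proof (rule order_trans[OF sum_abs], rule sum_mono)
    fix j assume j: "j \<in> {1..<CARD('d)}"
    have "\<bar>u j \<bullet> u' k\<bar> \<le> 1"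
      using abs_inner_unit_le[OF basis_norm(2)[OF onb(2) k], of "u j"] basis_norm(2)[OF onb(1) j] by simp
    then have "\<bar>v \<bullet> u j\<bar> * \<bar>u j \<bullet> u' k\<bar> \<le> c * 1"
      using c j by (intro mult_mono) auto
    then show "\<bar>(v \<bullet> u j) * (u j \<bullet> u' k)\<bar> \<le> c" by (simp add: abs_mult)
  qed
  also have "\<dots> \<le> real CARD('d) * c" using c by (simp add: mult_right_mono)
  finally show ?thesis .
qed

text \<open>The centres are lattice points within distance \<open>D\<close> of the points \<open>c a\<close>, with integer
coordinates \<open>a\<close>, of the tangential grid of spacing \<open>p = l + 2 D\<close> in the directions \<open>u\<close>; the spacing
keeps the blocks disjoint.  Only those grid points are kept whose cells stay in the large box, which is
what the margin \<open>r\<close> guarantees.  The cells of the kept points contain disjoint boxes of side \<open>l\<close>, which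
bounds their number from above, and they cover the large box up to a margin \<open>2 r\<close>, which bounds it
from below.  The points near the hyperplane that are deep in no block are counted by volume:
thickened by \<open>D\<close>, they avoid concentric boxes of side \<open>l - 2 - 4 D\<close> around the kept grid points.\<close>

theorem tiling:
  fixes u u' :: "nat \<Rightarrow> real ^ 'd" and n :: "real ^ 'd" and l h L H :: real
  defines "D \<equiv> real CARD('d)" and "m \<equiv> CARD('d) - 1"
  defines "r \<equiv> D * (l + 2 * D + 1) + D + 1"
  assumes onb: "orthonormal_basis_with u n" "orthonormal_basis_with u' n"
    and l: "l > 4 * D + 2" and h: "h > 2 * D + 2" and H: "H \<ge> h + 2 * D + 2" and L: "L \<ge> 4 * r"
  obtains Z where "finite Z" "Z \<subseteq> int_lattice" "\<And>z. z \<in> Z \<Longrightarrow> \<bar>z \<bullet> n\<bar> \<le> D"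
    "disjoint_family_on (\<lambda>z. lattice_box u n z l h) Z"
    "\<And>z y w. z \<in> Z \<Longrightarrow> y \<in> lattice_box u n z l h \<Longrightarrow> w \<in> int_lattice \<Longrightarrow> norm (w - y) \<le> 1 \<Longrightarrow>
       w \<in> lattice_box u' n 0 L H"
    "real (card Z) * l ^ m \<le> L ^ m"
    "real (card {y \<in> lattice_box u' n 0 L H. \<bar>y \<bullet> n\<bar> \<le> D + 1 \<and>
        (\<forall>z\<in>Z. \<not> (\<forall>k\<in>{1..<CARD('d)}. \<bar>(y - z) \<bullet> u k\<bar> < l / 2 - 1))})
      \<le> (4 * D + 4) * ((L + 2 * D) ^ m - ((L - 4 * r) / (l + 2 * D + 1)) ^ m * (l - 2 - 4 * D) ^ m)"
proof -
  let ?I = "{1..<CARD('d)}"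
  define p where "p = l + 2 * D"
  have D1: "D \<ge> 1" unfolding D_def using zero_less_card_finite[where 'a = 'd] by linarith
  have pos: "l > 0" "p > 0" "h > 0" using l h D1 by (auto simp: p_def)
  have r: "r \<ge> D * (p / 2)" "r > D * (l / 2) + D + 1" "r > D * (l / 2)" "r > 0"
  proof -
    have "D * (p / 2) \<le> D * (l + 2 * D + 1)" "D * (l / 2) < D * (l + 2 * D + 1)"
      using D1 pos by (intro mult_left_mono mult_strict_left_mono; simp add: p_def)+
    moreover have "0 < D * (l + 2 * D + 1)" using D1 pos by simp
    ultimately show "r \<ge> D * (p / 2)" "r > D * (l / 2) + D + 1" "r > D * (l / 2)" "r > 0"
      using D1 unfolding r_def by linarith+
  qed
  define c where "c a = (\<Sum>k\<in>?I. (p * real_of_int (a k)) *\<^sub>R u k)" for a :: "nat \<Rightarrow> int"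
  have cu: "c a \<bullet> u k = p * real_of_int (a k)" if "k \<in> ?I" for a k
    unfolding c_def by (rule basis_inner_sum[OF onb(1) that])
  have cn: "c a \<bullet> n = 0" for a unfolding c_def by (rule basis_inner_sum_normal[OF onb(1)])
  define g where "g a = (SOME z. z \<in> int_lattice \<and> norm (z - c a) \<le> D)" for a
  have g: "g a \<in> int_lattice" "norm (g a - c a) \<le> D" for a
  proof -
    have "\<exists>z. z \<in> int_lattice \<and> norm (z - c a) \<le> D" using nearby_lattice_point[of "c a"] unfolding D_def by metis
    from someI_ex[OF this] show "g a \<in> int_lattice" "norm (g a - c a) \<le> D" by (auto simp: g_def)
  qed
  have gu: "\<bar>(g a - c a) \<bullet> w\<bar> \<le> D" if "norm w = 1" for a w
    using abs_inner_unit_le[OF that, of "g a - c a"] g(2)[of a] by linarith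
  note nu = basis_norm(2)[OF onb(1)] and nu' = basis_norm(2)[OF onb(2)] and nn = basis_norm(1)[OF onb(1)]
  have gn: "\<bar>g a \<bullet> n\<bar> \<le> D" for a using gu[OF nn, of a] by (simp add: inner_diff_left cn)
  define A where "A = {a \<in> ?I \<rightarrow>\<^sub>E UNIV. \<forall>k\<in>?I. \<bar>c a \<bullet> u' k\<bar> + r \<le> L / 2}"
  \<comment> \<open>\<open>p\<close> is the spacing of the grid\<close>
  have same: "a = b" if "a \<in> A" "b \<in> A" "\<And>k. k \<in> ?I \<Longrightarrow> \<bar>(c a - c b) \<bullet> u k\<bar> < p" for a b
  proof (rule PiE_ext)
    show "a \<in> ?I \<rightarrow>\<^sub>E UNIV" "b \<in> ?I \<rightarrow>\<^sub>E UNIV" using that by (auto simp: A_def)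
    fix k assume k: "k \<in> ?I"
    have "p * \<bar>real_of_int (a k) - real_of_int (b k)\<bar> < p * 1"
      using that(3)[OF k] pos by (simp add: inner_diff_left cu[OF k] right_diff_distrib[symmetric] abs_mult)
    then have "\<bar>real_of_int (a k) - real_of_int (b k)\<bar> < 1" using pos by (simp only: mult_less_cancel_left_pos)
    then show "a k = b k" by linarith
  qed
  have tdisj: "tilted_box u n (c a) s t \<inter> tilted_box u n (c b) s t = {}"
    if "a \<in> A" "b \<in> A" "a \<noteq> b" "s \<le> p" for a b s t
  proof (rule ccontr)
    assume "\<not> ?thesis"
    then obtain v where v: "v \<in> tilted_box u n (c a) s t" "v \<in> tilted_box u n (c b) s t" by blast
    have "\<bar>(c a - c b) \<bullet> u k\<bar> < p" if k: "k \<in> ?I" for k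
    proof -
      have "\<bar>(v - c a) \<bullet> u k\<bar> < s / 2" "\<bar>(v - c b) \<bullet> u k\<bar> < s / 2" using v k by (auto simp: tilted_box_def)
      then show ?thesis using \<open>s \<le> p\<close> unfolding inner_diff_left by linarith
    qed
    then show False using same that by blast
  qed
  have gdisj: "lattice_box u n (g a) l h \<inter> lattice_box u n (g b) l h = {}" if "a \<in> A" "b \<in> A" "a \<noteq> b" for a b
  proof (rule ccontr)
    assume "\<not> ?thesis"
    then obtain v where v: "v \<in> lattice_box u n (g a) l h" "v \<in> lattice_box u n (g b) l h" by blast
    have "\<bar>(c a - c b) \<bullet> u k\<bar> < p" if k: "k \<in> ?I" for k
    proof -
      have "\<bar>(v - g a) \<bullet> u k\<bar> < l / 2" "\<bar>(v - g b) \<bullet> u k\<bar> < l / 2" using v k by (auto simp: tilted_box_def lattice_box_def)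
      then show ?thesis using gu[OF nu[OF k], of a] gu[OF nu[OF k], of b]
        unfolding p_def inner_diff_left by linarith
    qed
    then show False using same that by blast
  qed
  have g_mem: "g a \<in> lattice_box u n (g a) l h" for a
    using g pos by (auto simp: lattice_box_def tilted_box_def)
  have inj: "inj_on g A"
  proof (rule inj_onI, rule ccontr)
    fix a b assume "a \<in> A" "b \<in> A" "g a = g b" "a \<noteq> b"
    then show False using gdisj[of a b] g_mem[of a] g_mem[of b] by auto
  qed
  have inside: "w \<in> lattice_box u' n 0 L H"
    if a: "a \<in> A" and y: "y \<in> lattice_box u n (g a) l h" and w: "w \<in> int_lattice" "norm (w - y) \<le> 1" for a y w
  proof -
    have "\<bar>w \<bullet> u' k\<bar> < L / 2" if k: "k \<in> ?I" for k
    proof -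
      have "\<bar>(y - g a) \<bullet> u j\<bar> \<le> l / 2" if "j \<in> ?I" for j
        using y that by (auto simp: lattice_box_def tilted_box_def intro: less_imp_le)
      then have "\<bar>(y - g a) \<bullet> u' k\<bar> \<le> D * (l / 2)"
        unfolding D_def using pos by (intro tangential_change_of_basis[OF onb _ _ k]) auto
      moreover have "\<bar>(w - y) \<bullet> u' k\<bar> \<le> 1" using abs_inner_unit_le[OF nu'[OF k], of "w - y"] w by linarith
      moreover have "\<bar>(g a - c a) \<bullet> u' k\<bar> \<le> D" by (rule gu[OF nu'[OF k]])
      moreover have "\<bar>c a \<bullet> u' k\<bar> + r \<le> L / 2" using a k by (auto simp: A_def)
      ultimately show ?thesis using r(2,3)
        unfolding inner_diff_left by linarith
    qed
    moreover have "\<bar>w \<bullet> n\<bar> < H"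
    proof -
      have "\<bar>(y - g a) \<bullet> n\<bar> < h" using y by (auto simp: lattice_box_def tilted_box_def)
      moreover have "\<bar>(w - y) \<bullet> n\<bar> \<le> 1" using abs_inner_unit_le[OF nn, of "w - y"] w by linarith
      ultimately show ?thesis using gn[of a] H D1 unfolding inner_diff_left by linarith
    qed
    ultimately show ?thesis using w by (auto simp: lattice_box_def tilted_box_def)
  qed
  have "finite (g ` A)"
  proof (rule finite_subset[OF _ finite_lattice_box[OF onb(2)]])
    show "g ` A \<subseteq> lattice_box u' n 0 L H" using inside[OF _ g_mem, of _ "g _"] g by auto
  qed
  then have finA: "finite A" using inj by (rule finite_imageD)
  have cardZ: "card (g ` A) = card A" by (rule card_image[OF inj])
  have vol: "measure lborel (\<Union>a\<in>A. tilted_box u n (c a) s t) = real (card A) * (s ^ m * (2 * t))"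
    if "0 \<le> s" "s \<le> p" "0 \<le> t" for s t :: real
  proof -
    have "measure lborel (\<Union>a\<in>A. tilted_box u n (c a) s t) = (\<Sum>a\<in>A. measure lborel (tilted_box u n (c a) s t))"
      using tdisj that by (intro measure_UNION' finA tilted_box_lmeasurable[OF onb(1)]) (auto simp: pairwise_def disjnt_def)
    then show ?thesis using that by (simp add: measure_tilted_box[OF onb(1)] m_def)
  qed
  have near: "\<bar>v \<bullet> u' k\<bar> < L / 2" if v: "v \<in> tilted_box u n (c a) s t" and "s \<le> l" "0 \<le> s" "a \<in> A" "k \<in> ?I" for v a s t k
  proof -
    have "\<bar>(v - c a) \<bullet> u j\<bar> \<le> l / 2" if "j \<in> ?I" for j
    proof -
      have "\<bar>(v - c a) \<bullet> u j\<bar> < s / 2" using v that by (auto simp: tilted_box_def)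
      then show ?thesis using \<open>s \<le> l\<close> by linarith
    qed
    then have "\<bar>(v - c a) \<bullet> u' k\<bar> \<le> D * (l / 2)"
      unfolding D_def using pos \<open>k \<in> ?I\<close> by (intro tangential_change_of_basis[OF onb]) auto
    moreover have "\<bar>c a \<bullet> u' k\<bar> + r \<le> L / 2" using \<open>a \<in> A\<close> \<open>k \<in> ?I\<close> by (auto simp: A_def)
    ultimately show ?thesis using r(3) D1 unfolding inner_diff_left by linarith
  qed
  have L0: "L \<ge> 0" using L r by linarith
  have packed: "real (card A) * l ^ m \<le> L ^ m"
  proof -
    have "measure lborel (\<Union>a\<in>A. tilted_box u n (c a) l 1) \<le> measure lborel (tilted_box u' n 0 L 1)"
    proof (rule measure_mono_fmeasurable[OF _ _ tilted_box_lmeasurable[OF onb(2)]])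
      show "(\<Union>a\<in>A. tilted_box u n (c a) l 1) \<subseteq> tilted_box u' n 0 L 1"
      proof
        fix v assume "v \<in> (\<Union>a\<in>A. tilted_box u n (c a) l 1)"
        then obtain a where a: "a \<in> A" "v \<in> tilted_box u n (c a) l 1" by blast
        then have "\<bar>v \<bullet> n\<bar> < 1" by (simp add: tilted_box_def inner_diff_left cn)
        then show "v \<in> tilted_box u' n 0 L 1" using near[OF a(2) _ _ a(1)] pos by (auto simp: tilted_box_def)
      qed
      show "(\<Union>a\<in>A. tilted_box u n (c a) l 1) \<in> sets lborel"
        by (intro sets.finite_UN finA) (simp add: open_tilted_box)
    qed
    then show ?thesis using vol[where s = l and t = 1] pos D1 L0 by (simp add: measure_tilted_box[OF onb(2)] m_def p_def)
  qed
  have covered: "(L - 4 * r) ^ m \<le> real (card A) * (p + 1) ^ m"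
  proof -
    have "tilted_box u' n 0 (L - 4 * r) 1 \<subseteq> (\<Union>a\<in>A. tilted_box u n (c a) (p + 1) 1)"
    proof
      fix v assume v: "v \<in> tilted_box u' n 0 (L - 4 * r) 1"
      \<comment> \<open>the nearest grid point\<close>
      define a where "a = restrict (\<lambda>k. round (v \<bullet> u k / p)) ?I"
      have close: "\<bar>(v - c a) \<bullet> u k\<bar> \<le> p / 2" if k: "k \<in> ?I" for k
      proof -
        have "\<bar>of_int (round (v \<bullet> u k / p)) - v \<bullet> u k / p\<bar> \<le> 1 / 2" by (rule of_int_round_abs_le)
        then have "p * \<bar>of_int (round (v \<bullet> u k / p)) - v \<bullet> u k / p\<bar> \<le> p * (1 / 2)"
          using pos by (intro mult_left_mono) auto
        also have "p * \<bar>of_int (round (v \<bullet> u k / p)) - v \<bullet> u k / p\<bar> = \<bar>p * (of_int (round (v \<bullet> u k / p)) - v \<bullet> u k / p)\<bar>"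
          using pos by (simp add: abs_mult)
        also have "p * (of_int (round (v \<bullet> u k / p)) - v \<bullet> u k / p) = - ((v - c a) \<bullet> u k)"
          using pos k by (simp add: inner_diff_left cu a_def right_diff_distrib)
        finally show ?thesis by simp
      qed
      have "a \<in> A"
        unfolding A_def
      proof (intro CollectI conjI ballI)
        show "a \<in> ?I \<rightarrow>\<^sub>E UNIV" by (simp add: a_def)
        fix k assume k: "k \<in> ?I"
        have "\<bar>(v - c a) \<bullet> u' k\<bar> \<le> D * (p / 2)"
          unfolding D_def using close pos by (intro tangential_change_of_basis[OF onb _ _ k]) auto
        then have "\<bar>v \<bullet> u' k - c a \<bullet> u' k\<bar> \<le> r" using r(1) unfolding inner_diff_left by linarith
        moreover have "\<bar>v \<bullet> u' k\<bar> < L / 2 - 2 * r" using v k by (auto simp: tilted_box_def diff_divide_distrib)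
        ultimately show "\<bar>c a \<bullet> u' k\<bar> + r \<le> L / 2" by linarith
      qed
      moreover have "v \<in> tilted_box u n (c a) (p + 1) 1"
        using close v by (fastforce simp: tilted_box_def inner_diff_left cn)
      ultimately show "v \<in> (\<Union>a\<in>A. tilted_box u n (c a) (p + 1) 1)" by blast
    qed
    then have "measure lborel (tilted_box u' n 0 (L - 4 * r) 1) \<le> measure lborel (\<Union>a\<in>A. tilted_box u n (c a) (p + 1) 1)"
      by (rule measure_mono_fmeasurable)
        (auto intro!: fmeasurable.finite_UN finA tilted_box_lmeasurable[OF onb(1)] simp: open_tilted_box)
    also have "\<dots> \<le> (\<Sum>a\<in>A. measure lborel (tilted_box u n (c a) (p + 1) 1))"
      by (intro measure_UNION_le finA) (simp add: open_tilted_box)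
    finally show ?thesis using L pos by (simp add: measure_tilted_box[OF onb(1)] measure_tilted_box[OF onb(2)] m_def)
  qed
  define s where "s = l - 2 - 4 * D"
  have s: "0 < s" "s \<le> p" "s \<le> l" using l D1 by (auto simp: s_def p_def)
  let ?W = "{y \<in> lattice_box u' n 0 L H. \<bar>y \<bullet> n\<bar> \<le> D + 1 \<and>
        (\<forall>z\<in>g ` A. \<not> (\<forall>k\<in>?I. \<bar>(y - z) \<bullet> u k\<bar> < l / 2 - 1))}"
  let ?B = "tilted_box u' n 0 (L + 2 * D) (2 * D + 2)" and ?U = "\<Union>a\<in>A. tilted_box u n (c a) s (2 * D + 2)"
  have fU: "?U \<in> fmeasurable lborel" by (intro fmeasurable.finite_UN finA tilted_box_lmeasurable[OF onb(1)])
  have fB: "?B \<in> fmeasurable lborel" by (rule tilted_box_lmeasurable[OF onb(2)])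
  have "real (card ?W) \<le> measure lborel (?B - ?U)"
  proof (rule card_lattice_le_measure)
    show "?W \<subseteq> int_lattice" by (auto simp: lattice_box_def)
    show "finite ?W" using finite_lattice_box[OF onb(2)] by simp
    show "?B - ?U \<in> fmeasurable lborel" using fU fB by (rule fmeasurable_Diff[rotated, OF fmeasurableD])
    fix y v :: "real ^ 'd" assume y: "y \<in> ?W" and v: "norm (v - y) \<le> real CARD('d)"
    have vy: "\<bar>(v - y) \<bullet> w\<bar> \<le> D" if "norm w = 1" for w
      using abs_inner_unit_le[OF that, of "v - y"] v by (simp add: D_def)
    have "\<bar>v \<bullet> u' k\<bar> < L / 2 + D" if k: "k \<in> ?I" for k
    proof -
      have "\<bar>y \<bullet> u' k\<bar> < L / 2" using y k by (auto simp: lattice_box_def tilted_box_def)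
      then show ?thesis using vy[OF nu'[OF k]] unfolding inner_diff_left by linarith
    qed
    moreover have "\<bar>v \<bullet> n\<bar> < 2 * D + 2" using y vy[OF nn] unfolding inner_diff_left by auto
    ultimately have vB: "v \<in> ?B" by (simp add: tilted_box_def add_divide_distrib)
    have "v \<notin> tilted_box u n (c a) s (2 * D + 2)" if a: "a \<in> A" for a
    proof
      assume va: "v \<in> tilted_box u n (c a) s (2 * D + 2)"
      have "\<bar>(y - g a) \<bullet> u k\<bar> < l / 2 - 1" if k: "k \<in> ?I" for k
      proof -
        have "\<bar>(v - c a) \<bullet> u k\<bar> < s / 2" using va k by (auto simp: tilted_box_def)
        moreover have "s / 2 = l / 2 - 1 - 2 * D" by (simp add: s_def field_simps)
        ultimately show ?thesis using vy[OF nu[OF k]] gu[OF nu[OF k], of a]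
          unfolding inner_diff_left by linarith
      qed
      then show False using y a by blast
    qed
    with vB show "v \<in> ?B - ?U" by blast
  qed
  also have "\<dots> = measure lborel ?B - measure lborel ?U"
  proof (rule measure_Diff)
    show "?U \<subseteq> ?B"
    proof
      fix v assume "v \<in> ?U"
      then obtain a where a: "a \<in> A" "v \<in> tilted_box u n (c a) s (2 * D + 2)" by blast
      then have "\<bar>v \<bullet> n\<bar> < 2 * D + 2" by (simp add: tilted_box_def inner_diff_left cn)
      moreover have "\<bar>v \<bullet> u' k\<bar> < (L + 2 * D) / 2" if "k \<in> ?I" for k
        using near[OF a(2) s(3) _ a(1) that] s D1 by simp
      ultimately show "v \<in> ?B" by (simp add: tilted_box_def)
    qed
  qed (use fU fB in \<open>auto simp: fmeasurable_def\<close>)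
  also have "\<dots> = (L + 2 * D) ^ m * (2 * (2 * D + 2)) - real (card A) * (s ^ m * (2 * (2 * D + 2)))"
    using vol[where s = s and t = "2 * D + 2"] s D1 L0 by (simp add: measure_tilted_box[OF onb(2)] m_def)
  also have "\<dots> = (4 * D + 4) * ((L + 2 * D) ^ m - real (card A) * s ^ m)" by (simp add: algebra_simps)
  also have "\<dots> \<le> (4 * D + 4) * ((L + 2 * D) ^ m - ((L - 4 * r) / (l + 2 * D + 1)) ^ m * s ^ m)"
  proof -
    have "((L - 4 * r) / (p + 1)) ^ m \<le> real (card A)"
      using covered pos by (simp add: power_divide pos_divide_le_eq)
    then have "((L - 4 * r) / (p + 1)) ^ m * s ^ m \<le> real (card A) * s ^ m" using s by (intro mult_right_mono) auto
    then show ?thesis using D1 by (intro mult_left_mono) (auto simp: p_def)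
  qed
  finally have few: "real (card ?W) \<le> (4 * D + 4) * ((L + 2 * D) ^ m - ((L - 4 * r) / (l + 2 * D + 1)) ^ m * (l - 2 - 4 * D) ^ m)"
    by (simp add: s_def)
  show ?thesis
  proof (rule that[of "g ` A"])
    show "disjoint_family_on (\<lambda>z. lattice_box u n z l h) (g ` A)"
      using gdisj by (fastforce simp: disjoint_family_on_def)
    show "real (card (g ` A)) * l ^ m \<le> L ^ m" using packed by (simp add: cardZ)
  qed (use \<open>finite (g ` A)\<close> g gn inside few in auto)
qed

section \<open>Locality and translation invariance\<close>

lemma wired_prob_cong:
  assumes "\<And>e. e \<in> E \<Longrightarrow> J e = J' e"
  shows "wired_prob \<beta> q J E \<A> = wired_prob \<beta> q J' E \<A>"
proof -
  have "edge_weight \<beta> J E F = edge_weight \<beta> J' E F" for F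
    unfolding edge_weight_def edge_prob_def using assms by (intro prod.cong) auto
  then show ?thesis by (simp add: wired_prob_def wired_weight_def)
qed

lemma separation_cost_cong:
  assumes "\<And>e. e \<in> edges_in V \<Longrightarrow> J e = J' e"
  shows "separation_cost \<beta> q J x n V = separation_cost \<beta> q J' x n V"
  unfolding separation_cost_def using wired_prob_cong[of "edges_in V" J J'] assms by simp

context
  fixes z :: "real ^ 'd"
  assumes z: "z \<in> int_lattice"
begin

lemma translate_int_lattice: "(+) z ` int_lattice = int_lattice"
proof (intro equalityI subsetI)
  fix x assume "x \<in> (int_lattice :: (real ^ 'd) set)"
  then have "x - z \<in> int_lattice" using z int_lattice_diff by blast
  then show "x \<in> (+) z ` int_lattice" by (intro image_eqI[of _ _ "x - z"]) auto
qed (use z in \<open>auto simp: int_lattice_def\<close>)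

lemma inj_translate_edges: "inj ((`) ((+) z))"
  by (rule injI) (simp add: inj_image_eq_iff)

lemma translate_edges_in: "edges_in ((+) z ` V) = (`) ((+) z) ` edges_in V"
proof (intro equalityI subsetI)
  fix e assume "e \<in> edges_in ((+) z ` V)"
  then obtain x y where "e = {z + x, z + y}" "x \<in> V" "y \<in> V" "adj (z + x) (z + y)"
    by (auto simp: edges_in_def)
  then show "e \<in> (`) ((+) z) ` edges_in V"
    by (intro image_eqI[of _ _ "{x, y}"]) (auto simp: edges_in_def adj_def)
next
  fix e assume "e \<in> (`) ((+) z) ` edges_in V"
  then obtain x y where "e = {z + x, z + y}" "x \<in> V" "y \<in> V" "adj x y"
    by (auto simp: edges_in_def)
  then show "e \<in> edges_in ((+) z ` V)"
    using edges_in_pairI[of "z + x" "(+) z ` V" "z + y"] by (simp add: adj_def)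
qed

lemma translate_all_edges: "(`) ((+) z) ` all_edges = all_edges"
  using translate_edges_in[of int_lattice] translate_int_lattice by simp

lemma translate_connected_via:
  "(z + x, z + y) \<in> connected_via ((`) ((+) z) ` F) \<longleftrightarrow> (x, y) \<in> connected_via F"
proof -
  have pair: "{z + a, z + b} \<in> (`) ((+) z) ` F \<longleftrightarrow> {a, b} \<in> F" for a b
  proof -
    have "{z + a, z + b} = (+) z ` {a, b}" by simp
    then show ?thesis by (metis inj_image_mem_iff inj_translate_edges)
  qed
  have 1: "(z + x, z + y) \<in> connected_via ((`) ((+) z) ` F)" if "(x, y) \<in> connected_via F" for x y
    using that unfolding connected_via_def
    by (induction rule: rtrancl_induct) (auto simp: pair intro: rtrancl_into_rtrancl)
  have 2: "(a - z, b - z) \<in> connected_via F" if "(a, b) \<in> connected_via ((`) ((+) z) ` F)" for a b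
    using that unfolding connected_via_def
  proof (induction rule: rtrancl_induct)
    case (step b c)
    have "{b - z, c - z} \<in> F" using step.hyps(2) pair[of "b - z" "c - z"] by simp
    then show ?case using step.IH by (auto intro: rtrancl_into_rtrancl)
  qed simp
  show ?thesis using 1[of x y] 2[of "z + x" "z + y"] by auto
qed

lemma translate_cluster_count:
  "cluster_count ((+) z ` X) ((`) ((+) z) ` F) = cluster_count X F"
proof -
  have cl: "connected_via ((`) ((+) z) ` F) `` {z + x} = (+) z ` (connected_via F `` {x})" for x
  proof (intro equalityI subsetI)
    fix y assume "y \<in> connected_via ((`) ((+) z) ` F) `` {z + x}"
    then have "(x, y - z) \<in> connected_via F" using translate_connected_via[of x "y - z"] by simp
    then show "y \<in> (+) z ` (connected_via F `` {x})" by (intro image_eqI[of _ _ "y - z"]) auto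
  qed (auto simp: translate_connected_via)
  have "((+) z ` X) // connected_via ((`) ((+) z) ` F) = (`) ((+) z) ` (X // connected_via F)"
    by (auto simp: quotient_def cl)
  then show ?thesis
    unfolding cluster_count_def by (simp add: card_image inj_on_subset[OF inj_translate_edges])
qed

lemma translate_wired_weight:
  assumes "F \<subseteq> E" "E \<subseteq> all_edges"
  shows "wired_weight \<beta> q J ((`) ((+) z) ` E) ((`) ((+) z) ` F)
       = wired_weight \<beta> q (\<lambda>e. J ((+) z ` e)) E F"
proof -
  have mem: "(+) z ` e \<in> (`) ((+) z) ` F \<longleftrightarrow> e \<in> F" for e
    by (rule inj_image_mem_iff[OF inj_translate_edges])
  have "edge_weight \<beta> J ((`) ((+) z) ` E) ((`) ((+) z) ` F) = edge_weight \<beta> (\<lambda>e. J ((+) z ` e)) E F"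
    unfolding edge_weight_def
    by (subst prod.reindex) (auto simp: mem edge_prob_def inj_on_subset[OF inj_translate_edges] intro!: prod.cong)
  moreover have "all_edges - (`) ((+) z) ` E = (`) ((+) z) ` (all_edges - E)"
    using translate_all_edges inj_translate_edges by (metis image_set_diff)
  then have "(`) ((+) z) ` F \<union> (all_edges - (`) ((+) z) ` E) = (`) ((+) z) ` (F \<union> (all_edges - E))"
    by (simp add: image_Un)
  moreover have "\<Union>((`) ((+) z) ` E) = (+) z ` \<Union>E" by blast
  ultimately show ?thesis
    by (simp only: wired_weight_def translate_cluster_count)
qed

lemma translate_wired_prob:
  assumes "E \<subseteq> all_edges" and "\<And>F. F \<subseteq> E \<Longrightarrow> (`) ((+) z) ` F \<in> \<A>' \<longleftrightarrow> F \<in> \<A>"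
  shows "wired_prob \<beta> q J ((`) ((+) z) ` E) \<A>' = wired_prob \<beta> q (\<lambda>e. J ((+) z ` e)) E \<A>"
proof -
  let ?s = "(`) ((`) ((+) z))"
  have Pow: "Pow ((`) ((+) z) ` E) = ?s ` Pow E" by (rule image_Pow_surj[symmetric]) simp
  have inj: "inj_on ?s (Pow E)" using inj_translate_edges by (auto simp: inj_on_def inj_image_eq_iff)
  show ?thesis
    unfolding wired_prob_def Pow sum.reindex[OF inj] o_def
    using assms by (intro arg_cong2[where f = "(/)"] sum.cong) (auto simp: translate_wired_weight)
qed

lemma translate_inner_boundary: "inner_boundary ((+) z ` V) = (+) z ` inner_boundary V"
proof -
  have "int_lattice - (+) z ` V = (+) z ` (int_lattice - V)"
    by (subst translate_int_lattice[symmetric]) (simp add: image_set_diff)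
  then have mem: "z + w \<in> int_lattice - (+) z ` V \<longleftrightarrow> w \<in> int_lattice - V" for w by auto
  have adj: "adj (z + a) (z + b) \<longleftrightarrow> adj a b" for a b by (simp add: adj_def)
  have "z + x \<in> inner_boundary ((+) z ` V) \<longleftrightarrow> x \<in> inner_boundary V" for x
  proof
    assume "z + x \<in> inner_boundary ((+) z ` V)"
    then obtain w where "x \<in> V" "w \<in> int_lattice - (+) z ` V" "adj w (z + x)"
      by (auto simp: inner_boundary_def)
    then show "x \<in> inner_boundary V"
      using mem[of "w - z"] adj[of "w - z" x] by (auto simp: inner_boundary_def)
  next
    assume "x \<in> inner_boundary V"
    then obtain w where "x \<in> V" "w \<in> int_lattice - V" "adj w x" by (auto simp: inner_boundary_def)
    then show "z + x \<in> inner_boundary ((+) z ` V)"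
      using mem[of w] adj[of w x] unfolding inner_boundary_def by blast
  qed
  then have shift: "y \<in> inner_boundary ((+) z ` V) \<longleftrightarrow> y - z \<in> inner_boundary V" for y
    by (metis add.commute diff_add_cancel)
  show ?thesis
  proof (rule set_eqI)
    show "y \<in> inner_boundary ((+) z ` V) \<longleftrightarrow> y \<in> (+) z ` inner_boundary V" for y
      using shift[of y] by (auto intro: image_eqI[of y "(+) z" "y - z"])
  qed
qed

lemma translate_separation_cost:
  assumes "V \<subseteq> int_lattice"
  shows "separation_cost \<beta> q J z n ((+) z ` V) = separation_cost \<beta> q (\<lambda>e. J ((+) z ` e)) 0 n V"
proof -
  have up: "upper_boundary z n ((+) z ` V) = (+) z ` upper_boundary 0 n V"
    and low: "lower_boundary z n ((+) z ` V) = (+) z ` lower_boundary 0 n V"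
    by (auto simp: upper_boundary_def lower_boundary_def translate_inner_boundary)
  show ?thesis
    unfolding separation_cost_def translate_edges_in
    by (subst translate_wired_prob[OF edges_in_mono[OF assms], where \<A> = "separating 0 n V"])
      (auto simp: separating_def up low translate_connected_via)
qed

lemma translate_lattice_box: "lattice_box u n z L H = (+) z ` lattice_box u n 0 L H"
proof -
  have "lattice_box u n z L H = (+) z ` int_lattice \<inter> tilted_box u n z L H"
    by (simp add: translate_int_lattice lattice_box_def)
  then show ?thesis by (auto simp: lattice_box_def tilted_box_def)
qed

end

section \<open>Random couplings\<close>

text \<open>The coordinates of a product space are independent, and so are disjoint groups of them.\<close>

lemma indep_vars_PiM_blocks:
  fixes M :: "'i \<Rightarrow> 'a measure"
  assumes M: "\<And>i. i \<in> I \<Longrightarrow> prob_space (M i)" and "I \<noteq> {}"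
    and K: "\<And>j. j \<in> L \<Longrightarrow> K j \<subseteq> I" "disjoint_family_on K L"
  shows "prob_space.indep_vars (PiM I M) (\<lambda>j. PiM (K j) M) (\<lambda>j \<omega>. restrict \<omega> (K j)) L"
proof -
  interpret prob_space "PiM I M" using M by (rule prob_space_PiM)
  have "indep_vars M (\<lambda>i \<omega>. \<omega> i) I"
  proof (subst indep_vars_iff_distr_eq_PiM'[OF \<open>I \<noteq> {}\<close>])
    have "distr (PiM I M) (PiM I M) (\<lambda>x. \<lambda>i\<in>I. x i) = distr (PiM I M) (PiM I M) (\<lambda>x. x)"
      by (intro distr_cong refl) (auto simp: space_PiM)
    also have "\<dots> = PiM I M" by (rule distr_id)
    also have "\<dots> = (\<Pi>\<^sub>M i\<in>I. distr (PiM I M) (M i) (\<lambda>x. x i))"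
      using M by (intro PiM_cong refl) (simp add: distr_PiM_component)
    finally show "distr (PiM I M) (PiM I M) (\<lambda>x. \<lambda>i\<in>I. x i) = (\<Pi>\<^sub>M i\<in>I. distr (PiM I M) (M i) (\<lambda>x. x i))" .
  qed auto
  from indep_vars_restrict[OF this K] show ?thesis by simp
qed

lemma all_edges_nonempty: "(all_edges :: (real ^ 'd) set set) \<noteq> {}"
proof -
  fix k :: 'd
  have "{0, axis k 1} \<in> (all_edges :: (real ^ 'd) set set)"
  proof (rule edges_in_pairI)
    show "adj 0 (axis k 1 :: real ^ 'd)" by (simp add: adj_def norm_axis_1)
  qed (auto simp: int_lattice_def axis_def)
  then show ?thesis by blast
qed

context
  fixes \<mu> :: "real measure"
  assumes law: "coupling_law \<mu>"
begin

lemma prob_space_couplings: "prob_space (couplings \<mu>)"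
  using law unfolding couplings_def coupling_law_def by (intro prob_space_PiM) auto

lemma coupling_bounds:
  assumes "J \<in> space (couplings \<mu>)" "e \<in> all_edges"
  shows "0 \<le> J e \<and> J e \<le> 1"
proof -
  have "space \<mu> = {0..1}"
    using law sets_eq_imp_space_eq[of \<mu> "restrict_space borel {0..1}"]
    by (simp add: coupling_law_def space_restrict_space)
  then show ?thesis using assms by (auto simp: couplings_def space_PiM PiE_iff)
qed

lemma coupling_coordinate_measurable:
  assumes "e \<in> I"
  shows "(\<lambda>J. J e) \<in> borel_measurable (PiM I (\<lambda>_. \<mu>))"
proof -
  have "(\<lambda>x. x) \<in> borel_measurable \<mu>"
    using law measurable_restrict_space1[of "\<lambda>x. x" borel borel "{0..1::real}"]
    by (simp add: coupling_law_def cong: measurable_cong_sets)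
  from measurable_compose[OF measurable_component_singleton[OF assms, of "\<lambda>_. \<mu>"] this]
  show ?thesis by simp
qed

lemma separation_cost_measurable:
  assumes "edges_in V \<subseteq> I"
  shows "(\<lambda>J. separation_cost \<beta> q J x n V) \<in> borel_measurable (PiM I (\<lambda>_. \<mu>))"
proof -
  have [measurable]: "(\<lambda>J. edge_prob \<beta> J e) \<in> borel_measurable (PiM I (\<lambda>_. \<mu>))" if "e \<in> edges_in V" for e
    unfolding edge_prob_def using assms that
    by (intro borel_measurable_diff borel_measurable_const borel_measurable_exp[THEN measurable_compose[rotated]]
      borel_measurable_times coupling_coordinate_measurable) auto
  have [measurable]: "(\<lambda>J. wired_weight \<beta> q J (edges_in V) F) \<in> borel_measurable (PiM I (\<lambda>_. \<mu>))" for F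
    unfolding wired_weight_def edge_weight_def
    by (intro borel_measurable_times borel_measurable_const borel_measurable_prod) simp
  show ?thesis unfolding separation_cost_def wired_prob_def by measurable
qed

text \<open>The translation permutes the edges of the lattice, and a product of identical factors is invariant
under permutation of its indices.\<close>

lemma expectation_translate_cost:
  assumes z: "z \<in> int_lattice" and V: "V \<subseteq> int_lattice"
  shows "(\<integral>J. separation_cost \<beta> q J z n ((+) z ` V) \<partial>couplings \<mu>)
       = (\<integral>J. separation_cost \<beta> q J 0 n V \<partial>couplings \<mu>)"
proof -
  let ?\<phi> = "(`) ((+) z)"
  let ?T = "\<lambda>J. \<lambda>e\<in>all_edges. J (?\<phi> e)"
  have E: "edges_in V \<subseteq> all_edges" using V by (rule edges_in_mono)
  have ran: "?\<phi> \<in> all_edges \<rightarrow> all_edges" using translate_all_edges[OF z] by blast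
  have d: "distr (couplings \<mu>) (couplings \<mu>) ?T = couplings \<mu>"
    using distr_PiM_reindex[of all_edges "\<lambda>_. \<mu>" ?\<phi> all_edges] law ran
      inj_on_subset[OF inj_translate_edges[OF z]]
    by (auto simp: couplings_def coupling_law_def)
  have T: "?T \<in> measurable (couplings \<mu>) (couplings \<mu>)"
    unfolding couplings_def using ran
    by (intro measurable_restrict measurable_component_singleton) auto
  have "(\<integral>J. separation_cost \<beta> q J 0 n V \<partial>couplings \<mu>)
      = (\<integral>J. separation_cost \<beta> q J 0 n V \<partial>distr (couplings \<mu>) (couplings \<mu>) ?T)" by (simp only: d)
  also have "\<dots> = (\<integral>J. separation_cost \<beta> q (?T J) 0 n V \<partial>couplings \<mu>)"
    using separation_cost_measurable[OF E] by (intro integral_distr T) (simp add: couplings_def)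
  also have "\<dots> = (\<integral>J. separation_cost \<beta> q J z n ((+) z ` V) \<partial>couplings \<mu>)"
  proof (intro Bochner_Integration.integral_cong refl)
    fix J
    show "separation_cost \<beta> q (?T J) 0 n V = separation_cost \<beta> q J z n ((+) z ` V)"
      unfolding translate_separation_cost[OF z V] using E by (intro separation_cost_cong) auto
  qed
  finally show ?thesis by simp
qed

text \<open>Each cost depends only on the couplings of the edges inside its block.\<close>

lemma indep_separation_costs:
  assumes V: "\<And>z. z \<in> Z \<Longrightarrow> Vf z \<subseteq> int_lattice" and disj: "disjoint_family_on Vf Z"
  shows "prob_space.indep_vars (couplings \<mu>) (\<lambda>_. borel) (\<lambda>z J. separation_cost \<beta> q J z n (Vf z)) Z"
proof -
  interpret prob_space "couplings \<mu>" by (rule prob_space_couplings)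
  have "indep_vars (\<lambda>z. PiM (edges_in (Vf z)) (\<lambda>_. \<mu>)) (\<lambda>z J. restrict J (edges_in (Vf z))) Z"
    unfolding couplings_def
  proof (rule indep_vars_PiM_blocks)
    show "disjoint_family_on (\<lambda>z. edges_in (Vf z)) Z"
      using disj edges_in_disjoint unfolding disjoint_family_on_def by blast
  qed (use law V in \<open>auto simp: coupling_law_def all_edges_nonempty dest: edges_in_mono\<close>)
  then have "indep_vars (\<lambda>_. borel) (\<lambda>z J. separation_cost \<beta> q (restrict J (edges_in (Vf z))) z n (Vf z)) Z"
    by (rule indep_vars_compose2) (rule separation_cost_measurable, simp)
  moreover have "separation_cost \<beta> q (restrict J (edges_in (Vf z))) z n (Vf z) = separation_cost \<beta> q J z n (Vf z)" for J z
    by (rule separation_cost_cong) simp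
  ultimately show ?thesis by simp
qed

end

section \<open>Limits from asymptotic subadditivity\<close>

text \<open>The limit is the infimum of the eventual upper bounds of \<open>f\<close>, that is, the limit superior: a single
large \<open>l\<close> with \<open>f l\<close> below it by more than \<open>\<epsilon>\<close> would force a smaller eventual bound.\<close>

lemma tendsto_of_asymptotic_subadditivity:
  fixes f :: "nat \<Rightarrow> real"
  assumes nonneg: "\<And>l. 0 \<le> f l"
    and sub: "\<And>\<epsilon>. 0 < \<epsilon> \<Longrightarrow> \<forall>\<^sub>F l in sequentially. \<forall>\<^sub>F N in sequentially. f N \<le> f l + \<epsilon>"
  obtains \<tau> where "0 \<le> \<tau>" "f \<longlonglongrightarrow> \<tau>"
proof -
  \<comment> \<open>the eventual upper bounds of \<open>f\<close>\<close>
  define C where "C = {c. \<forall>\<^sub>F N in sequentially. f N \<le> c}"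
  have ne: "C \<noteq> {}"
  proof -
    have "\<exists>l. \<forall>\<^sub>F N in sequentially. f N \<le> f l + 1"
      using sub[of 1] eventually_happens'[OF sequentially_bot] by auto
    then show ?thesis by (auto simp: C_def)
  qed
  have lower: "0 \<le> c" if c: "c \<in> C" for c
  proof -
    obtain N where "f N \<le> c"
      using c eventually_happens'[OF sequentially_bot, of "\<lambda>N. f N \<le> c"] unfolding C_def by blast
    then show ?thesis using nonneg[of N] by linarith
  qed
  then have bdd: "bdd_below C" by (rule bdd_belowI)
  define \<tau> where "\<tau> = Inf C"
  have "f \<longlonglongrightarrow> \<tau>"
  proof (rule tendstoI)
    fix e :: real assume e: "e > 0"
    obtain c where c: "c \<in> C" "c < \<tau> + e"
      using cInf_lessD[OF ne, of "\<tau> + e"] e by (auto simp: \<tau>_def)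
    then have up: "\<forall>\<^sub>F N in sequentially. f N < \<tau> + e"
      by (auto simp: C_def elim: eventually_mono)
    have "\<forall>\<^sub>F l in sequentially. \<tau> - e < f l"
      using sub[of "e / 2"]
    proof (rule eventually_mono)
      show "e / 2 > 0" using e by simp
      fix l assume "\<forall>\<^sub>F N in sequentially. f N \<le> f l + e / 2"
      then have "f l + e / 2 \<in> C" by (simp add: C_def)
      then have "\<tau> \<le> f l + e / 2" unfolding \<tau>_def by (intro cInf_lower bdd)
      then show "\<tau> - e < f l" using e by linarith
    qed
    with up show "\<forall>\<^sub>F N in sequentially. dist (f N) \<tau> < e"
      by eventually_elim (auto simp: dist_real_def abs_less_iff)
  qed
  moreover have "0 \<le> \<tau>" unfolding \<tau>_def using lower ne by (intro cInf_greatest)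
  ultimately show ?thesis using that by blast
qed

lemma tendsto_of_mutual_asymptotic_bounds:
  fixes f g :: "nat \<Rightarrow> real"
  assumes f: "f \<longlonglongrightarrow> \<tau>"
    and gf: "\<And>\<epsilon>. 0 < \<epsilon> \<Longrightarrow> \<forall>\<^sub>F l in sequentially. \<forall>\<^sub>F N in sequentially. g N \<le> f l + \<epsilon>"
    and fg: "\<And>\<epsilon>. 0 < \<epsilon> \<Longrightarrow> \<forall>\<^sub>F l in sequentially. \<forall>\<^sub>F N in sequentially. f N \<le> g l + \<epsilon>"
  shows "g \<longlonglongrightarrow> \<tau>"
proof (rule tendstoI)
  fix e :: real assume e: "e > 0"
  have near: "\<forall>\<^sub>F l in sequentially. \<bar>f l - \<tau>\<bar> < e / 4"
    using tendstoD[OF f, of "e / 4"] e by (simp add: dist_real_def)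
  have "\<exists>l. \<bar>f l - \<tau>\<bar> < e / 4 \<and> (\<forall>\<^sub>F N in sequentially. g N \<le> f l + e / 4)"
    using eventually_happens'[OF sequentially_bot eventually_conj[OF near gf[of "e / 4"]]] e by auto
  then obtain l where l: "\<bar>f l - \<tau>\<bar> < e / 4" "\<forall>\<^sub>F N in sequentially. g N \<le> f l + e / 4" by blast
  then have up: "\<forall>\<^sub>F N in sequentially. g N < \<tau> + e"
    using e by (elim eventually_mono) linarith
  have "\<forall>\<^sub>F l in sequentially. \<tau> - e < g l"
    using fg[of "e / 4"]
  proof (rule eventually_mono)
    show "e / 4 > 0" using e by simp
    fix l assume "\<forall>\<^sub>F N in sequentially. f N \<le> g l + e / 4"
    then obtain N where "\<bar>f N - \<tau>\<bar> < e / 4" "f N \<le> g l + e / 4"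
      using eventually_happens'[OF sequentially_bot eventually_conj[OF near]] by blast
    then show "\<tau> - e < g l" using e by linarith
  qed
  with up show "\<forall>\<^sub>F N in sequentially. dist (g N) \<tau> < e"
    by eventually_elim (auto simp: dist_real_def abs_less_iff)
qed

context prob_space
begin

lemma integrable_indicator_event: "A \<in> events \<Longrightarrow> integrable M (indicator A :: 'a \<Rightarrow> real)"
  by (rule integrable_real_indicator) (auto simp: less_top[symmetric] emeasure_finite)

lemma expectation_le_of_upper_tail:
  assumes X: "X \<in> borel_measurable M" "\<And>\<omega>. \<omega> \<in> space M \<Longrightarrow> 0 \<le> X \<omega> \<and> X \<omega> \<le> C" and a: "0 \<le> a"
  shows "expectation X \<le> a + C * prob {\<omega> \<in> space M. X \<omega> > a}"
proof -
  let ?A = "{\<omega> \<in> space M. X \<omega> > a}"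
  have A: "?A \<in> events" using X(1) by measurable
  have int: "integrable M X"
    by (rule integrable_const_bound[where B = C]) (use X in auto)
  have "expectation X \<le> (\<integral>\<omega>. a + C * indicator ?A \<omega> \<partial>M)"
  proof (rule integral_mono[OF int])
    show "integrable M (\<lambda>\<omega>. a + C * indicator ?A \<omega>)"
      using A by (intro Bochner_Integration.integrable_add integrable_mult_right integrable_indicator_event) auto
    show "X \<omega> \<le> a + C * indicator ?A \<omega>" if "\<omega> \<in> space M" for \<omega>
      using X(2)[OF that] that a by (auto simp: indicator_def)
  qed
  also have "\<dots> = a + C * prob ?A"
    using A by (subst Bochner_Integration.integral_add) (auto simp: prob_space intro!: integrable_mult_right integrable_indicator_event)
  finally show ?thesis .
qed

text \<open>One-sided concentration suffices once the mean is known.\<close>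

lemma converges_in_probability_of_upper_tails:
  assumes X: "\<And>N. X N \<in> borel_measurable M"
    and bnd: "\<forall>\<^sub>F N in sequentially. \<forall>\<omega>\<in>space M. 0 \<le> X N \<omega> \<and> X N \<omega> \<le> C"
    and up: "\<And>\<epsilon>. 0 < \<epsilon> \<Longrightarrow> (\<lambda>N. prob {\<omega> \<in> space M. X N \<omega> > \<tau> + \<epsilon>}) \<longlonglongrightarrow> 0"
    and mean: "(\<lambda>N. expectation (X N)) \<longlonglongrightarrow> \<tau>" and \<tau>: "0 \<le> \<tau>"
  shows "converges_in_probability M X \<tau>"
  unfolding converges_in_probability_def
proof (intro conjI allI impI X)
  fix \<epsilon> :: real assume \<epsilon>: "\<epsilon> > 0"
  let ?U = "\<lambda>N e. {\<omega> \<in> space M. X N \<omega> > \<tau> + e}" and ?L = "\<lambda>N. {\<omega> \<in> space M. X N \<omega> < \<tau> - \<epsilon>}"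
  have meas: "?U N e \<in> events" "?L N \<in> events" for N e using X[of N] by measurable
  \<comment> \<open>if the lower tail had mass, the mean would fall below \<open>\<tau>\<close>, since the upper tail cannot compensate\<close>
  have key: "\<epsilon> * prob (?L N) \<le> \<tau> + e + C * prob (?U N e) - expectation (X N)"
    if b: "\<forall>\<omega>\<in>space M. 0 \<le> X N \<omega> \<and> X N \<omega> \<le> C" and e: "0 < e" for N e
  proof -
    have int: "integrable M (X N)"
      by (rule integrable_const_bound[where B = C]) (use X b in auto)
    have "expectation (\<lambda>\<omega>. X N \<omega> + \<epsilon> * indicator (?L N) \<omega>) \<le> (\<integral>\<omega>. (\<tau> + e) + C * indicator (?U N e) \<omega> \<partial>M)"
    proof (rule integral_mono)
      show "integrable M (\<lambda>\<omega>. X N \<omega> + \<epsilon> * indicator (?L N) \<omega>)"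
        using int meas by (intro Bochner_Integration.integrable_add integrable_mult_right integrable_indicator_event) auto
      show "integrable M (\<lambda>\<omega>. (\<tau> + e) + C * indicator (?U N e) \<omega>)"
        using meas by (intro Bochner_Integration.integrable_add integrable_mult_right integrable_indicator_event) auto
      show "X N \<omega> + \<epsilon> * indicator (?L N) \<omega> \<le> (\<tau> + e) + C * indicator (?U N e) \<omega>" if "\<omega> \<in> space M" for \<omega>
        using b that e \<epsilon> \<tau> by (auto simp: indicator_def)
    qed
    also have "\<dots> = \<tau> + e + C * prob (?U N e)"
      using meas by (subst Bochner_Integration.integral_add) (auto simp: prob_space intro!: integrable_mult_right integrable_indicator_event)
    also have "expectation (\<lambda>\<omega>. X N \<omega> + \<epsilon> * indicator (?L N) \<omega>) = expectation (X N) + \<epsilon> * prob (?L N)"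
      using meas int by (subst Bochner_Integration.integral_add) (auto intro!: integrable_mult_right integrable_indicator_event)
    finally show ?thesis by linarith
  qed
  have lowlim: "(\<lambda>N. prob (?L N)) \<longlonglongrightarrow> 0"
  proof (rule tendstoI)
    fix r :: real assume r: "r > 0"
    define e where "e = \<epsilon> * r / 3"
    have e: "e > 0" using \<epsilon> r by (simp add: e_def)
    have "(\<lambda>N. C * prob (?U N e)) \<longlonglongrightarrow> C * 0" using up[OF e] by (intro tendsto_mult tendsto_const)
    then have "\<forall>\<^sub>F N in sequentially. C * prob (?U N e) < e"
      using e by (intro order_tendstoD) auto
    moreover have "\<forall>\<^sub>F N in sequentially. expectation (X N) > \<tau> - e"
      using mean e by (intro order_tendstoD) auto
    ultimately show "\<forall>\<^sub>F N in sequentially. dist (prob (?L N)) 0 < r"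
      using bnd
    proof eventually_elim
      case (elim N)
      have "\<epsilon> * prob (?L N) < \<epsilon> * r" using key[OF elim(3) e] elim(1,2) by (simp add: e_def)
      then show ?case using \<epsilon> by simp
    qed
  qed
  have "(\<lambda>N. prob (?U N \<epsilon>) + prob (?L N)) \<longlonglongrightarrow> 0 + 0"
    by (intro tendsto_add up \<epsilon> lowlim)
  then have lim: "(\<lambda>N. prob (?U N \<epsilon>) + prob (?L N)) \<longlonglongrightarrow> 0" by simp
  have "prob {\<omega> \<in> space M. \<bar>X N \<omega> - \<tau>\<bar> > \<epsilon>} \<le> prob (?U N \<epsilon>) + prob (?L N)" for N
  proof -
    have "{\<omega> \<in> space M. \<bar>X N \<omega> - \<tau>\<bar> > \<epsilon>} \<subseteq> ?U N \<epsilon> \<union> ?L N" by auto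
    then have "prob {\<omega> \<in> space M. \<bar>X N \<omega> - \<tau>\<bar> > \<epsilon>} \<le> prob (?U N \<epsilon> \<union> ?L N)"
      using meas by (intro finite_measure_mono) auto
    also have "\<dots> \<le> prob (?U N \<epsilon>) + prob (?L N)" using meas by (intro measure_Un_le) auto
    finally show ?thesis .
  qed
  then show "(\<lambda>N. prob {\<omega> \<in> space M. \<bar>X N \<omega> - \<tau>\<bar> > \<epsilon>}) \<longlonglongrightarrow> 0"
    by (intro tendsto_sandwich[OF _ _ tendsto_const lim]) auto
qed

end

section \<open>The law of large numbers for the block costs\<close>

text \<open>Hoeffding's inequality, with the number of summands replaced by an upper bound \<open>k\<close> that has a closed
form.\<close>

lemma (in prob_space) sum_upper_tail:
  assumes ind: "indep_vars (\<lambda>_. borel) X Z" and Z: "finite Z"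
    and X: "\<And>z \<omega>. z \<in> Z \<Longrightarrow> \<omega> \<in> space M \<Longrightarrow> 0 \<le> X z \<omega> \<and> X z \<omega> \<le> C" and C: "0 < C"
    and mean: "\<And>z. z \<in> Z \<Longrightarrow> expectation (X z) = a"
    and k: "real (card Z) \<le> k" "0 < k" and t: "0 < t"
  shows "prob {\<omega> \<in> space M. (\<Sum>z\<in>Z. X z \<omega>) \<ge> real (card Z) * a + t} \<le> exp (- 2 * t\<^sup>2 / (k * C\<^sup>2))"
proof (cases "Z = {}")
  case True
  then show ?thesis using t by simp
next
  case False
  interpret H: Hoeffding_ineq M Z X "\<lambda>_. 0" "\<lambda>_. C" "\<Sum>z\<in>Z. expectation (X z)"
    by unfold_locales (use ind Z X in \<open>auto intro!: AE_I2\<close>)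
  have c: "0 < real (card Z)" using False Z by (simp add: card_gt_0_iff)
  have "prob {\<omega> \<in> space M. (\<Sum>z\<in>Z. X z \<omega>) \<ge> (\<Sum>z\<in>Z. expectation (X z)) + t}
      \<le> exp (- 2 * t\<^sup>2 / (\<Sum>z\<in>Z. (C - 0)\<^sup>2))"
    using c C t by (intro H.Hoeffding_ineq_ge) auto
  also have "\<dots> \<le> exp (- 2 * t\<^sup>2 / (k * C\<^sup>2))"
  proof -
    have "2 * t\<^sup>2 / (k * C\<^sup>2) \<le> 2 * t\<^sup>2 / (real (card Z) * C\<^sup>2)"
      using c C k by (intro divide_left_mono mult_right_mono mult_pos_pos) auto
    then show ?thesis by simp
  qed
  finally show ?thesis by (simp add: mean)
qed

section \<open>Block estimates\<close>

text \<open>The tiling is the same for all couplings; the last summand is \<open>\<beta>\<close> times the bound on the number of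
edges of the seam, \<open>K\<close> being the number of neighbours of a lattice point.\<close>

lemma block_comparison:
  fixes u u' :: "nat \<Rightarrow> real ^ 'd" and n :: "real ^ 'd" and l h L H q \<beta> :: real
  defines "D \<equiv> real CARD('d)" and "m \<equiv> CARD('d) - 1"
  defines "r \<equiv> D * (l + 2 * D + 1) + D + 1"
    and "K \<equiv> real (card (int_lattice \<inter> sphere 0 1 :: (real ^ 'd) set))"
  assumes onb: "orthonormal_basis_with u n" "orthonormal_basis_with u' n"
    and l: "l > 4 * D + 2" and h: "h > 2 * D + 2" and H: "H \<ge> h + 2 * D + 2" and L: "L \<ge> 4 * r"
    and q: "q \<ge> 1" and \<beta>: "\<beta> \<ge> 0"
  obtains Z where "finite Z" "Z \<subseteq> int_lattice" "disjoint_family_on (\<lambda>z. lattice_box u n z l h) Z"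
    "real (card Z) * l ^ m \<le> L ^ m"
    "\<And>J. (\<And>e. e \<in> all_edges \<Longrightarrow> 0 \<le> J e \<and> J e \<le> 1) \<Longrightarrow>
       separation_cost \<beta> q J 0 n (lattice_box u' n 0 L H)
         \<le> (\<Sum>z\<in>Z. separation_cost \<beta> q J z n (lattice_box u n z l h))
           + \<beta> * K * (4 * D + 4) * ((L + 2 * D) ^ m - ((L - 4 * r) / (l + 2 * D + 1)) ^ m * (l - 2 - 4 * D) ^ m)"
proof -
  let ?V = "lattice_box u' n 0 L H" and ?Vf = "\<lambda>z. lattice_box u n z l h"
  let ?P = "\<lambda>z y. \<forall>k\<in>{1..<CARD('d)}. \<bar>(y - z) \<bullet> u k\<bar> < l / 2 - 1"
  obtain Z where Z: "finite Z" "Z \<subseteq> int_lattice" "\<And>z. z \<in> Z \<Longrightarrow> \<bar>z \<bullet> n\<bar> \<le> D"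
    "disjoint_family_on ?Vf Z"
    "\<And>z y w. z \<in> Z \<Longrightarrow> y \<in> ?Vf z \<Longrightarrow> w \<in> int_lattice \<Longrightarrow> norm (w - y) \<le> 1 \<Longrightarrow> w \<in> ?V"
    "real (card Z) * l ^ m \<le> L ^ m"
    and few: "real (card {y \<in> ?V. \<bar>y \<bullet> n\<bar> \<le> D + 1 \<and> (\<forall>z\<in>Z. \<not> ?P z y)})
      \<le> (4 * D + 4) * ((L + 2 * D) ^ m - ((L - 4 * r) / (l + 2 * D + 1)) ^ m * (l - 2 - 4 * D) ^ m)"
    by (rule tiling[OF onb l[unfolded D_def] h[unfolded D_def] H[unfolded D_def] L[unfolded r_def D_def],
      folded D_def m_def, folded r_def]) (rule that; assumption)
  have V: "?V \<subseteq> int_lattice" "finite ?V" using finite_lattice_box[OF onb(2)] by (auto simp: lattice_box_def)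
  have n1: "norm n = 1" by (rule basis_norm[OF onb(1)])
  have seam: "card (seam n ?V ?Vf Z) \<le>
    card {y \<in> ?V. \<bar>y \<bullet> n\<bar> \<le> D + 1 \<and> (\<forall>z\<in>Z. \<not> ?P z y)} * card (int_lattice \<inter> sphere 0 1 :: (real ^ 'd) set)"
    unfolding D_def
  proof (rule card_seam_le[OF V])
    fix z y w assume z: "z \<in> Z" and y: "\<bar>y \<bullet> n\<bar> \<le> real CARD('d) + 1" "?P z y"
      and w: "w \<in> int_lattice" "norm (w - y) \<le> 1"
    have wy: "\<bar>(w - y) \<bullet> v\<bar> \<le> 1" if "norm v = 1" for v
      using abs_inner_unit_le[OF that, of "w - y"] w by linarith
    have "\<bar>(w - z) \<bullet> u k\<bar> < l / 2" if k: "k \<in> {1..<CARD('d)}" for k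
    proof -
      have "\<bar>(y - z) \<bullet> u k\<bar> < l / 2 - 1" using y(2) k by blast
      then show ?thesis using wy[OF basis_norm(2)[OF onb(1) k]] unfolding inner_diff_left by linarith
    qed
    moreover have "\<bar>(w - z) \<bullet> n\<bar> < h"
      using wy[OF n1] y(1) Z(3)[OF z] h unfolding inner_diff_left D_def by linarith
    ultimately show "w \<in> ?Vf z" using w by (simp add: lattice_box_def tilted_box_def)
  qed
  have "real (card (seam n ?V ?Vf Z)) \<le>
      (4 * D + 4) * ((L + 2 * D) ^ m - ((L - 4 * r) / (l + 2 * D + 1)) ^ m * (l - 2 - 4 * D) ^ m) * K"
    using order_trans[OF of_nat_mono[OF seam] , of "_ :: real"] mult_right_mono[OF few, of K]
    by (simp add: K_def)
  then have s: "\<beta> * real (card (seam n ?V ?Vf Z)) \<le>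
      \<beta> * K * (4 * D + 4) * ((L + 2 * D) ^ m - ((L - 4 * r) / (l + 2 * D + 1)) ^ m * (l - 2 - 4 * D) ^ m)"
    using mult_left_mono[OF _ \<beta>] by (simp only: mult.assoc mult.commute[of K])
  show ?thesis
  proof (rule that[OF Z(1,2,4,6)])
    fix J :: "(real ^ 'd) set \<Rightarrow> real" assume J: "\<And>e. e \<in> all_edges \<Longrightarrow> 0 \<le> J e \<and> J e \<le> 1"
    have "separation_cost \<beta> q J 0 n ?V
       \<le> (\<Sum>z\<in>Z. separation_cost \<beta> q J z n (?Vf z)) + \<beta> * card (seam n ?V ?Vf Z)"
      by (rule separation_cost_subadditive[OF q \<beta> J n1 V Z(1) _ Z(4) Z(5) Z(3)[unfolded D_def]]) (auto simp: lattice_box_def)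
    with s show "separation_cost \<beta> q J 0 n ?V \<le> (\<Sum>z\<in>Z. separation_cost \<beta> q J z n (?Vf z))
           + \<beta> * K * (4 * D + 4) * ((L + 2 * D) ^ m - ((L - 4 * r) / (l + 2 * D + 1)) ^ m * (l - 2 - 4 * D) ^ m)"
      by linarith
  qed
qed

text \<open>Without any blocks the seam consists of all edges near the hyperplane, and closing them disconnects
the box.\<close>

lemma separation_cost_le_area:
  fixes u :: "nat \<Rightarrow> real ^ 'd" and n :: "real ^ 'd"
  defines "D \<equiv> real CARD('d)" and "m \<equiv> CARD('d) - 1"
    and "K \<equiv> real (card (int_lattice \<inter> sphere 0 1 :: (real ^ 'd) set))"
  assumes onb: "orthonormal_basis_with u n" and L: "0 \<le> L"
    and q: "q \<ge> 1" and \<beta>: "\<beta> \<ge> 0" and J: "\<And>e. e \<in> all_edges \<Longrightarrow> 0 \<le> J e \<and> J e \<le> 1"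
  shows "separation_cost \<beta> q J 0 n (lattice_box u n 0 L H) \<le> \<beta> * K * (4 * D + 4) * (L + 2 * D) ^ m"
proof -
  let ?V = "lattice_box u n 0 L H"
  let ?W = "{y \<in> ?V. \<bar>y \<bullet> n\<bar> \<le> real CARD('d) + 1}"
  let ?B = "tilted_box u n 0 (L + 2 * D) (2 * D + 2)"
  have D: "0 \<le> D" by (simp add: D_def)
  have V: "?V \<subseteq> int_lattice" "finite ?V" using finite_lattice_box[OF onb] by (auto simp: lattice_box_def)
  have n1: "norm n = 1" by (rule basis_norm[OF onb])
  have "real (card ?W) \<le> measure lborel ?B"
  proof (rule card_lattice_le_measure[OF _ _ tilted_box_lmeasurable[OF onb]])
    fix y v :: "real ^ 'd" assume y: "y \<in> ?W" and v: "norm (v - y) \<le> real CARD('d)"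
    have vy: "\<bar>(v - y) \<bullet> w\<bar> \<le> D" if "norm w = 1" for w
      using abs_inner_unit_le[OF that, of "v - y"] v by (simp add: D_def)
    have "\<bar>v \<bullet> u k\<bar> < L / 2 + D" if k: "k \<in> {1..<CARD('d)}" for k
    proof -
      have "\<bar>y \<bullet> u k\<bar> < L / 2" using y k by (auto simp: lattice_box_def tilted_box_def)
      then show ?thesis using vy[OF basis_norm(2)[OF onb k]] unfolding inner_diff_left by linarith
    qed
    moreover have "\<bar>v \<bullet> n\<bar> < 2 * D + 2" using y vy[OF n1] unfolding inner_diff_left D_def by auto
    ultimately show "v \<in> ?B" by (simp add: tilted_box_def add_divide_distrib)
  qed (use V in auto)
  then have W: "real (card ?W) \<le> (4 * D + 4) * (L + 2 * D) ^ m"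
    using L D by (simp add: measure_tilted_box[OF onb] m_def algebra_simps)
  have "card (seam n ?V (\<lambda>_. {}) {}) \<le> card ?W * card (int_lattice \<inter> sphere 0 1 :: (real ^ 'd) set)"
    using card_seam_le[OF V, of "{}" n "\<lambda>_ _. True" "\<lambda>_. {}"] by simp
  then have "real (card (seam n ?V (\<lambda>_. {}) {})) \<le> real (card ?W) * K"
    unfolding K_def of_nat_mult[symmetric] of_nat_le_iff .
  also have "\<dots> \<le> (4 * D + 4) * (L + 2 * D) ^ m * K"
    using W by (intro mult_right_mono) (auto simp: K_def)
  finally have "\<beta> * real (card (seam n ?V (\<lambda>_. {}) {})) \<le> \<beta> * ((4 * D + 4) * (L + 2 * D) ^ m * K)"
    using \<beta> by (intro mult_left_mono)
  moreover have "separation_cost \<beta> q J 0 n ?V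
       \<le> (\<Sum>z\<in>{}. separation_cost \<beta> q J z n {}) + \<beta> * card (seam n ?V (\<lambda>_. {}) {})"
    by (rule separation_cost_subadditive[OF q \<beta> J n1 V]) (auto simp: disjoint_family_on_def)
  ultimately show ?thesis by (simp add: mult_ac)
qed

text \<open>With \<open>p = l + 2 D + 1\<close> and \<open>s = l - 2 - 4 D\<close> this is, up to a constant factor, the density
of the seam as the large box grows; the density vanishes as \<open>l\<close> grows, since then \<open>s / p\<close> tends to \<open>1\<close>.\<close>

lemma seam_density_tendsto:
  fixes D r s p :: real
  assumes "p > 0"
  shows "(\<lambda>N. ((real N + 2 * D) ^ m - ((real N - 4 * r) / p) ^ m * s ^ m) / real N ^ m)
    \<longlonglongrightarrow> 1 - (s / p) ^ m"
proof -
  have 0: "(\<lambda>N. c / real N) \<longlonglongrightarrow> 0" for c by (rule lim_const_over_n)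
  have "(\<lambda>N. (1 + 2 * D / real N) ^ m - ((1 - 4 * r / real N) / p) ^ m * s ^ m)
     \<longlonglongrightarrow> (1 + 0) ^ m - ((1 - 0) / p) ^ m * s ^ m"
    using assms by (intro tendsto_intros 0) auto
  also have "(1 + 0) ^ m - ((1 - 0) / p) ^ m * s ^ m = 1 - (s / p) ^ m"
    by (simp add: power_divide)
  finally show ?thesis
  proof (rule Lim_transform_eventually)
    show "\<forall>\<^sub>F N in sequentially. (1 + 2 * D / real N) ^ m - ((1 - 4 * r / real N) / p) ^ m * s ^ m
       = ((real N + 2 * D) ^ m - ((real N - 4 * r) / p) ^ m * s ^ m) / real N ^ m"
      using eventually_gt_at_top[of 0]
    proof eventually_elim
      case (elim N)
      have eqs: "1 + 2 * D / real N = (real N + 2 * D) / real N"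
        "(1 - 4 * r / real N) / p = ((real N - 4 * r) / p) / real N"
        using elim assms by (simp_all add: field_simps)
      show ?case
        unfolding eqs power_divide[of _ "real N"] by (simp only: diff_divide_distrib times_divide_eq_left)
    qed
  qed
qed

lemma seam_fraction_tendsto_0:
  fixes a b c :: real
  shows "(\<lambda>l. c * (1 - ((real l - a) / (real l + b)) ^ m)) \<longlonglongrightarrow> 0"
proof -
  have "filterlim (\<lambda>l. b + real l) at_top sequentially"
    by (rule filterlim_tendsto_add_at_top[OF tendsto_const filterlim_real_sequentially])
  then have "(\<lambda>l. (a + b) / (b + real l)) \<longlonglongrightarrow> 0"
    by (rule real_tendsto_divide_at_top[OF tendsto_const])
  then have "(\<lambda>l. c * (1 - (1 - (a + b) / (b + real l)) ^ m)) \<longlonglongrightarrow> c * (1 - (1 - 0) ^ m)"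
    by (intro tendsto_intros)
  then have "(\<lambda>l. c * (1 - (1 - (a + b) / (b + real l)) ^ m)) \<longlonglongrightarrow> 0" by simp
  then show ?thesis
  proof (rule Lim_transform_eventually)
    have "\<forall>\<^sub>F l in sequentially. real l > - b"
      using filterlim_real_sequentially by (simp add: filterlim_at_top_dense)
    then show "\<forall>\<^sub>F l in sequentially. c * (1 - (1 - (a + b) / (b + real l)) ^ m)
       = c * (1 - ((real l - a) / (real l + b)) ^ m)"
    proof eventually_elim
      case (elim l)
      have "1 - (a + b) / (b + real l) = (real l - a) / (real l + b)"
        using elim by (simp add: field_simps)
      then show ?case by simp
    qed
  qed
qed

section \<open>Surface tension of large boxes\<close>

lemma surface_tension_eq_cost:
  fixes u :: "nat \<Rightarrow> real ^ 'd" and n :: "real ^ 'd"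
  assumes onb: "orthonormal_basis_with u n"
    and S: "S = {\<Sum>k\<in>{1..<CARD('d)}. t k *\<^sub>R u k | t. \<forall>k\<in>{1..<CARD('d)}. t k \<in> {-1/2..1/2}}"
    and q: "q \<ge> 1" and \<beta>: "\<beta> \<ge> 0" and J: "\<And>e. e \<in> all_edges \<Longrightarrow> 0 \<le> J e \<and> J e \<le> 1"
    and pos: "L > 0" "H > 0"
  shows "surface_tension \<beta> q J x L H S n
       = separation_cost \<beta> q J x n (lattice_box u n x L H) / L ^ (CARD('d) - 1)"
proof -
  let ?V = "lattice_box u n x L H"
  have V: "lattice_interior (box_set x L H S n) = ?V"
    by (simp add: lattice_interior_def lattice_box_def interior_box_set[OF onb pos S])
  have E: "finite (edges_in ?V)" "edges_in ?V \<subseteq> all_edges"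
    using finite_edges_in[OF finite_lattice_box[OF onb]] by (auto simp: lattice_box_def intro: edges_in_mono[THEN subsetD])
  have "disconnection_event x n ?V = {\<omega> \<in> configs (edges_in ?V). open_edges (edges_in ?V) \<omega> \<in> separating x n ?V}"
    by (simp add: disconnection_event_def separating_def)
  then have "measure (rc_measure (edges_in ?V) \<beta> q J wired) (disconnection_event x n ?V)
      = wired_prob \<beta> q J (edges_in ?V) (separating x n ?V)"
    using measure_rc_wired[OF E wired_weight_nonneg[OF q \<beta> J E(2)]] by simp
  then show ?thesis by (simp add: surface_tension_def V separation_cost_def Let_def)
qed

context
  fixes \<mu> :: "real measure" and q \<beta> :: real and n :: "real ^ 'd"
  assumes law: "coupling_law \<mu>" and q: "q \<ge> 1" and \<beta>: "\<beta> \<ge> 0" and d2: "CARD('d) \<ge> 2"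
begin

abbreviation (input) tension :: "real \<Rightarrow> (real ^ 'd) set \<Rightarrow> nat \<Rightarrow> ((real ^ 'd) set \<Rightarrow> real) \<Rightarrow> real" where
  "tension \<delta> S N J \<equiv> surface_tension \<beta> q J 0 (real N) (\<delta> * real N) S n"

lemma unit_cubeE:
  assumes "S \<in> unit_cubes n"
  obtains u where "orthonormal_basis_with u n"
    "S = {\<Sum>k\<in>{1..<CARD('d)}. t k *\<^sub>R u k | t. \<forall>k\<in>{1..<CARD('d)}. t k \<in> {-1/2..1/2}}"
  using assms unfolding unit_cubes_def by blast

text \<open>The term \<open>N = 0\<close> of the sequence: division by \<open>0 ^ (d - 1) = 0\<close> gives \<open>0\<close>.\<close>

lemma surface_tension_0: "surface_tension \<beta> q J x 0 H S n = 0"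
  using d2 by (simp add: surface_tension_def power_0_left)

lemma tension_eq:
  assumes onb: "orthonormal_basis_with u n"
    and S: "S = {\<Sum>k\<in>{1..<CARD('d)}. t k *\<^sub>R u k | t. \<forall>k\<in>{1..<CARD('d)}. t k \<in> {-1/2..1/2}}"
    and "\<delta> > 0" "J \<in> space (couplings \<mu>)" "N > 0"
  shows "tension \<delta> S N J
     = separation_cost \<beta> q J 0 n (lattice_box u n 0 (real N) (\<delta> * real N)) / real N ^ (CARD('d) - 1)"
  using assms by (intro surface_tension_eq_cost onb S q \<beta> coupling_bounds[OF law]) auto

lemma lattice_box_edges: "edges_in (lattice_box u n x L H) \<subseteq> all_edges"
  by (rule edges_in_mono) (simp add: lattice_box_def)

lemma tension_measurable:
  assumes S: "S \<in> unit_cubes n" and "\<delta> > 0"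
  shows "tension \<delta> S N \<in> borel_measurable (couplings \<mu>)"
proof (cases "N = 0")
  case True
  then show ?thesis by (simp add: surface_tension_0)
next
  case False
  obtain u where u: "orthonormal_basis_with u n"
    "S = {\<Sum>k\<in>{1..<CARD('d)}. t k *\<^sub>R u k | t. \<forall>k\<in>{1..<CARD('d)}. t k \<in> {-1/2..1/2}}"
    using unit_cubeE[OF S] .
  have "(\<lambda>J. separation_cost \<beta> q J 0 n (lattice_box u n 0 (real N) (\<delta> * real N)) / real N ^ (CARD('d) - 1))
      \<in> borel_measurable (couplings \<mu>)"
    unfolding couplings_def
    by (intro borel_measurable_divide borel_measurable_const separation_cost_measurable[OF law] lattice_box_edges)
  then show ?thesis
    using tension_eq[OF u \<open>\<delta> > 0\<close>] False by (subst measurable_cong) auto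
qed

text \<open>The area bound on the cost, divided by \<open>N ^ (d - 1)\<close> and made uniform in \<open>N \<ge> 1\<close>.\<close>

definition tension_bound :: real where
  "tension_bound = \<beta> * real (card (int_lattice \<inter> sphere 0 1 :: (real ^ 'd) set))
     * (4 * real CARD('d) + 4) * (1 + 2 * real CARD('d)) ^ (CARD('d) - 1)"

lemma tension_bounds:
  assumes S: "S \<in> unit_cubes n" and "\<delta> > 0" and J: "J \<in> space (couplings \<mu>)"
  shows "0 \<le> tension \<delta> S N J" "tension \<delta> S N J \<le> tension_bound"
proof -
  let ?D = "real CARD('d)" and ?m = "CARD('d) - 1"
  let ?K = "real (card (int_lattice \<inter> sphere 0 1 :: (real ^ 'd) set))"
  have "0 \<le> tension \<delta> S N J \<and> tension \<delta> S N J \<le> tension_bound"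
  proof (cases "N = 0")
    case True
    then show ?thesis using \<beta> by (simp add: surface_tension_0 tension_bound_def)
  next
    case False
    obtain u where u: "orthonormal_basis_with u n"
      "S = {\<Sum>k\<in>{1..<CARD('d)}. t k *\<^sub>R u k | t. \<forall>k\<in>{1..<CARD('d)}. t k \<in> {-1/2..1/2}}"
      using unit_cubeE[OF S] .
    let ?V = "lattice_box u n 0 (real N) (\<delta> * real N)"
    let ?c = "separation_cost \<beta> q J 0 n ?V"
    have "0 \<le> ?c"
      using finite_lattice_box[OF u(1)]
      by (intro separation_cost_nonneg q \<beta> coupling_bounds[OF law J]) (auto simp: lattice_box_def)
    moreover have "?c \<le> \<beta> * ?K * (4 * ?D + 4) * (real N + 2 * ?D) ^ ?m"
      by (rule separation_cost_le_area[OF u(1) _ q \<beta> coupling_bounds[OF law J]]) auto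
    moreover have "\<dots> \<le> \<beta> * ?K * (4 * ?D + 4) * ((1 + 2 * ?D) * real N) ^ ?m"
    proof (intro mult_left_mono power_mono)
      have "2 * ?D * 1 \<le> 2 * ?D * real N" using False by (intro mult_left_mono) auto
      then show "real N + 2 * ?D \<le> (1 + 2 * ?D) * real N" by (simp add: algebra_simps)
    qed (use \<beta> in auto)
    ultimately have "0 \<le> ?c" "?c \<le> tension_bound * real N ^ ?m"
      by (auto simp: tension_bound_def power_mult_distrib mult_ac)
    then show ?thesis
      using tension_eq[OF u \<open>\<delta> > 0\<close> J] False by (simp add: pos_divide_le_eq)
  qed
  then show "0 \<le> tension \<delta> S N J" "tension \<delta> S N J \<le> tension_bound" by auto
qed

text \<open>Compare the large box with blocks of side \<open>l\<close>, where \<open>l\<close> is so large that the seam costs less than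
\<open>\<epsilon> / 2\<close> per unit area.  The remaining \<open>\<epsilon> / 2\<close> must then come from a deviation of a sum of at
most \<open>(N / l) ^ (d - 1)\<close> independent bounded block costs, which has probability at most
\<open>exp (- (\<kappa> * N ^ (d - 1)))\<close>.\<close>

theorem tension_upper_tail:
  assumes S: "S \<in> unit_cubes n" "S' \<in> unit_cubes n" and \<delta>: "\<delta> > 0" "\<delta>' > 0" and \<epsilon>: "\<epsilon> > 0"
  shows "\<forall>\<^sub>F l in sequentially.
    (\<lambda>N. measure (couplings \<mu>)
      {J \<in> space (couplings \<mu>). tension \<delta>' S' N J > (\<integral>J. tension \<delta> S l J \<partial>couplings \<mu>) + \<epsilon>})
    \<longlonglongrightarrow> 0"
proof -
  interpret prob_space "couplings \<mu>" by (rule prob_space_couplings[OF law])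
  let ?D = "real CARD('d)" and ?m = "CARD('d) - 1"
  define c where "c = \<beta> * real (card (int_lattice \<inter> sphere 0 1 :: (real ^ 'd) set)) * (4 * ?D + 4)"
  obtain u where u: "orthonormal_basis_with u n"
    "S = {\<Sum>k\<in>{1..<CARD('d)}. t k *\<^sub>R u k | t. \<forall>k\<in>{1..<CARD('d)}. t k \<in> {-1/2..1/2}}"
    using unit_cubeE[OF S(1)] .
  obtain u' where u': "orthonormal_basis_with u' n"
    "S' = {\<Sum>k\<in>{1..<CARD('d)}. t k *\<^sub>R u' k | t. \<forall>k\<in>{1..<CARD('d)}. t k \<in> {-1/2..1/2}}"
    using unit_cubeE[OF S(2)] .
  have large: "\<forall>\<^sub>F l in sequentially. a < b * real l" if "b > 0" for a b
  proof -
    have "\<forall>\<^sub>F l in sequentially. a / b < real l"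
      using filterlim_real_sequentially by (simp add: filterlim_at_top_dense)
    then show ?thesis using that by (elim eventually_mono) (simp add: field_simps)
  qed
  have "\<forall>\<^sub>F l in sequentially. c * (1 - ((real l - (2 + 4 * ?D)) / (real l + (2 * ?D + 1))) ^ ?m) < \<epsilon> / 2"
    using seam_fraction_tendsto_0 \<epsilon> by (intro order_tendstoD(2)[where y = 0]) auto
  with large[OF zero_less_one, of "4 * ?D + 2"] large[OF \<delta>(1), of "2 * ?D + 2"] show ?thesis
  proof eventually_elim
    case (elim l)
    define h where "h = \<delta> * real l"
    define r where "r = ?D * (real l + 2 * ?D + 1) + ?D + 1"
    define s where "s = real l - 2 - 4 * ?D"
    define p where "p = real l + 2 * ?D + 1"
    have l: "real l > 4 * ?D + 2" "h > 2 * ?D + 2" using elim by (auto simp: h_def)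
    have l0: "real l > 0" "p > 0" using l by (auto simp: p_def)
    have sf: "c * (1 - (s / p) ^ ?m) < \<epsilon> / 2"
      using elim(3) by (simp add: s_def p_def algebra_simps)
    define cost where "cost z J = separation_cost \<beta> q J z n (lattice_box u n z (real l) h)" for z J
    define a where "a = expectation (cost 0)"
    have mean: "expectation (tension \<delta> S l) = a / real l ^ ?m"
    proof -
      have "expectation (tension \<delta> S l) = expectation (\<lambda>J. cost 0 J / real l ^ ?m)"
        using tension_eq[OF u \<delta>(1)] l0 by (intro Bochner_Integration.integral_cong) (auto simp: cost_def h_def)
      then show ?thesis by (simp add: a_def)
    qed
    have cost_eq: "cost z J = separation_cost \<beta> q (\<lambda>e. J ((+) z ` e)) 0 n (lattice_box u n 0 (real l) h)"
      if "z \<in> int_lattice" for z J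
      unfolding cost_def translate_lattice_box[OF that, of u n "real l"]
      by (rule translate_separation_cost[OF that]) (simp add: lattice_box_def)
    have mean_z: "expectation (cost z) = a" if "z \<in> int_lattice" for z
      unfolding a_def cost_def translate_lattice_box[OF that, of u n "real l"]
      by (subst expectation_translate_cost[OF law that]) (auto simp: lattice_box_def)
    \<comment> \<open>the summand \<open>1\<close> makes \<open>C\<close> positive also when \<open>\<beta> = 0\<close>\<close>
    define C where "C = c * (real l + 2 * ?D) ^ ?m + 1"
    have cost_bounds: "0 \<le> cost z J \<and> cost z J \<le> C" if z: "z \<in> int_lattice" and J: "J \<in> space (couplings \<mu>)" for z J
    proof -
      have J': "0 \<le> J ((+) z ` e) \<and> J ((+) z ` e) \<le> 1" if "e \<in> all_edges" for e
        using coupling_bounds[OF law J, of "(+) z ` e"] translate_all_edges[OF z] that by blast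
      have "0 \<le> cost z J"
        unfolding cost_eq[OF z] using finite_lattice_box[OF u(1)]
        by (intro separation_cost_nonneg q \<beta> J') (auto simp: lattice_box_def)
      moreover have "cost z J \<le> c * (real l + 2 * ?D) ^ ?m"
        unfolding cost_eq[OF z] c_def using l0 by (intro separation_cost_le_area u(1) q \<beta> J') auto
      ultimately show ?thesis by (simp add: C_def)
    qed
    have c0: "0 \<le> c" using \<beta> by (simp add: c_def)
    then have C: "C > 0" using l0 by (simp add: C_def add_nonneg_pos)
    have "0 \<in> (int_lattice :: (real ^ 'd) set)" by (simp add: int_lattice_def)
    then have a0: "0 \<le> a" unfolding a_def using cost_bounds by (intro integral_nonneg_AE AE_I2) auto
    let ?seam = "\<lambda>N. (real N + 2 * ?D) ^ ?m - ((real N - 4 * r) / p) ^ ?m * s ^ ?m"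
    have "(\<lambda>N. c * (?seam N / real N ^ ?m)) \<longlonglongrightarrow> c * (1 - (s / p) ^ ?m)"
      by (intro tendsto_mult tendsto_const seam_density_tendsto l0)
    then have ev: "\<forall>\<^sub>F N in sequentially. c * (?seam N / real N ^ ?m) < \<epsilon> / 2"
      using sf by (rule order_tendstoD(2))
    define \<kappa> where "\<kappa> = \<epsilon>\<^sup>2 * real l ^ ?m / (2 * C\<^sup>2)"
    have \<kappa>: "\<kappa> > 0" using \<epsilon> l0 C by (simp add: \<kappa>_def)
    have bound: "\<forall>\<^sub>F N in sequentially.
      prob {J \<in> space (couplings \<mu>). tension \<delta>' S' N J > expectation (tension \<delta> S l) + \<epsilon>} \<le> exp (- (\<kappa> * real N ^ ?m))"
      using ev large[OF \<delta>(2), of "h + 2 * ?D + 2"] large[OF zero_less_one, of "4 * r"] eventually_gt_at_top[of 0]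
    proof eventually_elim
      case (elim N)
      have N: "real N > 0" using elim by simp
      obtain Z where Z: "finite Z" "Z \<subseteq> int_lattice" "disjoint_family_on (\<lambda>z. lattice_box u n z (real l) h) Z"
        "real (card Z) * real l ^ ?m \<le> real N ^ ?m"
        and sub: "\<And>J. (\<And>e. e \<in> all_edges \<Longrightarrow> 0 \<le> J e \<and> J e \<le> 1) \<Longrightarrow>
          separation_cost \<beta> q J 0 n (lattice_box u' n 0 (real N) (\<delta>' * real N)) \<le> (\<Sum>z\<in>Z. cost z J) + c * ?seam N"
        using block_comparison[OF u(1) u'(1) l _ _ q \<beta>, of "\<delta>' * real N" "real N"] elim
        unfolding cost_def c_def r_def s_def p_def by auto
      let ?t = "\<epsilon> / 2 * real N ^ ?m"
      have incl: "{J \<in> space (couplings \<mu>). tension \<delta>' S' N J > expectation (tension \<delta> S l) + \<epsilon>}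
        \<subseteq> {J \<in> space (couplings \<mu>). (\<Sum>z\<in>Z. cost z J) \<ge> real (card Z) * a + ?t}"
      proof (intro subsetI CollectI conjI; elim CollectE conjE)
        fix J assume J: "J \<in> space (couplings \<mu>)" and big: "tension \<delta>' S' N J > expectation (tension \<delta> S l) + \<epsilon>"
        have "(a / real l ^ ?m + \<epsilon>) * real N ^ ?m
          < separation_cost \<beta> q J 0 n (lattice_box u' n 0 (real N) (\<delta>' * real N))"
          using big tension_eq[OF u' \<delta>(2) J] N by (simp add: mean pos_less_divide_eq)
        also have "\<dots> \<le> (\<Sum>z\<in>Z. cost z J) + c * ?seam N" by (rule sub[OF coupling_bounds[OF law J]])
        also have "c * ?seam N \<le> \<epsilon> / 2 * real N ^ ?m"
          using elim(1) N by (simp add: pos_divide_less_eq)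
        finally have "a / real l ^ ?m * real N ^ ?m + ?t \<le> (\<Sum>z\<in>Z. cost z J)" by (simp add: algebra_simps)
        moreover have "real (card Z) * a \<le> a / real l ^ ?m * real N ^ ?m"
          using mult_left_mono[OF Z(4) a0] l0 by (simp add: field_simps)
        ultimately show "real (card Z) * a + ?t \<le> (\<Sum>z\<in>Z. cost z J)" by linarith
      qed
      have ind: "indep_vars (\<lambda>_. borel) cost Z"
        unfolding cost_def by (rule indep_separation_costs[OF law _ Z(3)]) (simp add: lattice_box_def)
      have [measurable]: "cost z \<in> borel_measurable (couplings \<mu>)" for z
        unfolding cost_def couplings_def by (rule separation_cost_measurable[OF law lattice_box_edges])
      have "prob {J \<in> space (couplings \<mu>). tension \<delta>' S' N J > expectation (tension \<delta> S l) + \<epsilon>}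
         \<le> prob {J \<in> space (couplings \<mu>). (\<Sum>z\<in>Z. cost z J) \<ge> real (card Z) * a + ?t}"
        by (rule finite_measure_mono[OF incl]) measurable
      also have "\<dots> \<le> exp (- 2 * ?t\<^sup>2 / (real N ^ ?m / real l ^ ?m * C\<^sup>2))"
        using Z(2,4) N l0 \<epsilon> cost_bounds mean_z
        by (intro sum_upper_tail ind Z(1) C) (auto simp: pos_le_divide_eq)
      also have "- 2 * ?t\<^sup>2 / (real N ^ ?m / real l ^ ?m * C\<^sup>2) = - (\<kappa> * real N ^ ?m)"
        using N l0 C by (simp add: \<kappa>_def power2_eq_square field_simps)
      finally show ?case .
    qed
    have "(\<lambda>N. exp (- (\<kappa> * real N ^ ?m))) \<longlonglongrightarrow> 0"
    proof -
      have "filterlim (\<lambda>N. real N ^ ?m) at_top sequentially"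
        using d2 by (intro filterlim_pow_at_top filterlim_real_sequentially) auto
      then have "filterlim (\<lambda>N. \<kappa> * real N ^ ?m) at_top sequentially"
        by (rule filterlim_tendsto_pos_mult_at_top[OF tendsto_const \<kappa>])
      then have "filterlim (\<lambda>N. - (\<kappa> * real N ^ ?m)) at_bot sequentially"
        by (simp add: filterlim_uminus_at_bot)
      then show ?thesis by (rule filterlim_compose[OF exp_at_bot])
    qed
    then show ?case
      by (intro tendsto_sandwich[OF _ bound tendsto_const]) auto
  qed
qed

lemma mean_tension_asymptotically_subadditive:
  assumes S: "S \<in> unit_cubes n" "S' \<in> unit_cubes n" and \<delta>: "\<delta> > 0" "\<delta>' > 0" and \<epsilon>: "\<epsilon> > 0"
  shows "\<forall>\<^sub>F l in sequentially. \<forall>\<^sub>F N in sequentially.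
    (\<integral>J. tension \<delta>' S' N J \<partial>couplings \<mu>) \<le> (\<integral>J. tension \<delta> S l J \<partial>couplings \<mu>) + \<epsilon>"
proof -
  interpret prob_space "couplings \<mu>" by (rule prob_space_couplings[OF law])
  have "\<epsilon> / 2 > 0" using \<epsilon> by simp
  from tension_upper_tail[OF S \<delta> this] show ?thesis
  proof eventually_elim
    case (elim l)
    let ?a = "expectation (tension \<delta> S l) + \<epsilon> / 2"
    have a: "0 \<le> ?a" using \<epsilon> tension_bounds(1)[OF S(1) \<delta>(1)]
      by (intro add_nonneg_nonneg integral_nonneg_AE AE_I2) auto
    have "(\<lambda>N. tension_bound * prob {J \<in> space (couplings \<mu>). tension \<delta>' S' N J > ?a}) \<longlonglongrightarrow> tension_bound * 0"
      by (intro tendsto_mult tendsto_const elim)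
    then have "\<forall>\<^sub>F N in sequentially. tension_bound * prob {J \<in> space (couplings \<mu>). tension \<delta>' S' N J > ?a} < \<epsilon> / 2"
      using \<epsilon> by (intro order_tendstoD(2)) auto
    then show ?case
    proof eventually_elim
      case (elim N)
      have "expectation (tension \<delta>' S' N) \<le> ?a + tension_bound * prob {J \<in> space (couplings \<mu>). tension \<delta>' S' N J > ?a}"
        using tension_bounds[OF S(2) \<delta>(2)] tension_measurable[OF S(2) \<delta>(2)] a
        by (intro expectation_le_of_upper_tail) auto
      with elim show ?case by linarith
    qed
  qed
qed

text \<open>The limit is determined by one reference cube and \<open>\<delta> = 1\<close>; comparing in both directions
transfers it to every other cube and every other \<open>\<delta>\<close>.\<close>

theorem tension_converges:
  "\<exists>\<tau>\<ge>0. \<forall>S\<in>unit_cubes n. \<forall>\<delta>>0. converges_in_probability (couplings \<mu>) (tension \<delta> S) \<tau>"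
proof (cases "unit_cubes n = {}")
  case True
  then show ?thesis by auto
next
  case False
  then obtain S\<^sub>0 where S\<^sub>0: "S\<^sub>0 \<in> unit_cubes n" by blast
  interpret prob_space "couplings \<mu>" by (rule prob_space_couplings[OF law])
  have nonneg: "0 \<le> expectation (tension \<delta> S N)" if "S \<in> unit_cubes n" "\<delta> > 0" for \<delta> S N
    using tension_bounds(1)[OF that] by (intro integral_nonneg_AE AE_I2) auto
  obtain \<tau> where \<tau>: "0 \<le> \<tau>" "(\<lambda>N. expectation (tension 1 S\<^sub>0 N)) \<longlonglongrightarrow> \<tau>"
    using tendsto_of_asymptotic_subadditivity[of "\<lambda>N. expectation (tension 1 S\<^sub>0 N)"]
      nonneg[OF S\<^sub>0, of 1] mean_tension_asymptotically_subadditive[OF S\<^sub>0 S\<^sub>0, of 1 1] by auto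
  have "converges_in_probability (couplings \<mu>) (tension \<delta> S) \<tau>" if S: "S \<in> unit_cubes n" and \<delta>: "\<delta> > 0" for S \<delta>
  proof (rule converges_in_probability_of_upper_tails)
    show mean: "(\<lambda>N. expectation (tension \<delta> S N)) \<longlonglongrightarrow> \<tau>"
      by (rule tendsto_of_mutual_asymptotic_bounds[OF \<tau>(2)])
        (use mean_tension_asymptotically_subadditive[OF S\<^sub>0 S, of 1 \<delta>]
          mean_tension_asymptotically_subadditive[OF S S\<^sub>0, of \<delta> 1] \<delta> in auto)
    show "\<forall>\<^sub>F N in sequentially. \<forall>J\<in>space (couplings \<mu>). 0 \<le> tension \<delta> S N J \<and> tension \<delta> S N J \<le> tension_bound"
      using tension_bounds[OF S \<delta>] by auto
    fix e :: real assume e: "e > 0"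
    have "\<forall>\<^sub>F l in sequentially. expectation (tension \<delta> S l) < \<tau> + e / 2"
      using mean e by (intro order_tendstoD(2)) auto
    moreover have "e / 2 > 0" using e by simp
    ultimately obtain l where l: "expectation (tension \<delta> S l) < \<tau> + e / 2"
      and tail: "(\<lambda>N. prob {J \<in> space (couplings \<mu>). tension \<delta> S N J > expectation (tension \<delta> S l) + e / 2}) \<longlonglongrightarrow> 0"
      using eventually_happens'[OF sequentially_bot eventually_conj[OF _ tension_upper_tail[OF S S \<delta> \<delta>]]]
      by blast
    have [measurable]: "tension \<delta> S N \<in> borel_measurable (couplings \<mu>)" for N by (rule tension_measurable[OF S \<delta>])
    have "prob {J \<in> space (couplings \<mu>). tension \<delta> S N J > \<tau> + e}
       \<le> prob {J \<in> space (couplings \<mu>). tension \<delta> S N J > expectation (tension \<delta> S l) + e / 2}" for N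
      using l by (intro finite_measure_mono) auto
    then show "(\<lambda>N. prob {J \<in> space (couplings \<mu>). tension \<delta> S N J > \<tau> + e}) \<longlonglongrightarrow> 0"
      by (intro tendsto_sandwich[OF _ _ tendsto_const tail]) auto
  qed (use tension_measurable[OF S \<delta>] \<tau> in auto)
  with \<tau> show ?thesis by blast
qed

end

theorem theorem1p3:
  fixes q \<beta> :: real and \<mu> :: "real measure" and n :: "real ^ 'd"
  assumes "CARD('d) \<ge> 2" and "q \<ge> 1" and "coupling_law \<mu>"
    and "\<beta> \<ge> 0" and "n \<in> sphere 0 1"
  shows "\<exists>\<tau>\<ge>0. \<forall>S\<in>unit_cubes n. \<forall>\<delta>>0.
           converges_in_probability (couplings \<mu>)
             (\<lambda>N J. surface_tension \<beta> q J 0 (real N) (\<delta> * real N) S n) \<tau>"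
  using tension_converges[OF assms(3,2,4,1)] .

end
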